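(* For a Zariski open subset $U\subset\mathbb{A}^n$, the following are equivalent: (1) $U$ is the image of a morphism from an affine space, i.e., there exist $m\in\mathbb{N}$ and a morphism $\mathbb{A}^m\to\mathbb{A}^n$ whose image is exactly $U$. (2) The complement $\mathbb{A}^n\setminus U$ is of codimension at least two in $\mathbb{A}^n$.
   Context: $\mathbb{A}^n$ denotes affine $n$-space over $\mathbb{C}$, and morphisms are morphisms of algebraic varieties over $\mathbb{C}$. The empty set is regarded as having codimension at least two. *)

theory Defs
  imports "HOL-Analysis.Analysis" "HOL-Library.Poly_Mapping"
begin

text \<open>
  Varieties are identified with their sets of closed points. Since both the dimension of the source
  and that of the target have to vary inside one formula, a point of affine \<open>n\<close>-space is a
  function on \<open>{..<n}\<close>, extended by \<^const>\<open>undefined\<close>. The space of dimension 0 is one point.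
\<close>

definition affine_space :: "nat \<Rightarrow> (nat \<Rightarrow> complex) set" where
  "affine_space n = {..<n} \<rightarrow>\<^sub>E UNIV"

type_synonym mpoly = "(nat \<Rightarrow>\<^sub>0 nat) \<Rightarrow>\<^sub>0 complex"

text \<open>The polynomial ring in the variables with index below \<open>n\<close>; exponent vectors have finite support.\<close>

definition polys :: "nat \<Rightarrow> mpoly set" where
  "polys n = {p. \<forall>m \<in> Poly_Mapping.keys p. Poly_Mapping.keys m \<subseteq> {..<n}}"

definition monom_eval :: "(nat \<Rightarrow>\<^sub>0 nat) \<Rightarrow> (nat \<Rightarrow> complex) \<Rightarrow> complex" where
  "monom_eval m x = (\<Prod>i \<in> Poly_Mapping.keys m. x i ^ Poly_Mapping.lookup m i)"

definition mpoly_eval :: "mpoly \<Rightarrow> (nat \<Rightarrow> complex) \<Rightarrow> complex" where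
  "mpoly_eval p x = (\<Sum>m \<in> Poly_Mapping.keys p. Poly_Mapping.lookup p m * monom_eval m x)"

definition zero_locus :: "nat \<Rightarrow> mpoly set \<Rightarrow> (nat \<Rightarrow> complex) set" where
  "zero_locus n S = {x \<in> affine_space n. \<forall>p \<in> S. mpoly_eval p x = 0}"

text \<open>The lemma \<open>closedin_zariski\<close> below shows that this is not a junk value of \<^const>\<open>topology\<close>.\<close>

definition zariski :: "nat \<Rightarrow> (nat \<Rightarrow> complex) topology" where
  "zariski n = topology (\<lambda>U. \<exists>S \<subseteq> polys n. U = affine_space n - zero_locus n S)"

lemma monom_eval_superset:
  assumes "finite I" "Poly_Mapping.keys m \<subseteq> I"
  shows "monom_eval m x = (\<Prod>i\<in>I. x i ^ Poly_Mapping.lookup m i)"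
  unfolding monom_eval_def
  by (rule prod.mono_neutral_left) (use assms in \<open>auto simp: in_keys_iff\<close>)

lemma monom_eval_add: "monom_eval (a + b) x = monom_eval a x * monom_eval b x"
proof -
  let ?I = "Poly_Mapping.keys a \<union> Poly_Mapping.keys b"
  show ?thesis
    using keys_add[of a b]
    by (simp add: monom_eval_superset[of ?I] lookup_add power_add prod.distrib)
qed

lemma mpoly_eval_superset:
  assumes "finite I" "Poly_Mapping.keys p \<subseteq> I"
  shows "mpoly_eval p x = (\<Sum>m\<in>I. Poly_Mapping.lookup p m * monom_eval m x)"
  unfolding mpoly_eval_def
  by (rule sum.mono_neutral_left) (use assms in \<open>auto simp: in_keys_iff\<close>)

lemma mpoly_eval_0 [simp]: "mpoly_eval 0 x = 0"
  by (simp add: mpoly_eval_def)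

lemma mpoly_eval_1 [simp]: "mpoly_eval 1 x = 1"
  by (simp add: mpoly_eval_def monom_eval_def)

lemma mpoly_eval_add: "mpoly_eval (p + q) x = mpoly_eval p x + mpoly_eval q x"
proof -
  let ?I = "Poly_Mapping.keys p \<union> Poly_Mapping.keys q"
  show ?thesis
    using keys_add[of p q]
    by (simp add: mpoly_eval_superset[of ?I] lookup_add algebra_simps sum.distrib)
qed

lemma mpoly_eval_sum: "mpoly_eval (\<Sum>i\<in>I. p i) x = (\<Sum>i\<in>I. mpoly_eval (p i) x)"
  by (induction I rule: infinite_finite_induct) (auto simp: mpoly_eval_add)

lemma mpoly_eval_single: "mpoly_eval (Poly_Mapping.single m c) x = c * monom_eval m x"
  by (simp add: mpoly_eval_def)

lemma mpoly_expand:
  "p = (\<Sum>m\<in>Poly_Mapping.keys p. Poly_Mapping.single m (Poly_Mapping.lookup p m))"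
  for p :: mpoly
  by (rule poly_mapping_eqI)
     (auto simp: lookup_sum lookup_single when_def sum.delta in_keys_iff if_distrib cong: if_cong)

lemma mpoly_eval_mult: "mpoly_eval (p * q) x = mpoly_eval p x * mpoly_eval q x"
proof -
  have "p * q = (\<Sum>a\<in>Poly_Mapping.keys p. \<Sum>b\<in>Poly_Mapping.keys q.
      Poly_Mapping.single (a + b) (Poly_Mapping.lookup p a * Poly_Mapping.lookup q b))"
    by (subst (1) mpoly_expand[of p], subst (1) mpoly_expand[of q])
       (simp add: sum_product mult_single)
  then have "mpoly_eval (p * q) x = (\<Sum>a\<in>Poly_Mapping.keys p. \<Sum>b\<in>Poly_Mapping.keys q.
      Poly_Mapping.lookup p a * Poly_Mapping.lookup q b * monom_eval (a + b) x)"
    by (simp add: mpoly_eval_sum mpoly_eval_single)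
  then show ?thesis
    by (simp add: monom_eval_add mpoly_eval_def[of p] mpoly_eval_def[of q] sum_product mult_ac)
qed

lemma polys_mult: "p \<in> polys n \<Longrightarrow> q \<in> polys n \<Longrightarrow> p * q \<in> polys n"
  unfolding polys_def
  by (auto dest!: subsetD[OF keys_mult] subsetD[OF keys_add])

lemma istopology_zariski: "istopology (\<lambda>U. \<exists>S \<subseteq> polys n. U = affine_space n - zero_locus n S)"
  (is "istopology ?P")
  unfolding istopology_def
proof (intro conjI allI impI)
  fix U V assume "?P U" "?P V"
  then obtain S T where S: "S \<subseteq> polys n" "U = affine_space n - zero_locus n S"
    and T: "T \<subseteq> polys n" "V = affine_space n - zero_locus n T" by blast
  let ?R = "(\<lambda>(p, q). p * q) ` (S \<times> T)"
  have "?R \<subseteq> polys n" using S T by (auto intro!: polys_mult)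
  moreover have "U \<inter> V = affine_space n - zero_locus n ?R"
    unfolding S T zero_locus_def by (auto simp: mpoly_eval_mult)
  ultimately show "?P (U \<inter> V)" by blast
next
  fix K assume K: "\<forall>U\<in>K. ?P U"
  define R where "R = \<Union> {S. S \<subseteq> polys n \<and> affine_space n - zero_locus n S \<in> K}"
  have "\<Union> K = affine_space n - zero_locus n R"
  proof
    show "\<Union> K \<subseteq> affine_space n - zero_locus n R"
    proof
      fix x assume "x \<in> \<Union> K"
      then obtain U where U: "x \<in> U" "U \<in> K" by blast
      with K obtain S where "S \<subseteq> polys n" "U = affine_space n - zero_locus n S" by blast
      with U show "x \<in> affine_space n - zero_locus n R"
        unfolding R_def zero_locus_def by blast
    qed
    show "affine_space n - zero_locus n R \<subseteq> \<Union> K"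
      unfolding R_def zero_locus_def by blast
  qed
  moreover have "R \<subseteq> polys n" unfolding R_def by blast
  ultimately show "?P (\<Union> K)" by blast
qed

lemma openin_zariski:
  "openin (zariski n) U \<longleftrightarrow> (\<exists>S \<subseteq> polys n. U = affine_space n - zero_locus n S)"
  unfolding zariski_def by (simp add: topology_inverse'[OF istopology_zariski])

lemma topspace_zariski [simp]: "topspace (zariski n) = affine_space n"
proof
  show "topspace (zariski n) \<subseteq> affine_space n"
    unfolding topspace_def openin_zariski by blast
  have "{1} \<subseteq> polys n" "affine_space n = affine_space n - zero_locus n {1}"
    by (auto simp: polys_def zero_locus_def)
  then have "openin (zariski n) (affine_space n)"
    unfolding openin_zariski by blast
  then show "affine_space n \<subseteq> topspace (zariski n)"
    by (rule openin_subset)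
qed

lemma closedin_zariski: "closedin (zariski n) Z \<longleftrightarrow> (\<exists>S \<subseteq> polys n. Z = zero_locus n S)"
proof -
  have "zero_locus n S \<subseteq> affine_space n" for S
    by (auto simp: zero_locus_def)
  then show ?thesis
    unfolding closedin_def openin_zariski topspace_zariski by (metis Diff_Diff_Int Int_absorb1 Diff_subset)
qed

text \<open>
  A function on an open subset \<open>V\<close> is regular if it is locally a quotient of polynomials, and a
  morphism is a continuous map that pulls regular functions on open sets back to regular functions.
\<close>

definition regular_fun :: "nat \<Rightarrow> (nat \<Rightarrow> complex) set \<Rightarrow> ((nat \<Rightarrow> complex) \<Rightarrow> complex) \<Rightarrow> bool" where
  "regular_fun n V \<phi> \<longleftrightarrow>
     (\<forall>x \<in> V. \<exists>W. openin (zariski n) W \<and> x \<in> W \<and> W \<subseteq> V \<and>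
        (\<exists>p \<in> polys n. \<exists>q \<in> polys n. \<forall>y \<in> W. mpoly_eval q y \<noteq> 0 \<and> \<phi> y = mpoly_eval p y / mpoly_eval q y))"

definition variety_morphism :: "nat \<Rightarrow> nat \<Rightarrow> ((nat \<Rightarrow> complex) \<Rightarrow> nat \<Rightarrow> complex) \<Rightarrow> bool" where
  "variety_morphism m n f \<longleftrightarrow>
     continuous_map (zariski m) (zariski n) f \<and>
     (\<forall>V \<phi>. openin (zariski n) V \<and> regular_fun n V \<phi> \<longrightarrow>
        regular_fun m {x \<in> affine_space m. f x \<in> V} (\<phi> \<circ> f))"

definition irreducible_space :: "'a topology \<Rightarrow> bool" where
  "irreducible_space X \<longleftrightarrow> topspace X \<noteq> {} \<and>
     (\<forall>A B. closedin X A \<and> closedin X B \<and> A \<union> B = topspace X \<longrightarrow> A = topspace X \<or> B = topspace X)"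

definition irreducible_closed :: "'a topology \<Rightarrow> 'a set \<Rightarrow> bool" where
  "irreducible_closed X Y \<longleftrightarrow> closedin X Y \<and> irreducible_space (subtopology X Y)"

definition irreducible_codim :: "'a topology \<Rightarrow> 'a set \<Rightarrow> enat" where
  "irreducible_codim X Y =
     Sup {enat k | k. \<exists>Z :: nat \<Rightarrow> 'a set. Z 0 = Y \<and>
            (\<forall>i\<le>k. irreducible_closed X (Z i)) \<and> (\<forall>i<k. Z i \<subset> Z (Suc i))}"

text \<open>
  The infimum over all irreducible closed subsets is attained at the irreducible components.
  For \<open>Z = {}\<close> it is \<^term>\<open>\<infinity> :: enat\<close>, so the empty set has codimension at least two.
\<close>

definition codim :: "'a topology \<Rightarrow> 'a set \<Rightarrow> enat" where
  "codim X Z = (INF Y \<in> {Y. irreducible_closed X Y \<and> Y \<subseteq> Z}. irreducible_codim X Y)"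

lemma codim_empty: "codim X {} = \<infinity>"
proof -
  have "{Y. irreducible_closed X Y \<and> Y \<subseteq> {}} = {}"
    by (auto simp: irreducible_closed_def irreducible_space_def)
  then show ?thesis
    unfolding codim_def by (metis INF_empty top_enat_def)
qed

end

theory Submission
  imports Defs "Subresultants.Subresultant_Gcd" "HOL-Computational_Algebra.Field_as_Ring"
    "HOL-Computational_Algebra.Fundamental_Theorem_Algebra"
begin

text \<open>
  Write \<open>Z\<close> for the complement of \<open>U\<close>.

  If \<open>Z\<close> has codimension at least two, \<open>U\<close> is swept out by flows. Let \<open>q\<close> be a polynomial that vanishes
  on \<open>Z\<close> and is constant along a direction \<open>e\<close>. Then \<open>x \<mapsto> x + t q(x) e\<close> maps \<open>U\<close> to itself for every
  time \<open>t\<close>: a point with \<open>q(x) = 0\<close> stays where it is, and if \<open>q(x) \<noteq> 0\<close> then the whole line \<open>x + \<complex>e\<close>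
  avoids \<open>Z\<close>. A composition of such flows, applied to one point of \<open>U\<close>, is a polynomial map from the
  affine space of the times into \<open>U\<close>. Flows in \<open>n\<close> independent directions reach every point off some
  hypersurface \<open>s = 0\<close> (\<open>reach_generic_points\<close>). A point \<open>v\<close> of \<open>U\<close> on that hypersurface is
  reached by one more flow with \<open>q(v) \<noteq> 0\<close> along a line that leaves the hypersurface, and by Hilbert's
  basis theorem finitely many flows serve all \<open>v\<close> (\<open>polymap_onto_complement\<close>). What remains is the
  supply of functions \<open>q\<close>. Codimension two enters through the fact that a generic line through \<open>v\<close>
  avoids \<open>Z\<close> (\<open>generic_line_avoids\<close>). A chain \<open>Y \<subset> Z\<^sub>1 \<subset> Z\<^sub>2\<close> gives two prime
  ideals, the smaller one nonzero, and the larger one then contains a nonzero polynomial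
  free of one variable (\<open>elimination\<close>); in the coordinates of the projection from \<open>v\<close> this polynomial
  cuts out a cone of exceptional directions. For a direction \<open>e\<close> off the cone, a resultant along \<open>e\<close> of two
  polynomials in the ideal of \<open>Z\<close> is the required \<open>q\<close> (\<open>shear_invariant_function\<close>).

  Conversely, let \<open>f\<close> be a morphism with image \<open>U\<close> and let \<open>Y\<close> be an irreducible closed
  subset of \<open>Z\<close>. It suffices to place an irreducible closed set strictly between \<open>Y\<close> and the whole
  space. Fix a generic direction \<open>e\<close>. If a nonzero polynomial constant along \<open>e\<close> vanishes on \<open>Y\<close>, then the
  common zeros of all such polynomials form the required set, a cylinder
  (\<open>irreducible_cylinder_between\<close>). If there is none, let \<open>H\<close> be a nonzero element of
  the ideal of \<open>Y\<close> of least degree along \<open>e\<close>, with leading coefficient \<open>l\<close>. On the image of a line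
  under \<open>f\<close>, Gauss' lemma makes \<open>H / l\<close> a polynomial in the parameter of the line, and a zero of it would
  be a parameter at which \<open>f\<close> hits \<open>Y\<close>. So \<open>H / l\<close> is constant on all these images, hence \<open>H\<close> is a
  constant multiple of \<open>l\<close>, which contradicts its positive degree along \<open>e\<close>
  (\<open>invariant_function_if_missed\<close>). The argument looks at \<open>f\<close> on lines only, where
  a morphism is polynomial for an elementary reason (\<open>regular_fun_line\<close>).
\<close>

section \<open>Polynomial functions\<close>

lemma polys_single:
  "Poly_Mapping.keys m \<subseteq> {..<n} \<Longrightarrow> Poly_Mapping.single m c \<in> polys n"
  by (auto simp: polys_def)

lemma polys_0 [simp]: "0 \<in> polys n"
  and polys_1 [simp]: "1 \<in> polys n"
  by (auto simp: polys_def)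

lemma polys_const [simp]: "Poly_Mapping.single 0 c \<in> polys n"
  by (rule polys_single) simp

lemma polys_add: "p \<in> polys n \<Longrightarrow> q \<in> polys n \<Longrightarrow> p + q \<in> polys n"
  using keys_add[of p q] unfolding polys_def by blast

lemma polys_uminus: "p \<in> polys n \<Longrightarrow> - p \<in> polys n"
  by (simp add: polys_def)

lemma polys_diff: "p \<in> polys n \<Longrightarrow> q \<in> polys n \<Longrightarrow> p - q \<in> polys n"
  using polys_add[OF _ polys_uminus] by fastforce

lemma polys_sum: "(\<And>i. i \<in> I \<Longrightarrow> p i \<in> polys n) \<Longrightarrow> sum p I \<in> polys n"
  by (induction I rule: infinite_finite_induct) (auto intro: polys_add)

lemma polys_prod: "(\<And>i. i \<in> I \<Longrightarrow> p i \<in> polys n) \<Longrightarrow> prod p I \<in> polys n"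
  by (induction I rule: infinite_finite_induct) (auto intro: polys_mult)

lemma polys_power: "p \<in> polys n \<Longrightarrow> p ^ i \<in> polys n"
  by (induction i) (auto intro: polys_mult)

lemma polys_mono: "m \<le> n \<Longrightarrow> p \<in> polys m \<Longrightarrow> p \<in> polys n"
  unfolding polys_def by fastforce

definition var :: "nat \<Rightarrow> mpoly" where
  "var i = Poly_Mapping.single (Poly_Mapping.single i 1) 1"

lemma polys_var: "i < n \<Longrightarrow> var i \<in> polys n"
  unfolding var_def by (rule polys_single) simp

lemma mpoly_eval_const [simp]: "mpoly_eval (Poly_Mapping.single 0 c) x = c"
  by (simp add: mpoly_eval_single monom_eval_def)

lemma mpoly_eval_var [simp]: "mpoly_eval (var i) x = x i"
  by (simp add: var_def mpoly_eval_single monom_eval_def)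

lemma mpoly_eval_uminus: "mpoly_eval (- p) x = - mpoly_eval p x"
  by (simp add: mpoly_eval_def sum_negf)

lemma mpoly_eval_diff: "mpoly_eval (p - q) x = mpoly_eval p x - mpoly_eval q x"
  using mpoly_eval_add[of p "- q" x] by (simp add: mpoly_eval_uminus)

lemma mpoly_eval_hom: "comm_ring_hom (\<lambda>p. mpoly_eval p x)"
  by standard (auto simp: mpoly_eval_add mpoly_eval_mult)

lemma mpoly_eval_cong:
  assumes "p \<in> polys n" "\<And>i. i < n \<Longrightarrow> x i = y i"
  shows "mpoly_eval p x = mpoly_eval p y"
proof -
  have "monom_eval m x = monom_eval m y" if "m \<in> Poly_Mapping.keys p" for m
    unfolding monom_eval_def using assms that unfolding polys_def
    by (intro prod.cong) (auto simp: subset_iff)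
  then show ?thesis
    unfolding mpoly_eval_def by (intro sum.cong) auto
qed

lemma single_monom_var:
  "Poly_Mapping.single (a + Poly_Mapping.single i j) c = Poly_Mapping.single a c * var i ^ j"
proof (induction j)
  case (Suc j)
  have "Poly_Mapping.single (a + Poly_Mapping.single i (Suc j)) c
      = Poly_Mapping.single ((a + Poly_Mapping.single i j) + Poly_Mapping.single i 1) (c * 1)"
    by (simp add: add.assoc flip: single_add)
  also have "\<dots> = Poly_Mapping.single (a + Poly_Mapping.single i j) c * var i"
    unfolding var_def by (rule mult_single[symmetric])
  finally show ?case
    using Suc by (simp add: mult_ac)
qed auto

text \<open>
  Splitting off the last variable lets division, degrees and resultants in one variable act on
  polynomials in several variables.
\<close>

lemma polys_Suc_ex_poly:
  assumes "p \<in> polys (Suc k)"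
  shows "\<exists>P. (\<forall>i. coeff P i \<in> polys k) \<and> p = poly P (var k)"
proof -
  have *: "\<exists>P. (\<forall>i. coeff P i \<in> polys k) \<and> Poly_Mapping.single m c = poly P (var k)"
    if "m \<in> Poly_Mapping.keys p" for m c
  proof -
    let ?j = "Poly_Mapping.lookup m k"
    define a where "a = m - Poly_Mapping.single k ?j"
    have la: "Poly_Mapping.lookup a i = (if i = k then 0 else Poly_Mapping.lookup m i)" for i
      by (simp add: a_def lookup_minus lookup_single when_def)
    have m: "m = a + Poly_Mapping.single k ?j"
      by (rule poly_mapping_eqI) (simp add: la lookup_add lookup_single when_def)
    have "Poly_Mapping.keys a \<subseteq> {..<k}"
    proof
      fix i assume "i \<in> Poly_Mapping.keys a"
      then have "i \<noteq> k" "i \<in> Poly_Mapping.keys m"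
        by (auto simp: in_keys_iff la split: if_splits)
      with that assms show "i \<in> {..<k}"
        unfolding polys_def by fastforce
    qed
    then have "Poly_Mapping.single a c \<in> polys k"
      by (rule polys_single)
    moreover have "Poly_Mapping.single m c = poly (Polynomial.monom (Poly_Mapping.single a c) ?j) (var k)"
      by (subst m, subst single_monom_var) (simp add: poly_monom)
    ultimately show ?thesis
      by (intro exI[of _ "Polynomial.monom (Poly_Mapping.single a c) ?j"]) auto
  qed
  define P where "P = (\<lambda>m. SOME P. (\<forall>i. coeff P i \<in> polys k) \<and>
     Poly_Mapping.single m (Poly_Mapping.lookup p m) = poly P (var k))"
  have P: "(\<forall>i. coeff (P m) i \<in> polys k) \<and>
     Poly_Mapping.single m (Poly_Mapping.lookup p m) = poly (P m) (var k)"
    if "m \<in> Poly_Mapping.keys p" for m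
    unfolding P_def by (rule someI_ex) (rule *[OF that])
  have "p = (\<Sum>m\<in>Poly_Mapping.keys p. poly (P m) (var k))"
    by (subst mpoly_expand) (intro sum.cong refl, use P in auto)
  then have "p = poly (\<Sum>m\<in>Poly_Mapping.keys p. P m) (var k)"
    by (simp add: poly_sum)
  moreover have "coeff (\<Sum>m\<in>Poly_Mapping.keys p. P m) i \<in> polys k" for i
    unfolding coeff_sum using P by (intro polys_sum) auto
  ultimately show ?thesis by blast
qed

lemma polys_poly_var: "(\<And>i. coeff P i \<in> polys k) \<Longrightarrow> poly P (var k) \<in> polys (Suc k)"
  unfolding poly_altdef
  by (intro polys_sum polys_mult polys_power polys_var) (auto intro: polys_mono[of k "Suc k"])

lemma mpoly_eval_poly_var:
  "mpoly_eval (poly P (var k)) x = poly (map_poly (\<lambda>p. mpoly_eval p x) P) (x k)"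
proof -
  interpret comm_ring_hom "\<lambda>p. mpoly_eval p x" by (rule mpoly_eval_hom)
  show ?thesis using poly_map_poly[of P "var k"] by simp
qed

lemma map_poly_eval_cong:
  assumes "\<And>i. coeff P i \<in> polys k" "\<And>i. i < k \<Longrightarrow> x i = y i"
  shows "map_poly (\<lambda>p. mpoly_eval p x) P = map_poly (\<lambda>p. mpoly_eval p y) P"
  by (rule poly_eqI) (simp add: coeff_map_poly mpoly_eval_cong[OF assms])

lemma polys_0_eq:
  assumes "p \<in> polys 0"
  shows "p = Poly_Mapping.single 0 (mpoly_eval p x)"
proof -
  have k: "Poly_Mapping.keys p \<subseteq> {0}"
    using assms by (auto simp: polys_def)
  then have "mpoly_eval p x = Poly_Mapping.lookup p 0"
    by (subst mpoly_eval_superset[of "{0}"]) (auto simp: monom_eval_def)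
  then show ?thesis
    using k by (intro poly_mapping_eqI) (auto simp: lookup_single when_def in_keys_iff)
qed

text \<open>
  Induction on the number of variables: some coefficient with respect to the last variable is nonzero
  at a point, and a nonzero polynomial in one variable has finitely many roots.
\<close>

lemma mpoly_nonzero_ex_eval:
  assumes "p \<in> polys n" "p \<noteq> 0"
  shows "\<exists>x. mpoly_eval p x \<noteq> 0"
  using assms
proof (induction n arbitrary: p)
  case 0
  then show ?case using polys_0_eq[of p] by (metis single_zero)
next
  case (Suc k)
  then obtain P where P: "\<And>i. coeff P i \<in> polys k" "p = poly P (var k)"
    using polys_Suc_ex_poly by blast
  with Suc.prems have "P \<noteq> 0" by auto
  then have "coeff P (degree P) \<noteq> 0" by simp
  then obtain x where x: "mpoly_eval (coeff P (degree P)) x \<noteq> 0"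
    using Suc.IH[OF P(1)] by blast
  let ?R = "map_poly (\<lambda>p. mpoly_eval p x) P"
  have "coeff ?R (degree P) \<noteq> 0"
    using x by (simp add: coeff_map_poly)
  then have "?R \<noteq> 0" by auto
  then have "finite {t. poly ?R t = 0}" by (rule poly_roots_finite)
  then obtain t where t: "poly ?R t \<noteq> 0"
    using ex_new_if_finite[OF infinite_UNIV_char_0] by blast
  have "mpoly_eval p (x(k := t)) = poly ?R t"
    unfolding P(2) mpoly_eval_poly_var
    by (subst map_poly_eval_cong[of P k _ x]) (use P in auto)
  with t show ?case by metis
qed

lemma mpoly_eq_iff_eval:
  assumes "p \<in> polys n" "q \<in> polys n"
  shows "p = q \<longleftrightarrow> (\<forall>x. mpoly_eval p x = mpoly_eval q x)"
  using mpoly_nonzero_ex_eval[OF polys_diff[OF assms]] by (auto simp: mpoly_eval_diff)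

text \<open>
  Coordinate changes and compositions are easier to state for functions than for formal polynomials.
  A point is an arbitrary function on \<open>nat\<close> here; only the coordinates below \<open>n\<close> matter.
\<close>

definition mpolyfun :: "nat \<Rightarrow> ((nat \<Rightarrow> complex) \<Rightarrow> complex) \<Rightarrow> bool" where
  "mpolyfun n F \<longleftrightarrow> (\<exists>p \<in> polys n. F = mpoly_eval p)"

lemma mpolyfunI: "p \<in> polys n \<Longrightarrow> (\<And>x. F x = mpoly_eval p x) \<Longrightarrow> mpolyfun n F"
  unfolding mpolyfun_def by (intro bexI[of _ p]) auto

lemma mpolyfunE:
  assumes "mpolyfun n F"
  obtains p where "p \<in> polys n" "F = mpoly_eval p"
  using assms unfolding mpolyfun_def by blast

lemma mpolyfun_eval [intro]: "p \<in> polys n \<Longrightarrow> mpolyfun n (mpoly_eval p)"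
  by (auto simp: mpolyfun_def)

lemma mpolyfun_const [intro]: "mpolyfun n (\<lambda>x. c)"
  by (rule mpolyfunI[of "Poly_Mapping.single 0 c"]) auto

lemma mpolyfun_coord [intro]: "i < n \<Longrightarrow> mpolyfun n (\<lambda>x. x i)"
  by (rule mpolyfunI[of "var i"]) (auto intro: polys_var)

lemma mpolyfun_add [intro]: "mpolyfun n F \<Longrightarrow> mpolyfun n G \<Longrightarrow> mpolyfun n (\<lambda>x. F x + G x)"
  by (elim mpolyfunE, rule mpolyfunI[OF polys_add]) (auto simp: mpoly_eval_add)

lemma mpolyfun_mult [intro]: "mpolyfun n F \<Longrightarrow> mpolyfun n G \<Longrightarrow> mpolyfun n (\<lambda>x. F x * G x)"
  by (elim mpolyfunE, rule mpolyfunI[OF polys_mult]) (auto simp: mpoly_eval_mult)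

lemma mpolyfun_diff [intro]: "mpolyfun n F \<Longrightarrow> mpolyfun n G \<Longrightarrow> mpolyfun n (\<lambda>x. F x - G x)"
  by (elim mpolyfunE, rule mpolyfunI[OF polys_diff]) (auto simp: mpoly_eval_diff)

lemma mpolyfun_power [intro]: "mpolyfun n F \<Longrightarrow> mpolyfun n (\<lambda>x. F x ^ i)"
  by (induction i) auto

lemma mpolyfun_sum [intro]:
  "(\<And>i. i \<in> I \<Longrightarrow> mpolyfun n (F i)) \<Longrightarrow> mpolyfun n (\<lambda>x. \<Sum>i\<in>I. F i x)"
  by (induction I rule: infinite_finite_induct) auto

lemma mpolyfun_prod [intro]:
  "(\<And>i. i \<in> I \<Longrightarrow> mpolyfun n (F i)) \<Longrightarrow> mpolyfun n (\<lambda>x. \<Prod>i\<in>I. F i x)"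
  by (induction I rule: infinite_finite_induct) auto

lemma mpolyfun_mono: "m \<le> n \<Longrightarrow> mpolyfun m F \<Longrightarrow> mpolyfun n F"
  unfolding mpolyfun_def using polys_mono by blast

lemma mpolyfun_cong:
  assumes "mpolyfun n F" "\<And>i. i < n \<Longrightarrow> x i = y i"
  shows "F x = F y"
  using assms mpoly_eval_cong unfolding mpolyfun_def by blast

lemma mpolyfun_induct [consumes 1, case_names const coord add mult]:
  assumes "mpolyfun n F"
    and const: "\<And>c. P (\<lambda>x. c)" and coord: "\<And>i. i < n \<Longrightarrow> P (\<lambda>x. x i)"
    and add: "\<And>F G. mpolyfun n F \<Longrightarrow> mpolyfun n G \<Longrightarrow> P F \<Longrightarrow> P G \<Longrightarrow> P (\<lambda>x. F x + G x)"
    and mult: "\<And>F G. mpolyfun n F \<Longrightarrow> mpolyfun n G \<Longrightarrow> P F \<Longrightarrow> P G \<Longrightarrow> P (\<lambda>x. F x * G x)"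
  shows "P F"
proof -
  obtain p where p: "p \<in> polys n" "F = mpoly_eval p"
    using assms(1) by (rule mpolyfunE)
  let ?Q = "\<lambda>F. mpolyfun n F \<and> P F"
  have pow: "?Q (\<lambda>x. x i ^ j)" if "i < n" for i j
    using that by (induction j) (auto intro: const coord mult)
  have "?Q (\<lambda>x. \<Prod>i\<in>I. x i ^ f i)" if "finite I" "I \<subseteq> {..<n}" for I f
    using that
  proof (induction I rule: finite_induct)
    case (insert i I)
    then show ?case
      using pow[of i "f i"] mult[of "\<lambda>x. x i ^ f i" "\<lambda>x. \<Prod>i\<in>I. x i ^ f i"] by auto
  qed (auto intro: const)
  then have mon: "?Q (\<lambda>x. c * monom_eval m x)" if "m \<in> Poly_Mapping.keys p" for m c
    using that p(1) mult[OF mpolyfun_const] const unfolding monom_eval_def polys_def by auto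
  have "?Q (\<lambda>x. \<Sum>m\<in>M. Poly_Mapping.lookup p m * monom_eval m x)"
    if "finite M" "M \<subseteq> Poly_Mapping.keys p" for M
    using that
  proof (induction M rule: finite_induct)
    case (insert m M)
    then show ?case
      using mon[of m "Poly_Mapping.lookup p m"]
        add[of "\<lambda>x. Poly_Mapping.lookup p m * monom_eval m x"
          "\<lambda>x. \<Sum>m\<in>M. Poly_Mapping.lookup p m * monom_eval m x"] by auto
  qed (auto intro: const)
  from this[of "Poly_Mapping.keys p"] show ?thesis
    unfolding p(2) mpoly_eval_def by simp
qed

lemma mpolyfun_compose:
  assumes "mpolyfun k F" "\<And>i. i < k \<Longrightarrow> mpolyfun n (\<lambda>x. G x i)"
  shows "mpolyfun n (\<lambda>x. F (G x))"
  using assms(1) by (induction rule: mpolyfun_induct) (use assms(2) in auto)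

lemma mpolyfun_nonzero_mult:
  assumes "mpolyfun n F" "mpolyfun n G" "F x \<noteq> 0" "G y \<noteq> 0"
  shows "\<exists>z. F z \<noteq> 0 \<and> G z \<noteq> 0"
proof -
  obtain p q where p: "p \<in> polys n" "F = mpoly_eval p" and q: "q \<in> polys n" "G = mpoly_eval q"
    using assms by (elim mpolyfunE) auto
  have "p \<noteq> 0" "q \<noteq> 0" using p q assms by auto
  then have "p * q \<noteq> 0" by simp
  then obtain z where "mpoly_eval (p * q) z \<noteq> 0"
    using mpoly_nonzero_ex_eval[OF polys_mult[OF p(1) q(1)]] by blast
  then show ?thesis unfolding p q by (auto simp: mpoly_eval_mult)
qed

lemma mpoly_eval_curve:
  "\<exists>r. \<forall>s. poly r s = mpoly_eval p (\<lambda>i. poly (\<gamma> i) s)"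
  unfolding mpoly_eval_def monom_eval_def
  by (rule exI[of _ "\<Sum>m\<in>Poly_Mapping.keys p. Polynomial.smult (Poly_Mapping.lookup p m)
      (\<Prod>i\<in>Poly_Mapping.keys m. \<gamma> i ^ Poly_Mapping.lookup m i)"]) (simp add: poly_sum poly_prod)

section \<open>Irreducible closed sets and codimension\<close>

definition vanishes_on :: "mpoly \<Rightarrow> (nat \<Rightarrow> complex) set \<Rightarrow> bool" where
  "vanishes_on p X \<longleftrightarrow> (\<forall>x\<in>X. mpoly_eval p x = 0)"

text \<open>
  The polynomials vanishing on \<open>X\<close> form a prime ideal or the whole ring. The case \<open>X = {}\<close> is allowed.
\<close>

definition prime_on :: "nat \<Rightarrow> (nat \<Rightarrow> complex) set \<Rightarrow> bool" where
  "prime_on n X \<longleftrightarrow> (\<forall>p\<in>polys n. \<forall>q\<in>polys n.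
     vanishes_on (p * q) X \<longrightarrow> vanishes_on p X \<or> vanishes_on q X)"

lemma prime_onD:
  "prime_on n X \<Longrightarrow> p \<in> polys n \<Longrightarrow> q \<in> polys n \<Longrightarrow> (\<And>x. x \<in> X \<Longrightarrow> mpoly_eval p x * mpoly_eval q x = 0)
    \<Longrightarrow> vanishes_on p X \<or> vanishes_on q X"
  unfolding prime_on_def vanishes_on_def mpoly_eval_mult by blast

abbreviation aff_proj :: "nat \<Rightarrow> (nat \<Rightarrow> complex) \<Rightarrow> nat \<Rightarrow> complex" where
  "aff_proj n x \<equiv> restrict x {..<n}"

lemma aff_proj_in [simp]: "aff_proj n x \<in> affine_space n"
  by (auto simp: affine_space_def)

lemma aff_proj_id: "x \<in> affine_space n \<Longrightarrow> aff_proj n x = x"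
  by (simp add: affine_space_def PiE_restrict)

lemma aff_proj_cong: "(\<And>i. i < n \<Longrightarrow> x i = y i) \<Longrightarrow> aff_proj n x = aff_proj n y"
  by (auto simp: restrict_def)

lemma mpoly_eval_aff_proj: "p \<in> polys n \<Longrightarrow> mpoly_eval p (aff_proj n x) = mpoly_eval p x"
  by (rule mpoly_eval_cong) auto

lemma closedin_zariski_zero_locus: "p \<in> polys n \<Longrightarrow> closedin (zariski n) (zero_locus n {p})"
  unfolding closedin_zariski by blast

lemma closedin_zariski_subset: "closedin (zariski n) Y \<Longrightarrow> Y \<subseteq> affine_space n"
  using closedin_subset[of "zariski n"] by simp

lemma closedin_zariski_separate:
  assumes "closedin (zariski n) Y" "x \<in> affine_space n" "x \<notin> Y"
  obtains p where "p \<in> polys n" "vanishes_on p Y" "mpoly_eval p x \<noteq> 0"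
  using assms unfolding closedin_zariski zero_locus_def vanishes_on_def by blast

text \<open>
  A decomposition into two closed sets and a product that vanishes on \<open>Y\<close> determine each other: separate
  one point from each part, or intersect \<open>Y\<close> with the zero sets of the two factors.
\<close>

lemma irreducible_closed_zariski_iff:
  "irreducible_closed (zariski n) Y \<longleftrightarrow> closedin (zariski n) Y \<and> Y \<noteq> {} \<and> prime_on n Y"
proof (cases "closedin (zariski n) Y")
  case True
  note Ysub = closedin_zariski_subset[OF True]
  have top: "topspace (subtopology (zariski n) Y) = Y"
    using Ysub by (auto simp: topspace_subtopology)
  have "(\<forall>A B. closedin (zariski n) A \<and> A \<subseteq> Y \<and> closedin (zariski n) B \<and> B \<subseteq> Y \<and> A \<union> B = Y
            \<longrightarrow> A = Y \<or> B = Y) \<longleftrightarrow> prime_on n Y" (is "?irr \<longleftrightarrow> _")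
  proof
    assume irr: ?irr
    show "prime_on n Y"
      unfolding prime_on_def
    proof (intro ballI impI)
      fix p q assume pq: "p \<in> polys n" "q \<in> polys n" "vanishes_on (p * q) Y"
      let ?A = "Y \<inter> zero_locus n {p}" and ?B = "Y \<inter> zero_locus n {q}"
      have "closedin (zariski n) ?A" "closedin (zariski n) ?B"
        using True pq by (auto intro: closedin_zariski_zero_locus)
      moreover have "?A \<union> ?B = Y"
        using pq(3) Ysub by (auto simp: vanishes_on_def zero_locus_def mpoly_eval_mult)
      ultimately have "?A = Y \<or> ?B = Y"
        using irr by (metis Int_lower1)
      then show "vanishes_on p Y \<or> vanishes_on q Y"
        by (auto simp: vanishes_on_def zero_locus_def)
    qed
  next
    assume prime: "prime_on n Y"
    show ?irr
    proof (intro allI impI, elim conjE, rule ccontr)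
      fix A B
      assume A: "closedin (zariski n) A" "A \<subseteq> Y" and B: "closedin (zariski n) B" "B \<subseteq> Y"
        and AB: "A \<union> B = Y" and "\<not> (A = Y \<or> B = Y)"
      then obtain x y where x: "x \<in> Y" "x \<notin> A" and y: "y \<in> Y" "y \<notin> B" by blast
      obtain p where p: "p \<in> polys n" "vanishes_on p A" "mpoly_eval p x \<noteq> 0"
        using closedin_zariski_separate[OF A(1)] x Ysub by blast
      obtain q where q: "q \<in> polys n" "vanishes_on q B" "mpoly_eval q y \<noteq> 0"
        using closedin_zariski_separate[OF B(1)] y Ysub by blast
      have "vanishes_on (p * q) Y"
        using p q AB by (auto simp: vanishes_on_def mpoly_eval_mult)
      then have "vanishes_on p Y \<or> vanishes_on q Y"
        using prime p q unfolding prime_on_def by blast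
      then show False using p q x y by (auto simp: vanishes_on_def)
    qed
  qed
  then show ?thesis
    unfolding irreducible_closed_def irreducible_space_def top
      closedin_closed_subtopology[OF True] using True by blast
qed (auto simp: irreducible_closed_def)

lemma irreducible_closed_affine_space: "irreducible_closed (zariski n) (affine_space n)"
proof -
  have "prime_on n (affine_space n)"
    unfolding prime_on_def
  proof (intro ballI impI)
    fix p q assume pq: "p \<in> polys n" "q \<in> polys n" "vanishes_on (p * q) (affine_space n)"
    have "mpoly_eval (p * q) x = 0" for x
      using pq(3) mpoly_eval_aff_proj[OF polys_mult[OF pq(1,2)], of x]
      by (metis vanishes_on_def aff_proj_in)
    then have "p * q = 0"
      using mpoly_nonzero_ex_eval[OF polys_mult[OF pq(1,2)]] by blast
    then show "vanishes_on p (affine_space n) \<or> vanishes_on q (affine_space n)"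
      by (auto simp: vanishes_on_def)
  qed
  moreover have "closedin (zariski n) (affine_space n)"
    using closedin_topspace[of "zariski n"] by simp
  moreover have "affine_space n \<noteq> {}"
    using aff_proj_in by blast
  ultimately show ?thesis
    by (simp add: irreducible_closed_zariski_iff)
qed

lemma irreducible_codim_ge_2_iff:
  assumes "irreducible_closed X Y"
  shows "irreducible_codim X Y \<ge> 2 \<longleftrightarrow>
    (\<exists>Z\<^sub>1 Z\<^sub>2. irreducible_closed X Z\<^sub>1 \<and> irreducible_closed X Z\<^sub>2 \<and> Y \<subset> Z\<^sub>1 \<and> Z\<^sub>1 \<subset> Z\<^sub>2)"
proof
  let ?C = "\<lambda>k Z. Z 0 = Y \<and> (\<forall>i\<le>k. irreducible_closed X (Z i)) \<and> (\<forall>i<k. Z i \<subset> Z (Suc i))"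
  assume ge: "irreducible_codim X Y \<ge> 2"
  have "\<exists>k Z. ?C k Z \<and> k \<ge> 2"
  proof (rule ccontr)
    assume neg: "\<not> ?thesis"
    have "irreducible_codim X Y \<le> enat 1"
      unfolding irreducible_codim_def
    proof (rule Sup_least)
      fix e assume "e \<in> {enat k |k. \<exists>Z. ?C k Z}"
      then obtain k Z where "e = enat k" "?C k Z" by blast
      with neg have "\<not> k \<ge> 2" by blast
      with \<open>e = enat k\<close> show "e \<le> enat 1" by simp
    qed
    with ge have "(2::enat) \<le> enat 1" by (rule order_trans)
    then show False by (simp add: numeral_eq_enat)
  qed
  then obtain k Z where Z: "?C k Z" and "k \<ge> 2" by blast
  have "0 < k" "1 < k" using \<open>k \<ge> 2\<close> by auto
  with Z \<open>k \<ge> 2\<close> have "irreducible_closed X (Z 1)" "irreducible_closed X (Z 2)" "Z 0 \<subset> Z (Suc 0)"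
    "Z (Suc 0) \<subset> Z (Suc (Suc 0))" "Z 0 = Y"
    by (metis less_imp_le, metis, metis, metis One_nat_def, metis)
  then show "\<exists>Z\<^sub>1 Z\<^sub>2. irreducible_closed X Z\<^sub>1 \<and> irreducible_closed X Z\<^sub>2 \<and> Y \<subset> Z\<^sub>1 \<and> Z\<^sub>1 \<subset> Z\<^sub>2"
    by (metis One_nat_def numeral_2_eq_2)
next
  assume "\<exists>Z\<^sub>1 Z\<^sub>2. irreducible_closed X Z\<^sub>1 \<and> irreducible_closed X Z\<^sub>2 \<and> Y \<subset> Z\<^sub>1 \<and> Z\<^sub>1 \<subset> Z\<^sub>2"
  then obtain Z1 Z2 where Z: "irreducible_closed X Z1" "irreducible_closed X Z2" "Y \<subset> Z1" "Z1 \<subset> Z2"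
    by blast
  let ?Z = "\<lambda>i::nat. if i = 0 then Y else if i = 1 then Z1 else Z2"
  have "enat 2 \<le> irreducible_codim X Y"
    unfolding irreducible_codim_def
    by (rule Sup_upper, rule CollectI, rule exI[of _ 2], intro conjI refl exI[of _ ?Z])
       (use Z assms in \<open>auto simp: less_2_cases_iff\<close>)
  then show "irreducible_codim X Y \<ge> 2" by (simp add: numeral_eq_enat)
qed

text \<open>
  Every irreducible closed subset is tested, not only the components. This form is the only one in which
  the codimension is used below.
\<close>

lemma codim_ge_2_iff:
  "codim X Z \<ge> 2 \<longleftrightarrow> (\<forall>Y. irreducible_closed X Y \<and> Y \<subseteq> Z \<longrightarrow>
    (\<exists>Z\<^sub>1 Z\<^sub>2. irreducible_closed X Z\<^sub>1 \<and> irreducible_closed X Z\<^sub>2 \<and> Y \<subset> Z\<^sub>1 \<and> Z\<^sub>1 \<subset> Z\<^sub>2))"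
  unfolding codim_def le_INF_iff using irreducible_codim_ge_2_iff by blast

section \<open>Elimination\<close>

text \<open>
  The ring \<open>A[t]\<close> over the ring \<open>A\<close> of polynomials in the variables below \<open>k\<close>. Its coefficients live
  in the integral domain of all polynomials, so that degrees behave as usual.
\<close>

definition upolys :: "nat \<Rightarrow> mpoly poly set" where
  "upolys k = {P. \<forall>i. coeff P i \<in> polys k}"

lemma upolys_0 [simp]: "0 \<in> upolys k"
  by (simp add: upolys_def)

lemma upolys_const: "a \<in> polys k \<Longrightarrow> [:a:] \<in> upolys k"
  by (auto simp: upolys_def coeff_pCons split: nat.splits)

lemma upolys_monom: "a \<in> polys k \<Longrightarrow> Polynomial.monom a i \<in> upolys k"
  by (auto simp: upolys_def)

lemma upolys_add: "P \<in> upolys k \<Longrightarrow> Q \<in> upolys k \<Longrightarrow> P + Q \<in> upolys k"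
  and upolys_diff: "P \<in> upolys k \<Longrightarrow> Q \<in> upolys k \<Longrightarrow> P - Q \<in> upolys k"
  and upolys_mult: "P \<in> upolys k \<Longrightarrow> Q \<in> upolys k \<Longrightarrow> P * Q \<in> upolys k"
  by (auto simp: upolys_def coeff_mult intro: polys_add polys_diff polys_sum polys_mult)

lemma upolys_smult: "a \<in> polys k \<Longrightarrow> P \<in> upolys k \<Longrightarrow> Polynomial.smult a P \<in> upolys k"
  by (auto simp: upolys_def intro: polys_mult)

lemma upolys_coeff: "P \<in> upolys k \<Longrightarrow> coeff P i \<in> polys k"
  by (simp add: upolys_def)

lemma upolys_poly_var: "P \<in> upolys k \<Longrightarrow> poly P (var k) \<in> polys (Suc k)"
  by (rule polys_poly_var) (simp add: upolys_def)

text \<open>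
  Pseudo-division inside the subring \<open>A\<close>: the quotient and the remainder have coefficients in \<open>A\<close>
  again.
\<close>

lemma upolys_pseudo_division:
  assumes H: "H \<in> upolys k" "H \<noteq> 0" and P: "P \<in> upolys k"
  shows "\<exists>j Q R. Q \<in> upolys k \<and> R \<in> upolys k \<and>
     Polynomial.smult (lead_coeff H ^ j) P = Q * H + R \<and> (R = 0 \<or> degree R < degree H)"
  using P
proof (induction "degree P" arbitrary: P rule: less_induct)
  case less
  show ?case
  proof (cases "P = 0 \<or> degree P < degree H")
    case True
    then show ?thesis
      using less.prems by (intro exI[of _ 0] exI[of _ P]) auto
  next
    case False
    let ?l = "lead_coeff H" and ?M = "Polynomial.monom (lead_coeff P) (degree P - degree H)"
    have M: "?M \<in> upolys k"
      using less.prems by (intro upolys_monom upolys_coeff)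
    define P' where "P' = Polynomial.smult ?l P - ?M * H"
    have P': "P' \<in> upolys k"
      unfolding P'_def using less.prems H M by (intro upolys_diff upolys_mult upolys_smult upolys_coeff)
    have "degree (?M * H) = degree P"
      using False H by (subst degree_mult_eq) (auto simp: degree_monom_eq)
    then have "degree P' \<le> degree P"
      unfolding P'_def by (intro degree_diff_le) auto
    moreover have "coeff P' (degree P) = 0"
      using False by (simp add: P'_def coeff_monom_mult)
    ultimately have deg: "P' = 0 \<or> degree P' < degree P"
      by (metis leading_coeff_0_iff le_neq_implies_less)
    have eq: "Polynomial.smult ?l P = P' + ?M * H"
      by (simp add: P'_def)
    show ?thesis
    proof (cases "P' = 0")
      case True
      with eq M show ?thesis
        by (intro exI[of _ 1] exI[of _ ?M] exI[of _ 0]) auto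
    next
      case False
      with deg less.hyps P' obtain j Q R where *: "Q \<in> upolys k" "R \<in> upolys k"
        "Polynomial.smult (?l ^ j) P' = Q * H + R" "R = 0 \<or> degree R < degree H" by blast
      have "Polynomial.smult (?l ^ Suc j) P = Polynomial.smult (?l ^ j) (Polynomial.smult ?l P)"
        by (simp add: mult.commute)
      also have "\<dots> = (Q + Polynomial.smult (?l ^ j) ?M) * H + R"
        unfolding eq smult_add_right *(3) by (simp add: algebra_simps)
      finally show ?thesis
        using * M H by (intro exI[of _ "Suc j"] exI[of _ "Q + Polynomial.smult (?l ^ j) ?M"] exI[of _ R])
          (auto intro!: upolys_add upolys_smult polys_power upolys_coeff)
    qed
  qed
qed

lemma vanishes_on_mult1: "vanishes_on p X \<Longrightarrow> vanishes_on (q * p) X"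
  by (simp add: vanishes_on_def mpoly_eval_mult)

lemma vanishes_on_diff: "vanishes_on p X \<Longrightarrow> vanishes_on q X \<Longrightarrow> vanishes_on (p - q) X"
  by (simp add: vanishes_on_def mpoly_eval_diff)

lemma vanishes_on_add: "vanishes_on p X \<Longrightarrow> vanishes_on q X \<Longrightarrow> vanishes_on (p + q) X"
  by (simp add: vanishes_on_def mpoly_eval_add)

lemma vanishes_on_power: "vanishes_on (p ^ j) X \<Longrightarrow> vanishes_on p X \<or> X = {}"
proof -
  have "mpoly_eval (p ^ j) x = mpoly_eval p x ^ j" for x
    by (induction j) (auto simp: mpoly_eval_mult)
  then show "vanishes_on (p ^ j) X \<Longrightarrow> vanishes_on p X \<or> X = {}"
    by (auto simp: vanishes_on_def)
qed

text \<open>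
  The ideals \<open>0 \<noteq> I\<^sub>1 \<subset> I\<^sub>0\<close> of \<open>T\<^sub>1\<close> and \<open>T\<^sub>0\<close> in \<open>A[t]\<close> cannot both meet \<open>A\<close> in zero, since
  over the field of fractions of \<open>A\<close> a nonzero prime ideal is maximal. Fractions are avoided by taking
  \<open>H \<in> I\<^sub>1\<close> nonzero and \<open>G \<in> I\<^sub>0\<close> outside \<open>I\<^sub>1\<close>, both of least degree in \<open>t\<close>, and
  pseudo-dividing the one of larger degree by the other. The remainder lies in \<open>I\<^sub>1\<close>, and
  primality then contradicts one of the two choices.
\<close>

lemma elimination:
  assumes prime: "prime_on (Suc k) T\<^sub>1"
    and sub: "\<And>p. p \<in> polys (Suc k) \<Longrightarrow> vanishes_on p T\<^sub>1 \<Longrightarrow> vanishes_on p T\<^sub>0"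
    and h: "h \<in> polys (Suc k)" "h \<noteq> 0" "vanishes_on h T\<^sub>1"
    and g: "g \<in> polys (Suc k)" "vanishes_on g T\<^sub>0" "\<not> vanishes_on g T\<^sub>1"
  shows "\<exists>a\<in>polys k. a \<noteq> 0 \<and> vanishes_on a T\<^sub>0"
proof (rule ccontr)
  assume "\<not> ?thesis"
  then have none: "a = 0" if "a \<in> polys k" "vanishes_on a T\<^sub>0" for a
    using that by blast
  define V where "V = (\<lambda>T P. P \<in> upolys k \<and> vanishes_on (poly P (var k)) T)"
  have V_sub: "V T\<^sub>0 P" if "V T\<^sub>1 P" for P
    using that sub upolys_poly_var unfolding V_def by blast
  have V_const: "P = 0" if "V T\<^sub>0 P" "degree P = 0" for P
  proof -
    obtain a where "P = [:a:]" using \<open>degree P = 0\<close> by (rule degree_eq_zeroE)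
    then show ?thesis
      using that(1) none[of a] unfolding V_def upolys_def by (auto dest: spec[of _ 0])
  qed
  have V_rem: "V T R" if "S = Q * H + R" "V T S" "V T H" "Q \<in> upolys k" "R \<in> upolys k" for T S Q H R
  proof -
    have "R = S - Q * H" using that(1) by simp
    then show ?thesis
      using that(2-5) unfolding V_def by (auto intro: vanishes_on_diff vanishes_on_mult1)
  qed
  have V_smult: "V T (Polynomial.smult a P)" if "V T P" "a \<in> polys k" for T a P
    using that unfolding V_def by (auto intro: upolys_smult vanishes_on_mult1)
  have V_prime: "V T\<^sub>1 P \<or> V T\<^sub>1 Q" if "V T\<^sub>1 (P * Q)" "P \<in> upolys k" "Q \<in> upolys k" for P Q
    using that prime upolys_poly_var unfolding V_def prime_on_def by auto
  obtain H0 where "H0 \<in> upolys k" "h = poly H0 (var k)"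
    using polys_Suc_ex_poly[OF h(1)] unfolding upolys_def by blast
  with h have H0: "V T\<^sub>1 H0 \<and> H0 \<noteq> 0"
    by (auto simp: V_def)
  obtain H where H: "V T\<^sub>1 H" "H \<noteq> 0" and Hmin: "\<And>P. V T\<^sub>1 P \<Longrightarrow> P \<noteq> 0 \<Longrightarrow> degree H \<le> degree P"
    using arg_min_nat_lemma[of "\<lambda>H. V T\<^sub>1 H \<and> H \<noteq> 0" H0 degree] H0 by blast
  have Hpos: "degree H > 0"
    using V_const[OF V_sub[OF H(1)]] H(2) by blast
  obtain G0 where "G0 \<in> upolys k" "g = poly G0 (var k)"
    using polys_Suc_ex_poly[OF g(1)] unfolding upolys_def by blast
  with g have G0: "V T\<^sub>0 G0 \<and> \<not> V T\<^sub>1 G0"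
    by (auto simp: V_def)
  obtain G where G: "V T\<^sub>0 G" "\<not> V T\<^sub>1 G"
    and Gmin: "\<And>P. V T\<^sub>0 P \<Longrightarrow> \<not> V T\<^sub>1 P \<Longrightarrow> degree G \<le> degree P"
    using arg_min_nat_lemma[of "\<lambda>G. V T\<^sub>0 G \<and> \<not> V T\<^sub>1 G" G0 degree] G0 by blast
  have V1_0: "V T\<^sub>1 0" by (simp add: V_def vanishes_on_def)
  then have G_nz: "G \<noteq> 0" using G by blast
  then have Gpos: "degree G > 0"
    using V_const[OF G(1)] by blast
  have up: "G \<in> upolys k" "H \<in> upolys k"
    using G H by (auto simp: V_def)
  show False
  proof (cases "degree G \<le> degree H")
    case True
    obtain j Q R where div: "Q \<in> upolys k" "R \<in> upolys k"
      "Polynomial.smult (lead_coeff G ^ j) H = Q * G + R" "R = 0 \<or> degree R < degree G"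
      using upolys_pseudo_division[OF up(1) G_nz up(2)] by blast
    let ?c = "lead_coeff G ^ j"
    have c: "?c \<in> polys k" "?c \<noteq> 0"
      using up G_nz by (auto intro: polys_power upolys_coeff)
    have cH: "V T\<^sub>1 (Polynomial.smult ?c H)"
      using H c by (intro V_smult)
    have "V T\<^sub>0 R"
      by (rule V_rem[OF div(3) V_sub[OF cH] G(1) div(1,2)])
    then have R: "V T\<^sub>1 R"
      using Gmin[of R] div(4) V1_0 by fastforce
    have eq: "Q * G = Polynomial.smult ?c H - R"
      using div(3) by simp
    have "V T\<^sub>1 (Q * G)"
      unfolding eq using cH R unfolding V_def by (auto intro: vanishes_on_diff upolys_diff)
    then have Q: "V T\<^sub>1 Q"
      using V_prime div up G by blast
    have "degree (Q * G) = degree H"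
    proof (cases "R = 0")
      case False
      then have "degree R < degree (Polynomial.smult ?c H)" using div(4) True c by simp
      then show ?thesis
        unfolding eq using c G_nz degree_add_eq_left[of "-R" "Polynomial.smult ?c H"] by simp
    qed (use eq c G_nz in simp)
    then have "Q \<noteq> 0 \<and> degree Q < degree H"
      using G_nz Gpos Hpos degree_mult_eq[of Q G] by (cases "Q = 0") auto
    then show False using Hmin[OF Q] by simp
  next
    case False
    obtain j Q R where div: "Q \<in> upolys k" "R \<in> upolys k"
      "Polynomial.smult (lead_coeff H ^ j) G = Q * H + R" "R = 0 \<or> degree R < degree H"
      using upolys_pseudo_division[OF up(2) H(2) up(1)] by blast
    let ?c = "lead_coeff H ^ j"
    have c: "?c \<in> polys k" "lead_coeff H \<in> polys k"
      using up by (auto intro: polys_power upolys_coeff)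
    have "V T\<^sub>0 R"
      by (rule V_rem[OF div(3) V_smult[OF G(1) c(1)] V_sub[OF H(1)] div(1,2)])
    then have R: "V T\<^sub>1 R"
      using Gmin[of R] div(4) V1_0 False by fastforce
    have "V T\<^sub>1 ([:?c:] * G)"
      using div R H up c unfolding V_def
      by (auto simp: div(3) intro: vanishes_on_add vanishes_on_mult1 upolys_add upolys_mult)
    then have "V T\<^sub>1 [:?c:]"
      using V_prime[of "[:?c:]" G] G up upolys_const[OF c(1)] by blast
    moreover have "T\<^sub>1 \<noteq> {}" using g(3) by (auto simp: vanishes_on_def)
    ultimately have "V T\<^sub>1 [:lead_coeff H:]"
      using vanishes_on_power upolys_const[OF c(2)] unfolding V_def by auto
    then show False
      using Hmin[of "[:lead_coeff H:]"] Hpos H(2) by simp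
  qed
qed

section \<open>Hilbert's basis theorem\<close>

definition is_subring :: "'a::comm_ring_1 set \<Rightarrow> bool" where
  "is_subring A \<longleftrightarrow> 0 \<in> A \<and> 1 \<in> A \<and> (\<forall>a\<in>A. \<forall>b\<in>A. a + b \<in> A \<and> a * b \<in> A \<and> - a \<in> A)"

inductive_set ideal_gen :: "'a::comm_ring_1 set \<Rightarrow> 'a set \<Rightarrow> 'a set" for A S where
  zero: "0 \<in> ideal_gen A S"
| step: "a \<in> A \<Longrightarrow> s \<in> S \<Longrightarrow> f \<in> ideal_gen A S \<Longrightarrow> a * s + f \<in> ideal_gen A S"

text \<open>
  The generators are taken from \<open>S\<close> itself, so that a system of equations has an equivalent finite
  subsystem. For all \<open>S\<close> together this amounts to finite generation of every ideal.
\<close>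

definition noetherian :: "'a::comm_ring_1 set \<Rightarrow> bool" where
  "noetherian A \<longleftrightarrow> (\<forall>S\<subseteq>A. \<exists>G\<subseteq>S. finite G \<and> S \<subseteq> ideal_gen A G)"

lemma ideal_gen_base: "is_subring A \<Longrightarrow> s \<in> S \<Longrightarrow> s \<in> ideal_gen A S"
  using ideal_gen.step[of 1 A s S 0] by (simp add: is_subring_def ideal_gen.zero)

lemma ideal_gen_add: "f \<in> ideal_gen A S \<Longrightarrow> g \<in> ideal_gen A S \<Longrightarrow> f + g \<in> ideal_gen A S"
  by (induction rule: ideal_gen.induct) (auto simp: add.assoc intro: ideal_gen.step)

lemma ideal_gen_mult:
  assumes "is_subring A" "a \<in> A" "f \<in> ideal_gen A S"
  shows "a * f \<in> ideal_gen A S"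
  using assms(3)
proof (induction rule: ideal_gen.induct)
  case (step b s f)
  have "a * b \<in> A" using assms step by (simp add: is_subring_def)
  from ideal_gen.step[OF this step.hyps(2) step.IH] show ?case
    by (simp add: algebra_simps)
qed (simp add: ideal_gen.zero)

lemma ideal_gen_diff:
  assumes "is_subring A" "f \<in> ideal_gen A S" "g \<in> ideal_gen A S"
  shows "f - g \<in> ideal_gen A S"
proof -
  have "- 1 \<in> A" using assms(1) unfolding is_subring_def by blast
  from ideal_gen_add[OF assms(2) ideal_gen_mult[OF assms(1) this assms(3)]] show ?thesis by simp
qed

lemma ideal_gen_trans:
  assumes "is_subring A" "S \<subseteq> ideal_gen A T"
  shows "ideal_gen A S \<subseteq> ideal_gen A T"
proof
  fix f assume "f \<in> ideal_gen A S"
  then show "f \<in> ideal_gen A T"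
    by (induction rule: ideal_gen.induct)
      (use assms in \<open>auto intro: ideal_gen.zero ideal_gen_add ideal_gen_mult\<close>)
qed

lemma ideal_gen_mono: "is_subring A \<Longrightarrow> S \<subseteq> T \<Longrightarrow> ideal_gen A S \<subseteq> ideal_gen A T"
  by (intro ideal_gen_trans) (auto intro: ideal_gen_base)

lemma ideal_gen_subset:
  assumes "is_subring A" "S \<subseteq> A"
  shows "ideal_gen A S \<subseteq> A"
proof
  fix f assume "f \<in> ideal_gen A S"
  then show "f \<in> A"
    by (induction rule: ideal_gen.induct) (use assms in \<open>auto simp: is_subring_def\<close>)
qed

lemma ideal_gen_finite:
  assumes "is_subring A" "f \<in> ideal_gen A S"
  shows "\<exists>G\<subseteq>S. finite G \<and> f \<in> ideal_gen A G"
  using assms(2)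
proof (induction rule: ideal_gen.induct)
  case zero
  show ?case by (intro exI[of _ "{}"]) (auto intro: ideal_gen.zero)
next
  case (step a s f)
  then obtain G where "G \<subseteq> S" "finite G" "f \<in> ideal_gen A G" by blast
  moreover have "f \<in> ideal_gen A (insert s G)"
    using ideal_gen_mono[OF assms(1), of G "insert s G"] calculation by blast
  ultimately show ?case
    using step by (intro exI[of _ "insert s G"]) (auto intro: ideal_gen.step)
qed

lemma ideal_gen_finite_subset:
  assumes "is_subring A" "finite F" "F \<subseteq> ideal_gen A S"
  shows "\<exists>G\<subseteq>S. finite G \<and> F \<subseteq> ideal_gen A G"
  using assms(2,3)
proof (induction rule: finite_induct)
  case (insert f F)
  then obtain G where G: "G \<subseteq> S" "finite G" "F \<subseteq> ideal_gen A G" by auto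
  obtain G' where G': "G' \<subseteq> S" "finite G'" "f \<in> ideal_gen A G'"
    using ideal_gen_finite[OF assms(1), of f S] insert by auto
  have "F \<subseteq> ideal_gen A (G \<union> G')" "f \<in> ideal_gen A (G \<union> G')"
    using G G' ideal_gen_mono[OF assms(1), of _ "G \<union> G'"] by blast+
  with G G' show ?case
    by (intro exI[of _ "G \<union> G'"]) auto
qed auto

lemma is_subring_coeffs:
  assumes "is_subring A"
  shows "is_subring {P. \<forall>i. coeff P i \<in> A}"
proof -
  have "sum f I \<in> A" if "\<And>i. i \<in> I \<Longrightarrow> f i \<in> A" for f and I :: "nat set"
    using that by (induction I rule: infinite_finite_induct) (use assms in \<open>auto simp: is_subring_def\<close>)
  then show ?thesis
    using assms by (auto simp: is_subring_def coeff_mult)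
qed

text \<open>
  Choose elements of an ideal that is not finitely generated one after the other, each of least degree outside the ideal of its
  predecessors. The leading coefficient of some \<open>f N\<close> is a combination of the earlier ones; as the
  degrees increase, the same combination of shifted \<open>f i\<close> cancels the leading term of
  \<open>f N\<close>, against its minimality.
\<close>

theorem Hilbert_basis:
  assumes A: "is_subring A" and noeth: "noetherian A"
  shows "noetherian {P. \<forall>i. coeff P i \<in> A}"
proof (rule ccontr)
  define B where "B = {P. \<forall>i. coeff P i \<in> A}"
  have B: "is_subring B" unfolding B_def by (rule is_subring_coeffs[OF A])
  assume "\<not> noetherian {P. \<forall>i. coeff P i \<in> A}"
  then obtain S where S: "S \<subseteq> B" and nfin: "\<And>G. G \<subseteq> S \<Longrightarrow> finite G \<Longrightarrow> \<not> S \<subseteq> ideal_gen B G"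
    unfolding noetherian_def B_def[symmetric] by metis
  define J where "J = ideal_gen B S"
  have J_sub: "J \<subseteq> B" unfolding J_def by (rule ideal_gen_subset[OF B S])
  have ex: "\<exists>f. f \<in> J - ideal_gen B G" if "finite G" "G \<subseteq> J" for G
  proof (rule ccontr)
    assume "\<not> ?thesis"
    then have "S \<subseteq> ideal_gen B G"
      using ideal_gen_base[OF B] unfolding J_def by blast
    moreover obtain G' where "G' \<subseteq> S" "finite G'" "G \<subseteq> ideal_gen B G'"
      using ideal_gen_finite_subset[OF B \<open>finite G\<close>] \<open>G \<subseteq> J\<close> unfolding J_def by blast
    ultimately show False
      using nfin[of G'] ideal_gen_trans[OF B, of G G'] by blast
  qed
  define pick where "pick = (\<lambda>G. arg_min degree (\<lambda>f. f \<in> J - ideal_gen B G))"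
  have pick: "pick G \<in> J - ideal_gen B G" "\<And>f. f \<in> J - ideal_gen B G \<Longrightarrow> degree (pick G) \<le> degree f"
    if "finite G" "G \<subseteq> J" for G
    using arg_min_nat_lemma[of "\<lambda>f. f \<in> J - ideal_gen B G" _ degree] ex[OF that]
    unfolding pick_def by blast+
  define F where "F = rec_nat {} (\<lambda>_ G. insert (pick G) G)"
  have F_Suc: "F (Suc k) = insert (pick (F k)) (F k)" and F_0: "F 0 = {}" for k
    by (simp_all add: F_def)
  have F: "finite (F k) \<and> F k \<subseteq> J" for k
    by (induction k) (use pick in \<open>auto simp: F_Suc F_0\<close>)
  define f where "f = (\<lambda>k. pick (F k))"
  have F_eq: "F k = f ` {..<k}" for k
    by (induction k) (auto simp: F_Suc F_0 f_def lessThan_Suc)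
  have f: "f k \<in> J" "f k \<notin> ideal_gen B (F k)" for k
    using pick(1)[of "F k"] F[of k] unfolding f_def by auto
  have deg: "degree (f i) \<le> degree (f k)" if "i \<le> k" for i k
  proof -
    have "F i \<subseteq> F k" using that by (auto simp: F_eq)
    then have "f k \<in> J - ideal_gen B (F i)"
      using f[of k] ideal_gen_mono[OF B] by blast
    then show ?thesis
      using pick(2)[of "F i"] F[of i] unfolding f_def by blast
  qed
  define a where "a = (\<lambda>k. lead_coeff (f k))"
  have "range a \<subseteq> A" using f(1) J_sub by (auto simp: a_def B_def)
  then obtain G where G: "G \<subseteq> range a" "finite G" "range a \<subseteq> ideal_gen A G"
    using noeth unfolding noetherian_def by metis
  then obtain K where K: "finite K" "G = a ` K" by (metis finite_subset_image subset_UNIV)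
  obtain N where "\<forall>k\<in>K. k < N" using K(1) finite_nat_set_iff_bounded by blast
  then have "a N \<in> ideal_gen A (a ` {..<N})"
    using G K ideal_gen_mono[OF A, of G "a ` {..<N}"] by blast
  moreover have "\<exists>h \<in> ideal_gen B (F N). degree h \<le> degree (f N) \<and> coeff h (degree (f N)) = c"
    if "c \<in> ideal_gen A (a ` {..<N})" for c
    using that
  proof (induction rule: ideal_gen.induct)
    case zero
    show ?case by (intro bexI[of _ 0]) (auto intro: ideal_gen.zero)
  next
    case (step b s c)
    then obtain h i where h: "h \<in> ideal_gen B (F N)" "degree h \<le> degree (f N)"
      "coeff h (degree (f N)) = c" and i: "i < N" "s = a i" by auto
    let ?M = "Polynomial.monom b (degree (f N) - degree (f i))"
    have di: "degree (f i) \<le> degree (f N)" using deg i by simp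
    have "?M \<in> B" using step A by (auto simp: B_def is_subring_def)
    moreover have "f i \<in> F N" using i by (auto simp: F_eq)
    ultimately have "?M * f i + h \<in> ideal_gen B (F N)"
      using h by (intro ideal_gen.step)
    moreover have "degree (?M * f i) \<le> degree (f N)"
      using degree_mult_le[of ?M "f i"] degree_monom_le[of b "degree (f N) - degree (f i)"] di by linarith
    then have "degree (?M * f i + h) \<le> degree (f N)"
      using h by (intro degree_add_le)
    moreover have "coeff (?M * f i + h) (degree (f N)) = b * s + c"
      using h i di by (simp add: coeff_monom_mult a_def)
    ultimately show ?case by blast
  qed
  ultimately obtain h where h: "h \<in> ideal_gen B (F N)" "degree h \<le> degree (f N)"
    "coeff h (degree (f N)) = a N" by blast
  have notin: "f N - h \<notin> ideal_gen B (F N)"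
    using ideal_gen_add[OF _ h(1), of "f N - h"] f(2)[of N] by auto
  have "ideal_gen B (F N) \<subseteq> J"
    unfolding J_def by (rule ideal_gen_trans[OF B]) (use F[of N] in \<open>auto simp: J_def\<close>)
  then have "f N - h \<in> J"
    using f(1)[of N] h(1) unfolding J_def by (intro ideal_gen_diff[OF B]) auto
  then have "degree (f N) \<le> degree (f N - h)"
    using pick(2)[of "F N"] F[of N] notin unfolding f_def by blast
  moreover have "degree (f N - h) \<le> degree (f N)"
    using h by (intro degree_diff_le) auto
  moreover have "coeff (f N - h) (degree (f N)) = 0"
    using h by (simp add: a_def)
  ultimately have "f N - h = 0"
    by (metis le_antisym leading_coeff_0_iff)
  with notin show False by (metis ideal_gen.zero)
qed

lemma noetherian_image:
  assumes "noetherian B" and hom: "comm_ring_hom \<phi>" and "\<phi> ` B = C"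
  shows "noetherian C"
  unfolding noetherian_def
proof (intro allI impI)
  interpret comm_ring_hom \<phi> by (rule hom)
  fix S assume S: "S \<subseteq> C"
  define S' where "S' = {b \<in> B. \<phi> b \<in> S}"
  then have "S' \<subseteq> B" by blast
  then obtain G where G: "G \<subseteq> S'" "finite G" "S' \<subseteq> ideal_gen B G"
    using assms(1) unfolding noetherian_def by metis
  have img: "\<phi> f \<in> ideal_gen C (\<phi> ` G)" if "f \<in> ideal_gen B G" for f
    using that
  proof (induction rule: ideal_gen.induct)
    case (step a s f)
    then show ?case
      using ideal_gen.step[of "\<phi> a" C "\<phi> s" "\<phi> ` G" "\<phi> f"] assms(3) by (auto simp: hom_distribs)
  qed (simp add: ideal_gen.zero)
  have "S \<subseteq> ideal_gen C (\<phi> ` G)"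
  proof
    fix s assume "s \<in> S"
    then obtain b where "b \<in> S'" "s = \<phi> b" using S assms(3) unfolding S'_def by blast
    with img G show "s \<in> ideal_gen C (\<phi> ` G)" by blast
  qed
  with G show "\<exists>G\<subseteq>S. finite G \<and> S \<subseteq> ideal_gen C G"
    by (intro exI[of _ "\<phi> ` G"]) (auto simp: S'_def)
qed

lemma is_subring_polys: "is_subring (polys n)"
  by (auto simp: is_subring_def intro: polys_add polys_mult polys_uminus)

lemma noetherian_polys: "noetherian (polys n)"
proof (induction n)
  case 0
  show ?case
    unfolding noetherian_def
  proof (intro allI impI)
    fix S assume S: "S \<subseteq> polys 0"
    show "\<exists>G\<subseteq>S. finite G \<and> S \<subseteq> ideal_gen (polys 0) G"
    proof (cases "S \<subseteq> {0}")
      case True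
      then show ?thesis by (intro exI[of _ "{}"]) (auto intro: ideal_gen.zero)
    next
      case False
      then obtain s where s: "s \<in> S" "s \<noteq> 0" by blast
      define u where "u = mpoly_eval s (\<lambda>_. 0)"
      have su: "s = Poly_Mapping.single 0 u"
        unfolding u_def using S s by (intro polys_0_eq) auto
      have "u \<noteq> 0" using su s by auto
      have "p \<in> ideal_gen (polys 0) {s}" if "p \<in> S" for p
      proof -
        define c where "c = mpoly_eval p (\<lambda>_. 0)"
        have "p = Poly_Mapping.single 0 c"
          unfolding c_def using S that by (intro polys_0_eq) auto
        then have "p = Poly_Mapping.single 0 (c / u) * s + 0"
          unfolding su using \<open>u \<noteq> 0\<close> by (simp add: mult_single)
        then show ?thesis
          using ideal_gen.step[of "Poly_Mapping.single 0 (c / u)" "polys 0" s "{s}" 0]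
          by (simp add: ideal_gen.zero)
      qed
      with s show ?thesis by (intro exI[of _ "{s}"]) auto
    qed
  qed
next
  case (Suc k)
  have "comm_ring_hom (\<lambda>P. poly P (var k))"
    by standard auto
  moreover have "(\<lambda>P. poly P (var k)) ` {P. \<forall>i. coeff P i \<in> polys k} = polys (Suc k)"
    using polys_poly_var polys_Suc_ex_poly by fast
  ultimately show ?case
    using noetherian_image[OF Hilbert_basis[OF is_subring_polys Suc]] by blast
qed

lemma zero_locus_finite:
  assumes "S \<subseteq> polys n"
  shows "\<exists>G\<subseteq>S. finite G \<and> (\<forall>x. (\<forall>p\<in>G. mpoly_eval p x = 0) \<longrightarrow> (\<forall>p\<in>S. mpoly_eval p x = 0))"
proof -
  obtain G where G: "G \<subseteq> S" "finite G" "S \<subseteq> ideal_gen (polys n) G"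
    using noetherian_polys[of n] assms unfolding noetherian_def by metis
  have "mpoly_eval p x = 0" if "p \<in> ideal_gen (polys n) G" "\<forall>p\<in>G. mpoly_eval p x = 0" for p x
    using that by (induction rule: ideal_gen.induct) (auto simp: mpoly_eval_add mpoly_eval_mult)
  then have "\<forall>x. (\<forall>p\<in>G. mpoly_eval p x = 0) \<longrightarrow> (\<forall>p\<in>S. mpoly_eval p x = 0)"
    using G(3) by (meson subsetD)
  with G(1,2) show ?thesis by (intro exI[of _ G] conjI)
qed

section \<open>Noetherian induction\<close>

text \<open>
  The polynomials vanishing on some member of a descending chain have the same zeros as finitely many
  of them, and these all vanish on one member, where the chain stops.
\<close>

lemma wf_closed_subsets:
  "wf {(A, B). closedin (zariski n) A \<and> closedin (zariski n) B \<and> A \<subset> B}"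
  unfolding wf_iff_no_infinite_down_chain
proof
  assume "\<exists>f. \<forall>i. (f (Suc i), f i) \<in> {(A, B). closedin (zariski n) A \<and> closedin (zariski n) B \<and> A \<subset> B}"
  then obtain f where "\<forall>i. (f (Suc i), f i) \<in> {(A, B). closedin (zariski n) A \<and> closedin (zariski n) B \<and> A \<subset> B}"
    by (rule exE)
  then have f: "closedin (zariski n) (f i)" "f (Suc i) \<subset> f i" for i
    by simp_all
  have anti: "f j \<subseteq> f i" if "i \<le> j" for i j
    by (rule lift_Suc_antimono_le[of f, OF psubset_imp_subset[OF f(2)] that])
  define S where "S = {p \<in> polys n. \<exists>i. vanishes_on p (f i)}"
  then have "S \<subseteq> polys n" by blast
  from zero_locus_finite[OF this] obtain G where G: "G \<subseteq> S" "finite G"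
    "\<And>x. (\<forall>p\<in>G. mpoly_eval p x = 0) \<Longrightarrow> (\<forall>p\<in>S. mpoly_eval p x = 0)" by metis
  have "\<forall>p\<in>G. \<exists>i. vanishes_on p (f i)" using G(1) unfolding S_def by blast
  then obtain i where i: "\<And>p. p \<in> G \<Longrightarrow> vanishes_on p (f (i p))" by metis
  obtain N where N: "\<And>p. p \<in> G \<Longrightarrow> i p \<le> N"
    using G(2) finite_nat_set_iff_bounded_le[of "i ` G"] by auto
  have "f N \<subseteq> f (Suc N)"
  proof
    fix x assume x: "x \<in> f N"
    have "\<forall>p\<in>G. mpoly_eval p x = 0"
      using x anti[OF N] i unfolding vanishes_on_def by blast
    then have "\<forall>p\<in>S. mpoly_eval p x = 0" by (rule G(3))
    moreover have "x \<in> affine_space n"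
      using x closedin_zariski_subset[OF f(1)] by blast
    ultimately show "x \<in> f (Suc N)"
      using closedin_zariski_separate[OF f(1), of x "Suc N"] unfolding S_def by blast
  qed
  with f(2)[of N] show False by blast
qed

text \<open>
  This replaces the decomposition into irreducible components.
\<close>

lemma closed_induct [consumes 1, case_names empty irreducible union]:
  assumes "closedin (zariski n) Z"
    and empty: "P {}"
    and irr: "\<And>Y. irreducible_closed (zariski n) Y \<Longrightarrow> Y \<subseteq> Z \<Longrightarrow> P Y"
    and union: "\<And>A B. P A \<Longrightarrow> P B \<Longrightarrow> P (A \<union> B)"
  shows "P Z"
proof -
  have "closedin (zariski n) A \<Longrightarrow> A \<subseteq> Z \<Longrightarrow> P A" for A
  proof (induction A rule: wf_induct_rule[OF wf_closed_subsets[of n]])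
    case (1 A)
    show ?case
    proof (cases "A = {} \<or> irreducible_closed (zariski n) A")
      case True
      then show ?thesis using empty irr 1 by blast
    next
      case False
      then have "\<not> prime_on n A"
        using 1 irreducible_closed_zariski_iff by blast
      then obtain p q where pq: "p \<in> polys n" "q \<in> polys n" "vanishes_on (p * q) A"
        "\<not> vanishes_on p A" "\<not> vanishes_on q A"
        unfolding prime_on_def by blast
      let ?B = "A \<inter> zero_locus n {p}" and ?C = "A \<inter> zero_locus n {q}"
      have "closedin (zariski n) ?B" "closedin (zariski n) ?C"
        using 1 pq by (auto intro: closedin_zariski_zero_locus)
      moreover have "?B \<subset> A" "?C \<subset> A"
        using pq(4,5) by (auto simp: vanishes_on_def zero_locus_def)
      ultimately have "P ?B" "P ?C"
        using 1 by auto
      moreover have "A = ?B \<union> ?C"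
        using pq(3) closedin_zariski_subset[OF 1(2)]
        by (auto simp: vanishes_on_def zero_locus_def mpoly_eval_mult)
      ultimately show ?thesis using union by metis
    qed
  qed
  with assms(1) show ?thesis by blast
qed

section \<open>Generic lines through a point\<close>

text \<open>
  The map \<open>c\<close> is the affine chart \<open>z \<mapsto> v + z\<^sub>k (z\<^sub>0, \<dots>, z\<^sub>k\<^sub>-\<^sub>1, 1)\<close> of the blow-up of
  \<open>v\<close>. Its inverse has powers of \<open>x\<^sub>k - v\<^sub>k\<close> as denominators; clearing them turns a
  polynomial in \<open>z\<close> into one in \<open>x\<close>.
\<close>

lemma blow_up_chart_homogenize:
  assumes "mpolyfun (Suc k) F"
    and u: "\<And>z. c z k = v k + z k" and c: "\<And>z i. i < k \<Longrightarrow> c z i = v i + z k * z i"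
  shows "\<exists>N F'. mpolyfun (Suc k) F' \<and> (\<forall>z. F' (c z) = z k ^ N * F z)"
  using assms(1)
proof (induction rule: mpolyfun_induct)
  case (const a)
  have "mpolyfun (Suc k) (\<lambda>_. a)" "\<forall>z. a = z k ^ 0 * a" by auto
  then show ?case by blast
next
  case (coord i)
  show ?case
  proof (cases "i = k")
    case True
    have "mpolyfun (Suc k) (\<lambda>x. x k - v k)" "\<forall>z. c z k - v k = z k ^ 0 * z i"
      using True u by auto
    then show ?thesis by blast
  next
    case False
    with coord have "mpolyfun (Suc k) (\<lambda>x. x i - v i)" "\<forall>z. c z i - v i = z k ^ 1 * z i"
      using c[of i] by auto
    then show ?thesis by blast
  qed
next
  case (add F G)
  then obtain N F' M G' where *: "mpolyfun (Suc k) F'" "mpolyfun (Suc k) G'"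
    "\<And>z. F' (c z) = z k ^ N * F z" "\<And>z. G' (c z) = z k ^ M * G z" by blast
  have "mpolyfun (Suc k) (\<lambda>x. (x k - v k) ^ M * F' x + (x k - v k) ^ N * G' x)"
    using * by (intro mpolyfun_add mpolyfun_mult mpolyfun_power mpolyfun_diff mpolyfun_coord mpolyfun_const) auto
  moreover have "\<forall>z. (c z k - v k) ^ M * F' (c z) + (c z k - v k) ^ N * G' (c z) = z k ^ (N + M) * (F z + G z)"
    by (simp add: * u power_add algebra_simps)
  ultimately show ?case
    by (intro exI[of _ "N + M"] exI[of _ "\<lambda>x. (x k - v k) ^ M * F' x + (x k - v k) ^ N * G' x"] conjI)
next
  case (mult F G)
  then obtain N F' M G' where *: "mpolyfun (Suc k) F'" "mpolyfun (Suc k) G'"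
    "\<And>z. F' (c z) = z k ^ N * F z" "\<And>z. G' (c z) = z k ^ M * G z" by blast
  have "mpolyfun (Suc k) (\<lambda>x. F' x * G' x)"
    using * by (intro mpolyfun_mult)
  moreover have "\<forall>z. F' (c z) * G' (c z) = z k ^ (N + M) * (F z * G z)"
    by (simp add: * power_add algebra_simps)
  ultimately show ?case
    by (intro exI[of _ "N + M"] exI[of _ "\<lambda>x. F' x * G' x"] conjI)
qed

text \<open>
  In the blow-up chart at \<open>v\<close>, a polynomial in the first \<open>k\<close> coordinates is a condition on the direction of the
  line through \<open>v\<close>. The preimages of \<open>Y\<close> and \<open>Z\<^sub>1\<close> satisfy the hypotheses of \<open>elimination\<close>, unless \<open>Y\<close> lies in
  the hyperplane \<open>x\<^sub>k = v\<^sub>k\<close>, which a line with \<open>e\<^sub>k = 1\<close> meets in \<open>v\<close> only.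
\<close>

lemma generic_line_avoids_irreducible:
  assumes Y: "irreducible_closed (zariski (Suc k)) Y"
    and Z1: "irreducible_closed (zariski (Suc k)) Z\<^sub>1" and Z2: "irreducible_closed (zariski (Suc k)) Z\<^sub>2"
    and sub: "Y \<subset> Z\<^sub>1" "Z\<^sub>1 \<subset> Z\<^sub>2"
    and v: "aff_proj (Suc k) v \<notin> Y"
  shows "\<exists>b\<in>polys k. b \<noteq> 0 \<and> (\<forall>e t. e k = 1 \<longrightarrow> mpoly_eval b e \<noteq> 0 \<longrightarrow>
     aff_proj (Suc k) (\<lambda>i. v i + t * e i) \<notin> Y)"
proof -
  let ?n = "Suc k"
  define u where "u = var k - Poly_Mapping.single 0 (v k)"
  have u: "u \<in> polys ?n" "mpoly_eval u x = x k - v k" for x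
    by (auto simp: u_def mpoly_eval_diff intro!: polys_diff polys_var)
  have closed: "closedin (zariski ?n) Y" "closedin (zariski ?n) Z\<^sub>1" "closedin (zariski ?n) Z\<^sub>2"
    and prime: "prime_on ?n Z\<^sub>1"
    using Y Z1 Z2 by (simp_all add: irreducible_closed_zariski_iff)
  have Z1_sub: "Z\<^sub>1 \<subseteq> affine_space ?n" by (rule closedin_zariski_subset[OF closed(2)])
  show ?thesis
  proof (cases "vanishes_on u Y")
    case True
    have "aff_proj ?n (\<lambda>i. v i + t * e i) \<notin> Y" if "e k = 1" for e t
    proof
      assume *: "aff_proj ?n (\<lambda>i. v i + t * e i) \<in> Y"
      with True have "mpoly_eval u (aff_proj ?n (\<lambda>i. v i + t * e i)) = 0"
        unfolding vanishes_on_def by blast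
      then have "t = 0" using that by (simp add: u mpoly_eval_aff_proj)
      with * v show False by simp
    qed
    then show ?thesis by (intro bexI[of _ 1]) auto
  next
    case False
    then have u_Z1: "\<not> vanishes_on u Z\<^sub>1" using sub unfolding vanishes_on_def by blast
    define c where "c = (\<lambda>z i. v i + (if i = k then z k else z k * z i))"
    have c_eval: "\<exists>p'\<in>polys ?n. \<forall>z. mpoly_eval p' z = mpoly_eval p (c z)" if "p \<in> polys ?n" for p
    proof -
      have "mpolyfun ?n (\<lambda>z. mpoly_eval p (c z))"
      proof (rule mpolyfun_compose[OF mpolyfun_eval[OF that]])
        show "mpolyfun ?n (\<lambda>z. c z i)" if "i < ?n" for i
          using that by (cases "i = k")
            (simp_all add: c_def mpolyfun_add mpolyfun_mult mpolyfun_coord mpolyfun_const)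
      qed
      then show ?thesis unfolding mpolyfun_def by metis
    qed
    have c_surj: "\<exists>z. z k \<noteq> 0 \<and> c z = x" if "x k \<noteq> v k" for x
      by (rule exI[of _ "\<lambda>i. if i = k then x k - v k else (x i - v i) / (x k - v k)"])
        (use that in \<open>auto simp: c_def\<close>)
    define T where "T = (\<lambda>Y. {z. z k \<noteq> 0 \<and> aff_proj ?n (c z) \<in> Y})"
    have T_eval: "mpoly_eval p (c z) = 0" if "vanishes_on p X" "p \<in> polys ?n" "z \<in> T X" for p z X
      using that mpoly_eval_aff_proj[of p ?n "c z"] unfolding T_def vanishes_on_def by auto
    have "prime_on ?n (T Z\<^sub>1)"
      unfolding prime_on_def
    proof (intro ballI impI)
      fix p q assume pq: "p \<in> polys ?n" "q \<in> polys ?n" "vanishes_on (p * q) (T Z\<^sub>1)"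
      have hom: "\<exists>N p'. p' \<in> polys ?n \<and> (\<forall>z. mpoly_eval p' (c z) = z k ^ N * mpoly_eval p z)"
        if "p \<in> polys ?n" for p
      proof -
        obtain N F' where "mpolyfun ?n F'" "\<And>z. F' (c z) = z k ^ N * mpoly_eval p z"
          using blow_up_chart_homogenize[OF mpolyfun_eval[OF \<open>p \<in> polys ?n\<close>], of c v] unfolding c_def by auto
        then show ?thesis by (elim mpolyfunE) auto
      qed
      obtain N p' where p': "p' \<in> polys ?n" "\<And>z. mpoly_eval p' (c z) = z k ^ N * mpoly_eval p z"
        using hom[OF pq(1)] by blast
      obtain M q' where q': "q' \<in> polys ?n" "\<And>z. mpoly_eval q' (c z) = z k ^ M * mpoly_eval q z"
        using hom[OF pq(2)] by blast
      have "vanishes_on (p' * q') Z\<^sub>1 \<or> vanishes_on u Z\<^sub>1"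
      proof (rule prime_onD[OF prime polys_mult[OF p'(1) q'(1)] u(1)])
        fix x assume x: "x \<in> Z\<^sub>1"
        show "mpoly_eval (p' * q') x * mpoly_eval u x = 0"
        proof (cases "x k = v k")
          case False
          then obtain z where z: "z k \<noteq> 0" "c z = x" using c_surj by blast
          then have "z \<in> T Z\<^sub>1" using x Z1_sub by (auto simp: T_def aff_proj_id)
          then have "mpoly_eval p z * mpoly_eval q z = 0"
            using pq(3) by (auto simp: vanishes_on_def mpoly_eval_mult)
          then show ?thesis by (auto simp: z(2)[symmetric] mpoly_eval_mult p' q')
        qed (simp add: u)
      qed
      then have "vanishes_on p' Z\<^sub>1 \<or> vanishes_on q' Z\<^sub>1"
        using u_Z1 prime p' q' unfolding prime_on_def by blast
      then show "vanishes_on p (T Z\<^sub>1) \<or> vanishes_on q (T Z\<^sub>1)"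
        using T_eval[of p' Z\<^sub>1] T_eval[of q' Z\<^sub>1] p' q' unfolding vanishes_on_def[of _ "T Z\<^sub>1"]
        by (auto simp: T_def)
    qed
    moreover have "T Y \<subseteq> T Z\<^sub>1" using sub by (auto simp: T_def)
    moreover have "\<exists>h\<in>polys ?n. h \<noteq> 0 \<and> vanishes_on h (T Z\<^sub>1)"
    proof -
      obtain x0 where "x0 \<in> affine_space ?n" "x0 \<notin> Z\<^sub>1"
        using sub(2) closedin_zariski_subset[OF closed(3)] by blast
      then obtain p where p: "p \<in> polys ?n" "vanishes_on p Z\<^sub>1" "mpoly_eval p x0 \<noteq> 0"
        using closedin_zariski_separate[OF closed(2)] by blast
      have "mpoly_eval u (\<lambda>_. v k + 1) \<noteq> 0" by (simp add: u)
      then obtain x where x: "mpoly_eval p x \<noteq> 0" "mpoly_eval u x \<noteq> 0"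
        using mpolyfun_nonzero_mult[OF mpolyfun_eval[OF p(1)] mpolyfun_eval[OF u(1)] p(3)] by blast
      then obtain z where "c z = x" using c_surj u by fastforce
      moreover obtain p' where "p' \<in> polys ?n" "\<And>z. mpoly_eval p' z = mpoly_eval p (c z)"
        using c_eval[OF p(1)] by blast
      ultimately show ?thesis
        using x T_eval[OF p(2,1)] by (intro bexI[of _ p']) (auto simp: vanishes_on_def)
    qed
    moreover have "\<exists>g\<in>polys ?n. vanishes_on g (T Y) \<and> \<not> vanishes_on g (T Z\<^sub>1)"
    proof -
      obtain x0 where x0: "x0 \<in> Z\<^sub>1" "x0 \<notin> Y" using sub(1) by blast
      then obtain p where p: "p \<in> polys ?n" "vanishes_on p Y" "mpoly_eval p x0 \<noteq> 0"
        using closedin_zariski_separate[OF closed(1)] Z1_sub by blast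
      obtain p' where p': "p' \<in> polys ?n" "\<And>z. mpoly_eval p' z = mpoly_eval p (c z)"
        using c_eval[OF p(1)] by blast
      have "\<not> vanishes_on p' (T Z\<^sub>1)"
      proof
        assume van: "vanishes_on p' (T Z\<^sub>1)"
        have "vanishes_on p Z\<^sub>1 \<or> vanishes_on u Z\<^sub>1"
        proof (rule prime_onD[OF prime p(1) u(1)])
          fix x assume x: "x \<in> Z\<^sub>1"
          show "mpoly_eval p x * mpoly_eval u x = 0"
          proof (cases "x k = v k")
            case False
            then obtain z where z: "z k \<noteq> 0" "c z = x" using c_surj by blast
            then have "z \<in> T Z\<^sub>1" using x Z1_sub by (auto simp: T_def aff_proj_id)
            then show ?thesis using van p'(2)[of z] z by (auto simp: vanishes_on_def)
          qed (simp add: u)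
        qed
        then show False using u_Z1 p x0 by (auto simp: vanishes_on_def)
      qed
      moreover have "vanishes_on p' (T Y)"
        using T_eval[OF p(2,1)] p'(2) by (auto simp: vanishes_on_def)
      ultimately show ?thesis using p' by blast
    qed
    ultimately obtain b where b: "b \<in> polys k" "b \<noteq> 0" "vanishes_on b (T Y)"
      using elimination[of k "T Z\<^sub>1" "T Y"] unfolding vanishes_on_def by blast
    have "aff_proj ?n (\<lambda>i. v i + t * e i) \<notin> Y" if e: "e k = 1" "mpoly_eval b e \<noteq> 0" for e t
    proof
      assume *: "aff_proj ?n (\<lambda>i. v i + t * e i) \<in> Y"
      with v have "t \<noteq> 0" by auto
      have "c (e(k := t)) = (\<lambda>i. v i + t * e i)"
        using e by (auto simp: c_def)
      with * \<open>t \<noteq> 0\<close> have "e(k := t) \<in> T Y" by (auto simp: T_def)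
      then have "mpoly_eval b (e(k := t)) = 0"
        using b by (auto simp: vanishes_on_def)
      moreover have "mpoly_eval b (e(k := t)) = mpoly_eval b e"
        using b(1) by (rule mpoly_eval_cong) auto
      ultimately show False using e by simp
    qed
    with b(2) show ?thesis by (intro bexI[OF _ b(1)] conjI allI impI)
  qed
qed

text \<open>
  The exceptional directions of finitely many irreducible sets lie in the union of the
  hypersurfaces found for each of them.
\<close>

lemma generic_line_avoids:
  assumes Z: "closedin (zariski (Suc k)) Z" and codim: "codim (zariski (Suc k)) Z \<ge> 2"
    and v: "aff_proj (Suc k) v \<notin> Z"
  shows "\<exists>b\<in>polys k. b \<noteq> 0 \<and> (\<forall>e t. e k = 1 \<longrightarrow> mpoly_eval b e \<noteq> 0 \<longrightarrow>
     aff_proj (Suc k) (\<lambda>i. v i + t * e i) \<notin> Z)"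
  using Z
proof (induction rule: closed_induct)
  case empty
  show ?case by (intro bexI[of _ 1]) auto
next
  case (irreducible Y)
  obtain Z1 Z2 where Z12: "irreducible_closed (zariski (Suc k)) Z1" "irreducible_closed (zariski (Suc k)) Z2"
    "Y \<subset> Z1" "Z1 \<subset> Z2"
    using codim[unfolded codim_ge_2_iff, rule_format, OF conjI[OF irreducible]] by (elim exE conjE)
  have "aff_proj (Suc k) v \<notin> Y" using v irreducible by (meson subsetD)
  then show ?case
    by (rule generic_line_avoids_irreducible[OF irreducible(1) Z12])
next
  case (union A B)
  obtain a where a: "a \<in> polys k" "a \<noteq> 0 \<and> (\<forall>e t. e k = 1 \<longrightarrow> mpoly_eval a e \<noteq> 0 \<longrightarrow>
      aff_proj (Suc k) (\<lambda>i. v i + t * e i) \<notin> A)"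
    using union(1) by (rule bexE)
  obtain b where b: "b \<in> polys k" "b \<noteq> 0 \<and> (\<forall>e t. e k = 1 \<longrightarrow> mpoly_eval b e \<noteq> 0 \<longrightarrow>
      aff_proj (Suc k) (\<lambda>i. v i + t * e i) \<notin> B)"
    using union(2) by (rule bexE)
  show ?case
  proof (intro bexI[OF _ polys_mult[OF a(1) b(1)]] conjI allI impI)
    show "a * b \<noteq> 0" using a(2) b(2) by simp
    fix e t assume "e k = 1" "mpoly_eval (a * b) e \<noteq> 0"
    then have "mpoly_eval a e \<noteq> 0" "mpoly_eval b e \<noteq> 0" by (simp_all add: mpoly_eval_mult)
    with a(2) b(2) \<open>e k = 1\<close> show "aff_proj (Suc k) (\<lambda>i. v i + t * e i) \<notin> A \<union> B" by blast
  qed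
qed

section \<open>Generic directions\<close>

lemma coeff_mult_add:
  fixes p q :: "'a::comm_semiring_0 poly"
  assumes "degree p \<le> m" "degree q \<le> n"
  shows "coeff (p * q) (m + n) = coeff p m * coeff q n"
proof -
  have "coeff p i * coeff q (m + n - i) = 0" if "i \<le> m + n" "i \<noteq> m" for i
  proof (cases "i < m")
    case True
    then have "coeff q (m + n - i) = 0" using assms by (intro coeff_eq_0) auto
    then show ?thesis by simp
  next
    case False
    then have "coeff p i = 0" using that assms by (intro coeff_eq_0) auto
    then show ?thesis by simp
  qed
  then have "(\<Sum>i\<le>m + n. coeff p i * coeff q (m + n - i)) = (\<Sum>i\<in>{m}. coeff p i * coeff q (m + n - i))"
    by (intro sum.mono_neutral_right) auto
  then show ?thesis by (simp add: coeff_mult)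
qed

text \<open>
  The total degree of a monomial. The leading coefficient along a direction is a value of
  the homogeneous part of top degree.
\<close>

definition monom_degree :: "(nat \<Rightarrow>\<^sub>0 nat) \<Rightarrow> nat" where
  "monom_degree m = (\<Sum>i\<in>Poly_Mapping.keys m. Poly_Mapping.lookup m i)"

lemma monom_eval_scale: "monom_eval m (\<lambda>i. c * x i) = c ^ monom_degree m * monom_eval m x"
  by (simp add: monom_eval_def monom_degree_def power_mult_distrib prod.distrib power_sum)

lemma monom_eval_line:
  "\<exists>r. degree r \<le> monom_degree m \<and> coeff r (monom_degree m) = monom_eval m e \<and>
     (\<forall>t. poly r t = monom_eval m (\<lambda>i. x i + t * e i))"
proof -
  have pw: "degree ([:x i, e i:] ^ j) \<le> j \<and> coeff ([:x i, e i:] ^ j) j = e i ^ j" for i j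
  proof (induction j)
    case (Suc j)
    have d: "degree [:x i, e i:] \<le> 1" by simp
    from Suc d show ?case
      using coeff_mult_add[OF d, of "[:x i, e i:] ^ j" j] degree_mult_le[of "[:x i, e i:]" "[:x i, e i:] ^ j"]
      by auto
  qed auto
  have "degree (\<Prod>i\<in>I. [:x i, e i:] ^ f i) \<le> sum f I \<and>
        coeff (\<Prod>i\<in>I. [:x i, e i:] ^ f i) (sum f I) = (\<Prod>i\<in>I. e i ^ f i)" if "finite I" for I f
    using that
  proof (induction I rule: finite_induct)
    case (insert i I)
    then show ?case
      using coeff_mult_add[of "[:x i, e i:] ^ f i" "f i" "\<Prod>i\<in>I. [:x i, e i:] ^ f i" "sum f I"] pw[of i "f i"]
        degree_mult_le[of "[:x i, e i:] ^ f i" "\<Prod>i\<in>I. [:x i, e i:] ^ f i"]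
      by auto
  qed auto
  then show ?thesis
    unfolding monom_degree_def monom_eval_def
    by (intro exI[of _ "\<Prod>i\<in>Poly_Mapping.keys m. [:x i, e i:] ^ Poly_Mapping.lookup m i"])
      (auto simp: poly_prod mult.commute)
qed

text \<open>
  The leading term in \<open>t\<close> of \<open>p(x + t e)\<close> is \<open>c t\<^sup>D\<close> for every \<open>x\<close>. With \<open>c \<noteq> 0\<close>
  this says that \<open>p\<close> is monic up to a constant after shearing \<open>e\<close> into the last coordinate axis.
\<close>

definition constant_lead_along :: "mpoly \<Rightarrow> (nat \<Rightarrow> complex) \<Rightarrow> nat \<Rightarrow> complex \<Rightarrow> bool" where
  "constant_lead_along p e D c \<longleftrightarrow> (\<forall>x. \<exists>r. degree r = D \<and> coeff r D = c \<and>
     (\<forall>t. poly r t = mpoly_eval p (\<lambda>i. x i + t * e i)))"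

text \<open>
  The coefficient of \<open>t\<^sup>D\<close> in \<open>p(x + t e)\<close>, where \<open>D\<close> is the total degree, is the top homogeneous part of
  \<open>p\<close> at \<open>e\<close> and so does not involve \<open>x\<close>. By homogeneity this part stays nonzero when it is restricted to
  \<open>e\<^sub>k = 1\<close>.
\<close>

lemma generic_direction:
  assumes p: "p \<in> polys (Suc k)" "p \<noteq> 0"
  shows "\<exists>a\<in>polys k. \<exists>D. a \<noteq> 0 \<and>
    (\<forall>e. e k = 1 \<longrightarrow> mpoly_eval a e \<noteq> 0 \<longrightarrow> constant_lead_along p e D (mpoly_eval a e))"
proof -
  let ?K = "Poly_Mapping.keys p" and ?c = "Poly_Mapping.lookup p"
  have K: "finite ?K" "?K \<noteq> {}" using p by auto
  define D where "D = Max (monom_degree ` ?K)"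
  have D: "monom_degree m \<le> D" if "m \<in> ?K" for m
    unfolding D_def using that K by auto
  define M where "M = {m \<in> ?K. monom_degree m = D}"
  have "D \<in> monom_degree ` ?K" unfolding D_def using K by (intro Max_in) auto
  then obtain m0 where m0: "m0 \<in> M" unfolding M_def by auto
  have M: "M \<subseteq> ?K" "finite M" unfolding M_def by auto
  define top where "top = (\<Sum>m\<in>M. Poly_Mapping.single m (?c m))"
  have top_polys: "top \<in> polys (Suc k)"
    unfolding top_def using p M by (intro polys_sum polys_single) (auto simp: polys_def)
  have "Poly_Mapping.lookup top m0 = ?c m0"
    unfolding top_def using m0 M by (simp add: lookup_sum lookup_single when_def sum.delta)
  also have "\<dots> \<noteq> 0" using m0 M by (auto simp: in_keys_iff)
  finally have top_nz: "top \<noteq> 0" by auto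
  have top_eval: "mpoly_eval top x = (\<Sum>m\<in>M. ?c m * monom_eval m x)" for x
    unfolding top_def by (simp add: mpoly_eval_sum mpoly_eval_single)
  have top_scale: "mpoly_eval top (\<lambda>i. c * x i) = c ^ D * mpoly_eval top x" for c x
    unfolding top_eval sum_distrib_left by (intro sum.cong) (auto simp: monom_eval_scale M_def)
  obtain y where "mpoly_eval top y \<noteq> 0"
    using mpoly_nonzero_ex_eval[OF top_polys top_nz] by blast
  then obtain e where e: "mpoly_eval top e \<noteq> 0" "e k \<noteq> 0"
    using mpolyfun_nonzero_mult[OF mpolyfun_eval[OF top_polys] mpolyfun_coord, of k y "\<lambda>_. 1"] by auto
  have "mpolyfun k (\<lambda>e. mpoly_eval top (e(k := 1)))"
    by (rule mpolyfun_compose[OF mpolyfun_eval[OF top_polys]]) (auto simp: less_Suc_eq)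
  then obtain a where a: "a \<in> polys k" "\<And>e. mpoly_eval top (e(k := 1)) = mpoly_eval a e"
    unfolding mpolyfun_def by metis
  have "mpoly_eval a (\<lambda>i. inverse (e k) * e i) \<noteq> 0"
  proof -
    have "(\<lambda>i. inverse (e k) * e i)(k := 1) = (\<lambda>i. inverse (e k) * e i)"
      using e by auto
    then show ?thesis
      using e by (simp add: a(2)[symmetric] top_scale)
  qed
  then have "a \<noteq> 0" by auto
  moreover have "\<exists>r. degree r = D \<and> coeff r D = mpoly_eval a e \<and> (\<forall>t. poly r t = mpoly_eval p (\<lambda>i. x i + t * e i))"
    if e: "e k = 1" "mpoly_eval a e \<noteq> 0" for e x
  proof -
    obtain r where r: "\<And>m. degree (r m) \<le> monom_degree m" "\<And>m. coeff (r m) (monom_degree m) = monom_eval m e"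
      "\<And>m t. poly (r m) t = monom_eval m (\<lambda>i. x i + t * e i)"
      using monom_eval_line[of _ e x] by metis
    define R where "R = (\<Sum>m\<in>?K. Polynomial.smult (?c m) (r m))"
    have "degree R \<le> D"
      unfolding R_def using D r(1) by (intro degree_sum_le) (auto intro: order_trans[OF degree_smult_le] order_trans)
    moreover have "coeff R D = mpoly_eval a e"
    proof -
      have "coeff R D = (\<Sum>m\<in>?K. ?c m * coeff (r m) D)"
        unfolding R_def by (simp add: coeff_sum)
      also have "\<dots> = (\<Sum>m\<in>M. ?c m * coeff (r m) D)"
      proof (intro sum.mono_neutral_right ballI)
        fix m assume "m \<in> ?K - M"
        then have "monom_degree m < D" using D[of m] unfolding M_def by auto
        then show "?c m * coeff (r m) D = 0" using r(1)[of m] by (simp add: coeff_eq_0)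
      qed (use M in auto)
      also have "\<dots> = mpoly_eval top e"
        unfolding top_eval using r(2) by (intro sum.cong) (auto simp: M_def)
      also have "\<dots> = mpoly_eval top (e(k := 1))" using e(1) by (metis fun_upd_triv)
      also have "\<dots> = mpoly_eval a e" by (rule a(2))
      finally show ?thesis .
    qed
    moreover have "poly R t = mpoly_eval p (\<lambda>i. x i + t * e i)" for t
      unfolding R_def mpoly_eval_def by (simp add: poly_sum r(3))
    moreover have "D \<le> degree R"
      using calculation(2) e by (intro le_degree) simp
    ultimately show ?thesis
      by (intro exI[of _ R]) auto
  qed
  ultimately have "a \<noteq> 0 \<and>
    (\<forall>e. e k = 1 \<longrightarrow> mpoly_eval a e \<noteq> 0 \<longrightarrow> constant_lead_along p e D (mpoly_eval a e))"
    unfolding constant_lead_along_def by blast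
  with a(1) show ?thesis by blast
qed

section \<open>Functions that are constant along a direction\<close>

text \<open>
  Given \<open>g\<close> that works for \<open>F\<close> and \<open>h\<close> that works for one more point, some \<open>g + c h\<close> works for both,
  since only finitely many \<open>c\<close> are excluded.
\<close>

lemma closed_separate_finite:
  assumes Z: "closedin (zariski n) Z" and F: "finite F" "F \<subseteq> affine_space n" "F \<inter> Z = {}"
  shows "\<exists>g\<in>polys n. vanishes_on g Z \<and> (\<forall>x\<in>F. mpoly_eval g x \<noteq> 0)"
  using F
proof (induction F rule: finite_induct)
  case empty
  show ?case by (intro bexI[of _ 0]) (auto simp: vanishes_on_def)
next
  case (insert y F)
  then obtain g where g: "g \<in> polys n" "vanishes_on g Z" "\<And>x. x \<in> F \<Longrightarrow> mpoly_eval g x \<noteq> 0" by auto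
  obtain h where h: "h \<in> polys n" "vanishes_on h Z" "mpoly_eval h y \<noteq> 0"
    using closedin_zariski_separate[OF Z, of y] insert.prems by auto
  define B where "B = (\<lambda>x. - mpoly_eval g x / mpoly_eval h x) ` insert y F"
  have "finite B" unfolding B_def using insert by auto
  then obtain c where c: "c \<notin> B" using ex_new_if_finite[OF infinite_UNIV_char_0] by blast
  let ?f = "g + Poly_Mapping.single 0 c * h"
  have "mpoly_eval ?f x \<noteq> 0" if "x \<in> insert y F" for x
  proof (cases "mpoly_eval h x = 0")
    case True
    then have "x \<in> F" using that h by auto
    with True g show ?thesis by (simp add: mpoly_eval_add mpoly_eval_mult)
  next
    case False
    show ?thesis
    proof
      assume "mpoly_eval ?f x = 0"
      then have "c = - mpoly_eval g x / mpoly_eval h x"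
        using False by (simp add: mpoly_eval_add mpoly_eval_mult field_simps eq_neg_iff_add_eq_0)
      with c that show False unfolding B_def by blast
    qed
  qed
  moreover have "?f \<in> polys n" "vanishes_on ?f Z"
    using g h by (auto intro!: polys_add polys_mult vanishes_on_add vanishes_on_mult1)
  ultimately show ?case by blast
qed

lemma det_in_polys:
  assumes "\<And>i j. i < dim_row A \<Longrightarrow> j < dim_row A \<Longrightarrow> A $$ (i, j) \<in> polys k"
  shows "Determinant.det A \<in> polys k"
proof (cases "dim_row A = dim_col A")
  case True
  have "signof p * (\<Prod>i = 0..<dim_row A. A $$ (i, p i)) \<in> polys k"
    if "p permutes {0..<dim_row A}" for p
  proof (intro polys_mult polys_prod)
    show "(signof p :: mpoly) \<in> polys k"
      by (auto simp: sign_def intro: polys_uminus)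
    show "A $$ (i, p i) \<in> polys k" if "i \<in> {0..<dim_row A}" for i
      using that permutes_in_image[OF \<open>p permutes _\<close>, of i] by (intro assms) auto
  qed
  then show ?thesis
    using True unfolding Determinant.det_def by (auto intro!: polys_sum)
qed (simp add: Determinant.det_def)

lemma resultant_in_polys:
  assumes "P \<in> upolys k" "Q \<in> upolys k"
  shows "resultant P Q \<in> polys k"
  unfolding resultant_def
proof (rule det_in_polys)
  fix i j assume "i < dim_row (sylvester_mat P Q)" "j < dim_row (sylvester_mat P Q)"
  then have "i < degree P + degree Q" "j < degree P + degree Q" by simp_all
  from sylvester_index_mat[OF this] show "sylvester_mat P Q $$ (i, j) \<in> polys k"
    using assms by (auto simp: upolys_def)
qed

lemma resultant_complex_0_iff:
  fixes p q :: "complex poly"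
  assumes "p \<noteq> 0"
  shows "resultant p q = 0 \<longleftrightarrow> (\<exists>t. poly p t = 0 \<and> poly q t = 0)"
proof -
  have nz: "gcd p q \<noteq> 0" using assms by simp
  have "degree (gcd p q) \<noteq> 0 \<longleftrightarrow> (\<exists>t. poly (gcd p q) t = 0)"
  proof
    assume "degree (gcd p q) \<noteq> 0"
    then show "\<exists>t. poly (gcd p q) t = 0"
      using fundamental_theorem_of_algebra[of "gcd p q"] by (simp add: constant_degree)
  next
    assume "\<exists>t. poly (gcd p q) t = 0"
    then show "degree (gcd p q) \<noteq> 0"
      using nz by (metis degree_eq_zeroE poly_const_conv pCons_0_0)
  qed
  also have "\<dots> \<longleftrightarrow> (\<exists>t. poly p t = 0 \<and> poly q t = 0)"
    by (auto simp: poly_eq_0_iff_dvd)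
  finally show ?thesis by (simp add: resultant_0_gcd)
qed

text \<open>
  The projection along \<open>e\<close>, for \<open>e\<^sub>k = 1\<close>, to the hyperplane where coordinate \<open>k\<close> is zero. A polynomial in the variables below \<open>k\<close>
  becomes constant along \<open>e\<close> when it is composed with this projection.
\<close>

definition shear :: "nat \<Rightarrow> (nat \<Rightarrow> complex) \<Rightarrow> (nat \<Rightarrow> complex) \<Rightarrow> nat \<Rightarrow> complex" where
  "shear k e z = (\<lambda>i. z i - z k * e i)"

definition eval_coeffs :: "(nat \<Rightarrow> complex) \<Rightarrow> mpoly poly \<Rightarrow> complex poly" where
  "eval_coeffs x P = map_poly (\<lambda>c. mpoly_eval c x) P"

lemma coeff_eval_coeffs: "coeff (eval_coeffs x P) i = mpoly_eval (coeff P i) x"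
  by (simp add: eval_coeffs_def coeff_map_poly)

text \<open>
  A condition under which \<open>x \<mapsto> x + t q(x) e\<close> preserves the complement of \<open>Z\<close>, with inverse
  \<open>x \<mapsto> x - t q(x) e\<close>.
\<close>

definition is_flow :: "nat \<Rightarrow> (nat \<Rightarrow> complex) set \<Rightarrow> mpoly \<Rightarrow> (nat \<Rightarrow> complex) \<Rightarrow> bool" where
  "is_flow n Z q e \<longleftrightarrow> q \<in> polys n \<and> vanishes_on q Z \<and>
     (\<forall>x t. mpoly_eval q (\<lambda>i. x i + t * e i) = mpoly_eval q x)"

text \<open>
  The polynomial in the coordinates \<open>(x, t)\<close> of the point \<open>x + t e\<close>, where \<open>x\<close> runs through the hyperplane.
\<close>

lemma polys_shear_ex_upoly:
  assumes p: "p \<in> polys (Suc k)" and e: "e k = 1"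
  shows "\<exists>P\<in>upolys k. \<forall>z t. poly (eval_coeffs (shear k e z) P) (z k + t)
            = mpoly_eval p (\<lambda>i. z i + t * e i)"
proof -
  have "mpolyfun (Suc k) (\<lambda>z. mpoly_eval p (\<lambda>i. (if i = k then 0 else z i) + z k * e i))"
  proof (rule mpolyfun_compose[OF mpolyfun_eval[OF p]])
    show "mpolyfun (Suc k) (\<lambda>z. (if i = k then 0 else z i) + z k * e i)" if "i < Suc k" for i
      using that by (cases "i = k") (simp_all add: mpolyfun_add mpolyfun_mult mpolyfun_coord mpolyfun_const)
  qed
  then obtain p' where p'_polys: "p' \<in> polys (Suc k)"
    and p'_eq: "(\<lambda>z. mpoly_eval p (\<lambda>i. (if i = k then 0 else z i) + z k * e i)) = mpoly_eval p'"
    by (rule mpolyfunE)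
  have p'_eval: "mpoly_eval p' z = mpoly_eval p (\<lambda>i. (if i = k then 0 else z i) + z k * e i)" for z
    using fun_cong[OF p'_eq] by simp
  obtain P where P: "P \<in> upolys k" "p' = poly P (var k)"
    using polys_Suc_ex_poly[OF p'_polys] unfolding upolys_def by blast
  have "poly (eval_coeffs (shear k e z) P) (z k + t)
            = mpoly_eval p (\<lambda>i. z i + t * e i)" for z t
  proof -
    let ?w = "(\<lambda>i. z i - z k * e i)(k := z k + t)"
    have "eval_coeffs (shear k e z) P = eval_coeffs ?w P"
      unfolding eval_coeffs_def shear_def using P(1) by (intro map_poly_eval_cong[of P k]) (auto simp: upolys_def)
    then have "poly (eval_coeffs (shear k e z) P) (z k + t) = mpoly_eval p' ?w"
      unfolding P(2) mpoly_eval_poly_var eval_coeffs_def by simp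
    also have "\<dots> = mpoly_eval p (\<lambda>i. z i + t * e i)"
      unfolding p'_eval using e by (intro arg_cong[where f = "mpoly_eval p"]) (auto simp: algebra_simps)
    finally show ?thesis .
  qed
  with P(1) show ?thesis by (intro bexI[OF _ P(1)] allI)
qed

text \<open>
  The values of the coefficients of \<open>P\<close> at every point are the coefficients of \<open>p\<close> on a line, so the
  formal degree and leading coefficient of \<open>P\<close> can be read off from the lines.
\<close>

lemma constant_lead_ex_upoly:
  assumes p: "p \<in> polys (Suc k)" and e: "e k = 1" and c: "c \<noteq> 0"
    and lines: "constant_lead_along p e D c"
  shows "\<exists>P\<in>upolys k. degree P = D \<and> lead_coeff P = Poly_Mapping.single 0 c \<and>
    (\<forall>z t. poly (eval_coeffs (shear k e z) P) (z k + t) = mpoly_eval p (\<lambda>i. z i + t * e i))"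
proof -
  obtain P where P: "P \<in> upolys k" and P_eval:
    "\<forall>z t. poly (eval_coeffs (shear k e z) P) (z k + t) = mpoly_eval p (\<lambda>i. z i + t * e i)"
    using polys_shear_ex_upoly[of p k e, OF p e] by (rule bexE)
  have deg: "degree (eval_coeffs x P) = D \<and> coeff (eval_coeffs x P) D = c" for x
  proof -
    let ?z = "x(k := 0)"
    have "eval_coeffs x P = eval_coeffs (shear k e ?z) P"
      unfolding eval_coeffs_def shear_def using P by (intro map_poly_eval_cong[of P k]) (auto simp: upolys_def)
    moreover obtain r where r: "degree r = D" "coeff r D = c" "\<And>t. poly r t = mpoly_eval p (\<lambda>i. ?z i + t * e i)"
      using lines unfolding constant_lead_along_def by blast
    moreover have "poly (eval_coeffs (shear k e ?z) P) t = poly r t" for t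
      using P_eval[rule_format, of ?z t] r(3) by simp
    then have "eval_coeffs (shear k e ?z) P = r"
      by (intro poly_ext)
    ultimately show ?thesis by simp
  qed
  have "coeff P i = (if i = D then Poly_Mapping.single 0 c else 0)" if "i \<ge> D" for i
  proof -
    have "mpoly_eval (coeff P i) x = mpoly_eval (if i = D then Poly_Mapping.single 0 c else 0) x" for x
      using deg[of x] that coeff_eq_0[of "eval_coeffs x P" i]
      by (cases "i = D") (auto simp: coeff_eval_coeffs)
    then show ?thesis
      using P by (subst mpoly_eq_iff_eval[of _ k]) (auto simp: upolys_def)
  qed
  then have "coeff P D = Poly_Mapping.single 0 c" "\<And>i. i > D \<Longrightarrow> coeff P i = 0" by auto
  note cf = this
  have "Poly_Mapping.single 0 c \<noteq> (0 :: mpoly)"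
    using c by (metis lookup_single_eq lookup_zero)
  with cf have "degree P = D"
    by (intro le_antisym degree_le le_degree) auto
  with cf(1) have "lead_coeff P = Poly_Mapping.single 0 c" by simp
  with \<open>degree P = D\<close> show ?thesis
    by (intro bexI[OF _ P] conjI P_eval)
qed

text \<open>
  The resultant along \<open>e\<close> of \<open>p\<close> and another polynomial \<open>g\<close> is constant along \<open>e\<close>, and it vanishes exactly at
  the points whose line in direction \<open>e\<close> contains a common zero of \<open>p\<close> and \<open>g\<close>. If both vanish on \<open>Z\<close>, so
  does the resultant. Because \<open>p\<close> has only finitely many zeros on the line through \<open>v\<close>, and these lie
  outside \<open>Z\<close>, some \<open>g\<close> in the ideal of \<open>Z\<close> is nonzero at all of them.
\<close>

lemma shear_invariant_function:
  assumes Z: "closedin (zariski (Suc k)) Z"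
    and p: "p \<in> polys (Suc k)" "vanishes_on p Z" and e: "e k = 1" and c: "c \<noteq> 0"
    and lines: "constant_lead_along p e D c"
    and v: "\<And>t. aff_proj (Suc k) (\<lambda>i. v i + t * e i) \<notin> Z"
  shows "\<exists>q. is_flow (Suc k) Z q e \<and> mpoly_eval q v \<noteq> 0"
proof -
  let ?n = "Suc k"
  define ev where "ev = (\<lambda>z. eval_coeffs (shear k e z))"
  obtain P where "P \<in> upolys k" and P_props: "degree P = D \<and> lead_coeff P = Poly_Mapping.single 0 c \<and>
    (\<forall>z t. poly (eval_coeffs (shear k e z) P) (z k + t)
      = mpoly_eval p (\<lambda>i. z i + t * e i))"
    using constant_lead_ex_upoly[of p k e c D, OF p(1) e c lines] by (rule bexE)
  note P = this(1) conjunct1[OF P_props] conjunct1[OF conjunct2[OF P_props]]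
  note P_eval = conjunct2[OF conjunct2[OF P_props]]
  have evP: "poly (ev z P) (z k + t) = mpoly_eval p (\<lambda>i. z i + t * e i)" for z t
    unfolding ev_def by (rule P_eval[rule_format])
  \<comment> \<open>The zeros of \<open>p\<close> on the line through \<open>v\<close>.\<close>
  define F where "F = (\<lambda>t. aff_proj ?n (\<lambda>i. v i + (t - v k) * e i)) ` {t. poly (ev v P) t = 0}"
  have ev_hom: "comm_ring_hom (\<lambda>c. mpoly_eval c (shear k e z))" for z by (rule mpoly_eval_hom)
  have ev_P: "degree (ev z P) = D" "coeff (ev z P) D = c" for z
  proof -
    show cf: "coeff (ev z P) D = c"
      using P(2,3) by (simp add: ev_def coeff_eval_coeffs)
    show "degree (ev z P) = D"
      using cf c P(2) unfolding ev_def eval_coeffs_def by (intro le_antisym le_degree order_trans[OF degree_map_poly_le]) auto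
  qed
  then have ev_P_nz: "ev z P \<noteq> 0" for z using c by (metis coeff_0)
  have "finite F" unfolding F_def using ev_P_nz by (intro finite_imageI poly_roots_finite)
  moreover have "F \<inter> Z = {}" using v unfolding F_def by auto
  moreover have "F \<subseteq> affine_space ?n" unfolding F_def by auto
  ultimately obtain g where "g \<in> polys ?n" and g_props: "vanishes_on g Z \<and> (\<forall>x\<in>F. mpoly_eval g x \<noteq> 0)"
    using closed_separate_finite[OF Z, of F] by metis
  note g = this(1) conjunct1[OF g_props] bspec[OF conjunct2[OF g_props]]
  obtain G where G: "G \<in> upolys k" and G_eval: "\<forall>z t. poly (eval_coeffs (shear k e z) G) (z k + t)
      = mpoly_eval g (\<lambda>i. z i + t * e i)"
    using polys_shear_ex_upoly[of g k e, OF g(1) e] by (rule bexE)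
  have evG: "poly (ev z G) (z k + t) = mpoly_eval g (\<lambda>i. z i + t * e i)" for z t
    unfolding ev_def by (rule G_eval[rule_format])
  \<comment> \<open>Adding a multiple of \<open>P\<close> makes the degree independent of the point without changing the common zeros.\<close>
  define N where "N = Suc (degree G)"
  define G' where "G' = G + Polynomial.monom 1 N * P"
  have G'_up: "G' \<in> upolys k"
    unfolding G'_def using G P by (intro upolys_add upolys_mult upolys_monom polys_1)
  have ev_G': "ev z G' = ev z G + Polynomial.monom 1 N * ev z P" for z
  proof -
    interpret comm_ring_hom "\<lambda>c. mpoly_eval c (shear k e z)" by (rule ev_hom)
    interpret mp: map_poly_comm_ring_hom "\<lambda>c. mpoly_eval c (shear k e z)" ..
    show ?thesis unfolding ev_def eval_coeffs_def G'_def by (simp add: mp.hom_add mp.hom_mult map_poly_monom)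
  qed
  have deg: "degree (G0 + Polynomial.monom 1 N * Q) = N + D"
    if "degree G0 < N" "degree Q = D" "Q \<noteq> 0" for G0 Q :: "'a::idom poly"
  proof -
    have "degree (Polynomial.monom 1 N * Q) = N + D"
      using that by (subst degree_mult_eq) (auto simp: degree_monom_eq)
    then show ?thesis using that by (subst degree_add_eq_right) auto
  qed
  have P_nz: "P \<noteq> 0" using ev_P_nz[of v] by (auto simp: ev_def eval_coeffs_def)
  have deg_G': "degree G' = N + D"
    unfolding G'_def by (rule deg) (use P P_nz in \<open>auto simp: N_def\<close>)
  have deg_ev_G': "degree (ev z G') = N + D" for z
    unfolding ev_G' by (rule deg) (use ev_P ev_P_nz in
        \<open>auto simp: N_def ev_def eval_coeffs_def less_Suc_eq_le intro: degree_map_poly_le\<close>)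
  define R where "R = resultant P G'"
  have R: "mpoly_eval R (shear k e z) = 0 \<longleftrightarrow> (\<exists>t. poly (ev z P) t = 0 \<and> poly (ev z G) t = 0)" for z
  proof -
    have "mpoly_eval R (shear k e z) = resultant (ev z P) (ev z G')"
      unfolding R_def ev_def eval_coeffs_def
      by (rule comm_ring_hom.resultant_map_poly[OF ev_hom, symmetric])
        (use ev_P[of z] P(2) deg_G' deg_ev_G'[of z] in \<open>auto simp: ev_def eval_coeffs_def\<close>)
    then have "mpoly_eval R (shear k e z) = 0 \<longleftrightarrow> (\<exists>t. poly (ev z P) t = 0 \<and> poly (ev z G') t = 0)"
      by (simp only: resultant_complex_0_iff[OF ev_P_nz])
    then show ?thesis by (auto simp: ev_G')
  qed
  have "mpolyfun ?n (\<lambda>z. mpoly_eval R (shear k e z))"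
    by (rule mpolyfun_compose[OF mpolyfun_eval[OF resultant_in_polys[OF P(1) G'_up, folded R_def]]])
      (simp add: shear_def mpolyfun_diff mpolyfun_mult mpolyfun_coord mpolyfun_const)
  then obtain q where q: "q \<in> polys ?n" "\<And>z. mpoly_eval q z = mpoly_eval R (shear k e z)"
    unfolding mpolyfun_def by metis
  have "vanishes_on q Z"
    unfolding vanishes_on_def
  proof
    fix z assume "z \<in> Z"
    then have "poly (ev z P) (z k) = 0" "poly (ev z G) (z k) = 0"
      using evP[of z 0] evG[of z 0] p(2) g(2) by (auto simp: vanishes_on_def)
    then show "mpoly_eval q z = 0" unfolding q(2) R by blast
  qed
  moreover have "mpoly_eval q v \<noteq> 0"
  proof
    assume "mpoly_eval q v = 0"
    then obtain t where t: "poly (ev v P) t = 0" "poly (ev v G) t = 0"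
      unfolding q(2) R by blast
    then have "mpoly_eval g (\<lambda>i. v i + (t - v k) * e i) = 0"
      using evG[of v "t - v k"] by simp
    then have "mpoly_eval g (aff_proj ?n (\<lambda>i. v i + (t - v k) * e i)) = 0"
      using g(1) by (simp add: mpoly_eval_aff_proj)
    then show False using g(3) t(1) unfolding F_def by blast
  qed
  moreover have "mpoly_eval q (\<lambda>i. x i + t * e i) = mpoly_eval q x" for x t
  proof -
    have "shear k e (\<lambda>i. x i + t * e i) = shear k e x" using e by (auto simp: shear_def algebra_simps)
    then show ?thesis unfolding q(2) by simp
  qed
  ultimately show ?thesis using q(1) unfolding is_flow_def by blast
qed

section \<open>Reaching the complement by flows\<close>

lemma invariant_function_exists:
  assumes Z: "closedin (zariski (Suc k)) Z" and codim: "codim (zariski (Suc k)) Z \<ge> 2"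
    and v: "aff_proj (Suc k) v \<notin> Z"
  shows "\<exists>b\<in>polys k. b \<noteq> 0 \<and> (\<forall>e. e k = 1 \<longrightarrow> mpoly_eval b e \<noteq> 0 \<longrightarrow>
     (\<exists>q. is_flow (Suc k) Z q e \<and> mpoly_eval q v \<noteq> 0))"
proof -
  obtain p where p: "p \<in> polys (Suc k)" "vanishes_on p Z" "mpoly_eval p (aff_proj (Suc k) v) \<noteq> 0"
    using closedin_zariski_separate[OF Z aff_proj_in v] by blast
  then have "p \<noteq> 0" by auto
  obtain a where a: "a \<in> polys k" and "\<exists>D. a \<noteq> 0 \<and> (\<forall>e. e k = 1 \<longrightarrow> mpoly_eval a e \<noteq> 0 \<longrightarrow>
    constant_lead_along p e D (mpoly_eval a e))"
    using generic_direction[OF p(1) \<open>p \<noteq> 0\<close>] by (rule bexE)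
  then obtain D where a_D: "a \<noteq> 0 \<and> (\<forall>e. e k = 1 \<longrightarrow> mpoly_eval a e \<noteq> 0 \<longrightarrow>
    constant_lead_along p e D (mpoly_eval a e))"
    by (elim exE)
  obtain b where b: "b \<in> polys k" and b_line: "b \<noteq> 0 \<and> (\<forall>e t. e k = 1 \<longrightarrow> mpoly_eval b e \<noteq> 0 \<longrightarrow>
     aff_proj (Suc k) (\<lambda>i. v i + t * e i) \<notin> Z)"
    using generic_line_avoids[OF Z codim v] by (rule bexE)
  show ?thesis
  proof (intro bexI[OF _ polys_mult[OF a b]] conjI allI impI)
    show "a * b \<noteq> 0" using a_D b_line by simp
  next
    fix e assume e: "e k = 1" "mpoly_eval (a * b) e \<noteq> 0"
    then have ne: "mpoly_eval a e \<noteq> 0" "mpoly_eval b e \<noteq> 0" by (simp_all add: mpoly_eval_mult)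
    show "\<exists>q. is_flow (Suc k) Z q e \<and> mpoly_eval q v \<noteq> 0"
      by (rule shear_invariant_function[OF Z p(1,2) e(1) ne(1)
            conjunct2[OF a_D, rule_format, OF e(1) ne(1)] conjunct2[OF b_line, rule_format, OF e(1) ne(2)]])
  qed
qed

definition polymap_avoiding :: "nat \<Rightarrow> (nat \<Rightarrow> complex) set \<Rightarrow> nat \<Rightarrow> ((nat \<Rightarrow> complex) \<Rightarrow> nat \<Rightarrow> complex) \<Rightarrow> bool" where
  "polymap_avoiding n Z m \<phi> \<longleftrightarrow> (\<forall>i. mpolyfun m (\<lambda>y. \<phi> y i)) \<and> (\<forall>y. aff_proj n (\<phi> y) \<notin> Z)"

lemma flow_avoids:
  assumes "is_flow n Z q e" "aff_proj n x \<notin> Z"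
  shows "aff_proj n (\<lambda>i. x i + s * mpoly_eval q x * e i) \<notin> Z"
proof
  let ?y = "\<lambda>i. x i + s * mpoly_eval q x * e i"
  assume *: "aff_proj n ?y \<in> Z"
  have q: "q \<in> polys n" "vanishes_on q Z" "mpoly_eval q ?y = mpoly_eval q x"
    using assms(1) unfolding is_flow_def by blast+
  have "mpoly_eval q (aff_proj n ?y) = 0"
    using q(2) * unfolding vanishes_on_def by blast
  then have "mpoly_eval q x = 0" using q by (simp add: mpoly_eval_aff_proj)
  with * assms(2) show False by simp
qed

text \<open>
  One flow costs one parameter: the new coordinate \<open>y m\<close> is the time for which it runs. The map \<open>\<phi>\<close>
  does not depend on this coordinate, so the time can be set freely.
\<close>

lemma polymap_avoiding_flow:
  assumes phi: "polymap_avoiding n Z m \<phi>" and flow: "is_flow n Z q e"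
    and \<psi>_def: "\<psi> = (\<lambda>y i. \<phi> y i + y m * mpoly_eval q (\<phi> y) * e i)"
  shows "polymap_avoiding n Z (Suc m) \<psi>"
    and "\<psi> (y(m := s)) = (\<lambda>i. \<phi> y i + s * mpoly_eval q (\<phi> y) * e i)"
proof -
  have q: "q \<in> polys n" using flow by (simp add: is_flow_def)
  have phi_i: "mpolyfun m (\<lambda>y. \<phi> y i)" for i using phi by (simp add: polymap_avoiding_def)
  then have phi_i': "mpolyfun (Suc m) (\<lambda>y. \<phi> y i)" for i by (rule mpolyfun_mono[rotated]) simp
  have "mpolyfun (Suc m) (\<lambda>y. mpoly_eval q (\<phi> y))"
    by (rule mpolyfun_compose[OF mpolyfun_eval[OF q] phi_i'])
  then have "mpolyfun (Suc m) (\<lambda>y. \<psi> y i)" for i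
    unfolding \<psi>_def by (intro mpolyfun_add mpolyfun_mult phi_i' mpolyfun_coord mpolyfun_const) auto
  moreover have "aff_proj n (\<psi> y) \<notin> Z" for y
    unfolding \<psi>_def using phi by (intro flow_avoids[OF flow]) (simp add: polymap_avoiding_def)
  ultimately show "polymap_avoiding n Z (Suc m) \<psi>"
    by (simp add: polymap_avoiding_def)
  have "\<phi> (y(m := s)) = \<phi> y"
  proof
    show "\<phi> (y(m := s)) i = \<phi> y i" for i by (rule mpolyfun_cong[OF phi_i]) simp
  qed
  then show "\<psi> (y(m := s)) = (\<lambda>i. \<phi> y i + s * mpoly_eval q (\<phi> y) * e i)"
    by (simp add: \<psi>_def)
qed

text \<open>
  One flow costs one parameter: the new coordinate \<open>y m\<close> is the time for which it runs. The map \<open>\<phi>\<close>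
  does not depend on this coordinate, so the time can be set freely.
\<close>

lemma polymap_avoiding_flows:
  assumes "finite Q" "\<And>q. q \<in> Q \<Longrightarrow> is_flow n Z q (e q)" "polymap_avoiding n Z m \<phi>"
  shows "\<exists>m' \<psi>. polymap_avoiding n Z m' \<psi> \<and> (\<forall>y. \<exists>y'. \<psi> y' = \<phi> y) \<and>
     (\<forall>q\<in>Q. \<forall>y s. \<exists>y'. \<psi> y' = (\<lambda>i. \<phi> y i + s * mpoly_eval q (\<phi> y) * e q i))"
  using assms(1,2)
proof (induction Q rule: finite_induct)
  case empty
  show ?case using assms(3) by blast
next
  case (insert q Q)
  then obtain m' \<psi> where psi: "polymap_avoiding n Z m' \<psi>" and a: "\<And>y. \<exists>y'. \<psi> y' = \<phi> y"
    and b: "\<And>q y s. q \<in> Q \<Longrightarrow> \<exists>y'. \<psi> y' = (\<lambda>i. \<phi> y i + s * mpoly_eval q (\<phi> y) * e q i)"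
    by (metis insertI2)
  define \<theta> where "\<theta> = (\<lambda>y i. \<psi> y i + y m' * mpoly_eval q (\<psi> y) * e q i)"
  have flow: "is_flow n Z q (e q)" using insert.prems by simp
  note chi = polymap_avoiding_flow[OF psi flow \<theta>_def]
  have ext: "\<exists>y'. \<theta> y' = \<psi> y" for y
    using chi(2)[of y 0] by auto
  have "\<exists>y'. \<theta> y' = (\<lambda>i. \<phi> y i + s * mpoly_eval p (\<phi> y) * e p i)" if p: "p \<in> insert q Q" for p y s
  proof (cases "p = q")
    case True
    obtain y' where "\<psi> y' = \<phi> y" using a by blast
    then show ?thesis using chi(2)[of y' s] True by auto
  next
    case False
    then obtain y' where "\<psi> y' = (\<lambda>i. \<phi> y i + s * mpoly_eval p (\<phi> y) * e p i)" using b[of p y s] p by blast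
    then show ?thesis using ext[of y'] by simp
  qed
  moreover have "\<exists>y'. \<theta> y' = \<phi> y" for y
    using a ext by metis
  ultimately show ?case
    using chi(1) by (intro exI[of _ "Suc m'"] exI[of _ \<theta>]) blast
qed

text \<open>
  On a coordinate line through \<open>e\<close> the polynomial has only finitely many zeros.
\<close>

lemma mpoly_eval_perturb:
  assumes "mpoly_eval p e \<noteq> 0"
  shows "\<exists>\<epsilon>. \<epsilon> \<noteq> 0 \<and> mpoly_eval p (e(i := e i + \<epsilon>)) \<noteq> 0"
proof -
  obtain r where r: "\<And>t. poly r t = mpoly_eval p (\<lambda>j. poly [:e j, if j = i then 1 else 0:] t)"
    using mpoly_eval_curve[of p "\<lambda>j. [:e j, if j = i then 1 else 0:]"] by blast
  have eq: "(\<lambda>j. poly [:e j, if j = i then 1 else 0:] t) = e(i := e i + t)" for t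
    by auto
  have "poly r 0 \<noteq> 0" using r[of 0] assms by (simp add: eq)
  then have "finite (insert 0 {t. poly r t = 0})" by (intro finite.insertI poly_roots_finite) auto
  then obtain t where "t \<notin> insert 0 {t. poly r t = 0}"
    using ex_new_if_finite[OF infinite_UNIV_char_0] by blast
  then show ?thesis using r[of t, unfolded eq] by (intro exI[of _ t]) simp
qed

text \<open>
  Let \<open>d\<^sub>0, \<dots>, d\<^sub>k\<close> be a basis of directions that carry flows moving \<open>x\<^sub>0\<close>. To reach \<open>x\<^sub>0 + \<Sum> c\<^sub>j d\<^sub>j\<close>, run
  the flows one after the other, each up to its coordinate \<open>c\<^sub>j\<close>. This succeeds as long as no flow stands
  still at the point reached so far, which is the condition that the product \<open>s\<close> of the functions
  \<open>q\<^sub>l\<close> at the intermediate points is nonzero. At the target \<open>x\<^sub>0\<close> every intermediate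
  point is \<open>x\<^sub>0\<close>, so \<open>s\<close> is not zero.
\<close>

lemma reach_generic_points:
  assumes Z: "closedin (zariski (Suc k)) Z" and codim: "codim (zariski (Suc k)) Z \<ge> 2"
    and x0: "aff_proj (Suc k) x\<^sub>0 \<notin> Z"
  shows "\<exists>m \<phi>. polymap_avoiding (Suc k) Z m \<phi> \<and>
    (\<exists>s\<in>polys (Suc k). s \<noteq> 0 \<and> (\<forall>x. mpoly_eval s x \<noteq> 0 \<longrightarrow> (\<exists>y. \<forall>i<Suc k. \<phi> y i = x i)))"
proof -
  let ?n = "Suc k"
  obtain b where b: "b \<in> polys k" and b_props: "b \<noteq> 0 \<and> (\<forall>e. e k = 1 \<longrightarrow> mpoly_eval b e \<noteq> 0 \<longrightarrow>
     (\<exists>q. is_flow ?n Z q e \<and> mpoly_eval q x\<^sub>0 \<noteq> 0))"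
    using invariant_function_exists[OF Z codim x0] by (rule bexE)
  obtain w where w: "mpoly_eval b w \<noteq> 0" using mpoly_nonzero_ex_eval[OF b] b_props by blast
  define e where "e = w(k := 1)"
  have e: "mpoly_eval b e \<noteq> 0" "e k = 1"
    using w mpoly_eval_cong[OF b, of e w] by (auto simp: e_def)
  obtain \<epsilon> where eps: "\<And>i. \<epsilon> i \<noteq> 0" "\<And>i. mpoly_eval b (e(i := e i + \<epsilon> i)) \<noteq> 0"
    using mpoly_eval_perturb[OF e(1)] by metis
  \<comment> \<open>Linearly independent directions, all of them generic.\<close>
  define d where "d = (\<lambda>j i. e i + (if i = j \<and> j < k then \<epsilon> j else 0))"
  have "\<exists>q. is_flow ?n Z q (d j) \<and> mpoly_eval q x\<^sub>0 \<noteq> 0" for j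
  proof -
    have "d j = (if j < k then e(j := e j + \<epsilon> j) else e)" by (auto simp: d_def)
    then have "d j k = 1" "mpoly_eval b (d j) \<noteq> 0" using e eps by auto
    then show ?thesis
      using b_props by blast
  qed
  then obtain q where q: "\<And>j. is_flow ?n Z (q j) (d j)" "\<And>j. mpoly_eval (q j) x\<^sub>0 \<noteq> 0"
    by metis
  define P where "P = (\<lambda>c j i. x\<^sub>0 i + (\<Sum>l<j. c l * d l i))"
  have reach: "\<exists>m \<phi>. polymap_avoiding ?n Z m \<phi> \<and>
      (\<forall>c. (\<forall>l<j. mpoly_eval (q l) (P c l) \<noteq> 0) \<longrightarrow> (\<exists>y. \<phi> y = P c j))" for j
  proof (induction j)
    case 0
    have "polymap_avoiding ?n Z 0 (\<lambda>_. x\<^sub>0)"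
      using x0 by (simp add: polymap_avoiding_def mpolyfun_const)
    then show ?case by (auto simp: P_def)
  next
    case (Suc j)
    then obtain m \<phi> where phi: "polymap_avoiding ?n Z m \<phi>"
      "\<And>c. (\<forall>l<j. mpoly_eval (q l) (P c l) \<noteq> 0) \<Longrightarrow> \<exists>y. \<phi> y = P c j" by blast
    define \<psi> where "\<psi> = (\<lambda>y i. \<phi> y i + y m * mpoly_eval (q j) (\<phi> y) * d j i)"
    note psi = polymap_avoiding_flow[OF phi(1) q(1)[of j] \<psi>_def]
    have "\<exists>y. \<psi> y = P c (Suc j)" if c: "\<forall>l<Suc j. mpoly_eval (q l) (P c l) \<noteq> 0" for c
    proof -
      obtain y where y: "\<phi> y = P c j" using phi(2)[of c] c by auto
      have "\<psi> (y(m := c j / mpoly_eval (q j) (P c j))) = P c (Suc j)"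
        unfolding psi(2) y using c by (auto simp: P_def)
      then show ?thesis by blast
    qed
    with psi(1) show ?case by blast
  qed
  then obtain m \<phi> where phi: "polymap_avoiding ?n Z m \<phi>"
    "\<And>c. (\<forall>l<?n. mpoly_eval (q l) (P c l) \<noteq> 0) \<Longrightarrow> \<exists>y. \<phi> y = P c ?n" by blast
  \<comment> \<open>The coordinates of a point with respect to the origin \<open>x\<^sub>0\<close> and the basis \<open>d\<close>.\<close>
  define c' where "c' = (\<lambda>x i. (x i - x\<^sub>0 i - (x k - x\<^sub>0 k) * e i) / \<epsilon> i)"
  define c where "c = (\<lambda>x i. if i < k then c' x i else (x k - x\<^sub>0 k) - (\<Sum>l<k. c' x l))"
  have c'_poly: "mpolyfun ?n (\<lambda>x. c' x i)" if "i < ?n" for i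
  proof -
    have "mpolyfun ?n (\<lambda>x. (x i - x\<^sub>0 i - (x k - x\<^sub>0 k) * e i) * inverse (\<epsilon> i))"
      using that by (intro mpolyfun_mult mpolyfun_diff mpolyfun_coord mpolyfun_const) auto
    then show ?thesis by (simp add: c'_def divide_inverse)
  qed
  have c_poly: "mpolyfun ?n (\<lambda>x. c x i)" if "i < ?n" for i
  proof (cases "i < k")
    case True
    then show ?thesis using c'_poly by (simp add: c_def)
  next
    case False
    have "mpolyfun ?n (\<lambda>x. (x k - x\<^sub>0 k) - (\<Sum>l<k. c' x l))"
      by (intro mpolyfun_diff mpolyfun_sum mpolyfun_coord mpolyfun_const c'_poly) auto
    with False show ?thesis by (simp add: c_def)
  qed
  have sum_c: "(\<Sum>l<?n. c x l) = x k - x\<^sub>0 k" for x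
    by (simp add: c_def)
  have P_c: "P (c x) ?n i = x i" if "i < ?n" for x i
  proof -
    have "(\<Sum>l<?n. c x l * d l i) = (\<Sum>l<?n. c x l) * e i + (\<Sum>l<?n. c x l * (if i = l \<and> l < k then \<epsilon> l else 0))"
      by (simp add: d_def distrib_left sum.distrib sum_distrib_right del: sum.lessThan_Suc)
    also have "(\<Sum>l<?n. c x l * (if i = l \<and> l < k then \<epsilon> l else 0)) = (if i < k then c x i * \<epsilon> i else 0)"
      using that by (subst sum.remove[of _ i]) (auto intro!: sum.neutral)
    also have "\<dots> = x i - x\<^sub>0 i - (x k - x\<^sub>0 k) * e i"
      using that eps(1) e(2) by (cases "i = k") (auto simp: c_def c'_def)
    finally show ?thesis by (simp add: P_def sum_c del: sum.lessThan_Suc)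
  qed
  have "mpolyfun ?n (\<lambda>x. mpoly_eval (q l) (P (c x) l))" if "l < ?n" for l
  proof (rule mpolyfun_compose[OF mpolyfun_eval])
    show "q l \<in> polys ?n" using q(1)[of l] by (simp add: is_flow_def)
    show "mpolyfun ?n (\<lambda>x. P (c x) l i)" for i
      unfolding P_def using that
      by (intro mpolyfun_add mpolyfun_sum mpolyfun_mult mpolyfun_const c_poly) auto
  qed
  then have "mpolyfun ?n (\<lambda>x. \<Prod>l<?n. mpoly_eval (q l) (P (c x) l))"
    by (intro mpolyfun_prod) auto
  then obtain s where s: "s \<in> polys ?n" "\<And>x. mpoly_eval s x = (\<Prod>l<?n. mpoly_eval (q l) (P (c x) l))"
    unfolding mpolyfun_def by metis
  have "c x\<^sub>0 l = 0" for l by (simp add: c_def c'_def)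
  then have "mpoly_eval s x\<^sub>0 \<noteq> 0" using q(2) by (simp add: s(2) P_def)
  then have "s \<noteq> 0" by auto
  moreover have "\<exists>y. \<forall>i<?n. \<phi> y i = x i" if "mpoly_eval s x \<noteq> 0" for x
  proof -
    have "\<forall>l<?n. mpoly_eval (q l) (P (c x) l) \<noteq> 0"
      using that unfolding s(2) by (auto simp: less_Suc_eq)
    then obtain y where "\<phi> y = P (c x) ?n" using phi(2) by blast
    then show ?thesis using P_c by (intro exI[of _ y]) auto
  qed
  ultimately show ?thesis using phi(1) s(1) by blast
qed

text \<open>
  Besides not vanishing at \<open>v\<close>, the flow used for \<open>v\<close> has a direction in which every line leaves the hypersurface
  \<open>s = 0\<close>. From \<open>v\<close> one flows backwards to a point with \<open>s \<noteq> 0\<close>, which is already reached. The functions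
  \<open>q\<close> of these flows have no common zero outside \<open>Z\<close>, hence neither do finitely many of them.
\<close>

lemma polymap_onto_complement:
  assumes Z: "closedin (zariski (Suc k)) Z" and codim: "codim (zariski (Suc k)) Z \<ge> 2"
    and x0: "aff_proj (Suc k) x\<^sub>0 \<notin> Z"
  shows "\<exists>m \<phi>. polymap_avoiding (Suc k) Z m \<phi> \<and>
    (\<forall>x. aff_proj (Suc k) x \<notin> Z \<longrightarrow> (\<exists>y. \<forall>i<Suc k. \<phi> y i = x i))"
proof -
  let ?n = "Suc k"
  obtain m \<phi> s where phi: "polymap_avoiding ?n Z m \<phi>" and s: "s \<in> polys ?n" "s \<noteq> 0"
    and reach: "\<And>x. mpoly_eval s x \<noteq> 0 \<Longrightarrow> \<exists>y. \<forall>i<?n. \<phi> y i = x i"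
    using reach_generic_points[OF Z codim x0] by metis
  obtain a where a: "a \<in> polys k" and "\<exists>D. a \<noteq> 0 \<and> (\<forall>e. e k = 1 \<longrightarrow> mpoly_eval a e \<noteq> 0 \<longrightarrow>
    constant_lead_along s e D (mpoly_eval a e))"
    using generic_direction[OF s] by (rule bexE)
  then obtain D where a_D: "a \<noteq> 0 \<and> (\<forall>e. e k = 1 \<longrightarrow> mpoly_eval a e \<noteq> 0 \<longrightarrow>
    constant_lead_along s e D (mpoly_eval a e))"
    by (elim exE)
  have transversal: "\<exists>t. mpoly_eval s (\<lambda>i. x i + t * e i) \<noteq> 0" if e: "e k = 1" "mpoly_eval a e \<noteq> 0" for e x
  proof -
    obtain r where r: "coeff r D = mpoly_eval a e" "\<And>t. poly r t = mpoly_eval s (\<lambda>i. x i + t * e i)"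
      using conjunct2[OF a_D, rule_format, OF e] unfolding constant_lead_along_def by blast
    with e have "r \<noteq> 0" by auto
    then obtain t where "poly r t \<noteq> 0" using poly_all_0_iff_0 by blast
    with r show ?thesis by auto
  qed
  define Q where "Q = {q. \<exists>e. is_flow ?n Z q e \<and> (\<forall>x. \<exists>t. mpoly_eval s (\<lambda>i. x i + t * e i) \<noteq> 0)}"
  have Q_v: "\<exists>q\<in>Q. mpoly_eval q v \<noteq> 0" if v: "aff_proj ?n v \<notin> Z" for v
  proof -
    obtain b where b: "b \<in> polys k" and b_props: "b \<noteq> 0 \<and> (\<forall>e. e k = 1 \<longrightarrow> mpoly_eval b e \<noteq> 0 \<longrightarrow>
       (\<exists>q. is_flow ?n Z q e \<and> mpoly_eval q v \<noteq> 0))"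
      using invariant_function_exists[OF Z codim v] by (rule bexE)
    have "a * b \<noteq> 0" using a_D b_props by simp
    then obtain w where w: "mpoly_eval (a * b) w \<noteq> 0"
      using mpoly_nonzero_ex_eval[OF polys_mult[OF a b]] by blast
    define e where "e = w(k := 1)"
    have e: "e k = 1" "mpoly_eval a e \<noteq> 0" "mpoly_eval b e \<noteq> 0"
      using w mpoly_eval_cong[OF a, of e w] mpoly_eval_cong[OF b, of e w]
      by (auto simp: e_def mpoly_eval_mult)
    obtain q where "is_flow ?n Z q e" "mpoly_eval q v \<noteq> 0"
      using conjunct2[OF b_props, rule_format, OF e(1,3)] by blast
    then show ?thesis using transversal[OF e(1,2)] unfolding Q_def by blast
  qed
  have "Q \<subseteq> polys ?n" unfolding Q_def is_flow_def by blast
  from zero_locus_finite[OF this] obtain G where G: "G \<subseteq> Q" "finite G"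
    "\<And>x. (\<forall>p\<in>G. mpoly_eval p x = 0) \<Longrightarrow> (\<forall>p\<in>Q. mpoly_eval p x = 0)" by metis
  have "\<forall>q\<in>G. \<exists>e. is_flow ?n Z q e \<and> (\<forall>x. \<exists>t. mpoly_eval s (\<lambda>i. x i + t * e i) \<noteq> 0)"
    using G(1) unfolding Q_def by blast
  then obtain e where "\<forall>q\<in>G. is_flow ?n Z q (e q) \<and> (\<forall>x. \<exists>t. mpoly_eval s (\<lambda>i. x i + t * e q i) \<noteq> 0)"
    by (rule bchoice[THEN exE])
  then have e: "is_flow ?n Z q (e q)" "\<exists>t. mpoly_eval s (\<lambda>i. x i + t * e q i) \<noteq> 0" if "q \<in> G" for q x
    using that by simp_all
  obtain m' \<psi> where psi: "polymap_avoiding ?n Z m' \<psi>"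
    "\<And>q y s. q \<in> G \<Longrightarrow> \<exists>y'. \<psi> y' = (\<lambda>i. \<phi> y i + s * mpoly_eval q (\<phi> y) * e q i)"
    using polymap_avoiding_flows[OF G(2) e(1) phi] by metis
  have "\<exists>y. \<forall>i<?n. \<psi> y i = x i" if x: "aff_proj ?n x \<notin> Z" for x
  proof -
    obtain q where q: "q \<in> G" "mpoly_eval q x \<noteq> 0" using Q_v[OF x] G(3)[of x] by blast
    have q_polys: "q \<in> polys ?n" using e(1)[OF q(1)] by (simp add: is_flow_def)
    obtain t where "mpoly_eval s (\<lambda>i. x i + t * e q i) \<noteq> 0" using e(2)[OF q(1)] by blast
    then obtain y where y: "\<And>i. i < ?n \<Longrightarrow> \<phi> y i = x i + t * e q i" using reach by blast
    have "mpoly_eval q (\<phi> y) = mpoly_eval q (\<lambda>i. x i + t * e q i)"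
      using y by (intro mpoly_eval_cong[OF q_polys])
    also have "\<dots> = mpoly_eval q x"
      using e(1)[OF q(1)] by (simp add: is_flow_def)
    finally have q_y: "mpoly_eval q (\<phi> y) = mpoly_eval q x" .
    obtain y' where y': "\<psi> y' = (\<lambda>i. \<phi> y i + (- t / mpoly_eval q x) * mpoly_eval q (\<phi> y) * e q i)"
      using psi(2)[OF q(1)] by blast
    have "\<psi> y' i = x i" if "i < ?n" for i
      using q(2) by (simp add: y' q_y y[OF that])
    then show ?thesis by blast
  qed
  with psi(1) show ?thesis by blast
qed

section \<open>Polynomial maps are morphisms\<close>

lemma variety_morphism_polymap:
  assumes phi: "\<And>i. i < n \<Longrightarrow> mpolyfun m (\<lambda>y. \<phi> y i)"
  shows "variety_morphism m n (\<lambda>y. aff_proj n (\<phi> y))"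
proof -
  let ?f = "\<lambda>y. aff_proj n (\<phi> y)"
  have pull: "\<exists>p'\<in>polys m. \<forall>y. mpoly_eval p' y = mpoly_eval p (?f y)" if "p \<in> polys n" for p
  proof -
    have "mpolyfun m (\<lambda>y. mpoly_eval p (\<phi> y))"
      by (rule mpolyfun_compose[OF mpolyfun_eval[OF that] phi])
    then show ?thesis
      using mpoly_eval_aff_proj[OF that] unfolding mpolyfun_def by metis
  qed
  have open_pull: "openin (zariski m) {y \<in> affine_space m. ?f y \<in> V}" if V: "openin (zariski n) V" for V
  proof -
    obtain S where S: "S \<subseteq> polys n" "V = affine_space n - zero_locus n S"
      using V unfolding openin_zariski by blast
    define S' where "S' = {p' \<in> polys m. \<exists>p\<in>S. \<forall>y. mpoly_eval p' y = mpoly_eval p (?f y)}"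
    have "?f y \<in> V \<longleftrightarrow> y \<notin> zero_locus m S'" if "y \<in> affine_space m" for y
    proof -
      have "?f y \<in> V \<longleftrightarrow> (\<exists>p\<in>S. mpoly_eval p (?f y) \<noteq> 0)"
        unfolding S(2) zero_locus_def using aff_proj_in by blast
      also have "\<dots> \<longleftrightarrow> (\<exists>p'\<in>S'. mpoly_eval p' y \<noteq> 0)"
      proof
        assume "\<exists>p\<in>S. mpoly_eval p (?f y) \<noteq> 0"
        then obtain p where p: "p \<in> S" "mpoly_eval p (?f y) \<noteq> 0" by blast
        then obtain p' where "p' \<in> polys m" "\<forall>y. mpoly_eval p' y = mpoly_eval p (?f y)"
          using pull[of p] S(1) by (meson subsetD)
        with p show "\<exists>p'\<in>S'. mpoly_eval p' y \<noteq> 0"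
          by (intro bexI[of _ p']) (auto simp: S'_def simp del: restrict_apply)
      next
        assume "\<exists>p'\<in>S'. mpoly_eval p' y \<noteq> 0"
        then show "\<exists>p\<in>S. mpoly_eval p (?f y) \<noteq> 0" unfolding S'_def by auto
      qed
      also have "\<dots> \<longleftrightarrow> y \<notin> zero_locus m S'"
        unfolding zero_locus_def using that by blast
      finally show ?thesis .
    qed
    then have "{y \<in> affine_space m. ?f y \<in> V} = affine_space m - zero_locus m S'"
      by blast
    moreover have "S' \<subseteq> polys m" by (auto simp: S'_def)
    ultimately show ?thesis unfolding openin_zariski by blast
  qed
  have "continuous_map (zariski m) (zariski n) ?f"
    unfolding continuous_map_def topspace_zariski using open_pull aff_proj_in by blast
  moreover have "regular_fun m {x \<in> affine_space m. ?f x \<in> V} (g \<circ> ?f)"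
    if V: "regular_fun n V g" for V g
    unfolding regular_fun_def
  proof
    fix x assume x: "x \<in> {x \<in> affine_space m. ?f x \<in> V}"
    then have "?f x \<in> V" by simp
    then obtain W p q where W: "openin (zariski n) W" "?f x \<in> W" "W \<subseteq> V"
      and pq: "p \<in> polys n" "q \<in> polys n" "\<forall>y\<in>W. mpoly_eval q y \<noteq> 0 \<and> g y = mpoly_eval p y / mpoly_eval q y"
      using V unfolding regular_fun_def by metis
    obtain p' where p': "p' \<in> polys m" "\<forall>y. mpoly_eval p' y = mpoly_eval p (?f y)"
      using pull[OF pq(1)] by (rule bexE)
    obtain q' where q': "q' \<in> polys m" "\<forall>y. mpoly_eval q' y = mpoly_eval q (?f y)"
      using pull[OF pq(2)] by (rule bexE)
    show "\<exists>W'. openin (zariski m) W' \<and> x \<in> W' \<and> W' \<subseteq> {x \<in> affine_space m. ?f x \<in> V} \<and>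
      (\<exists>p\<in>polys m. \<exists>q\<in>polys m. \<forall>y\<in>W'. mpoly_eval q y \<noteq> 0 \<and> (g \<circ> ?f) y = mpoly_eval p y / mpoly_eval q y)"
    proof (intro exI[of _ "{y \<in> affine_space m. ?f y \<in> W}"] conjI)
      show "openin (zariski m) {y \<in> affine_space m. ?f y \<in> W}" by (rule open_pull[OF W(1)])
      show "x \<in> {y \<in> affine_space m. ?f y \<in> W}" using x W(2) by blast
      show "{y \<in> affine_space m. ?f y \<in> W} \<subseteq> {x \<in> affine_space m. ?f x \<in> V}" using W(3) by blast
      have "mpoly_eval q' y \<noteq> 0 \<and> (g \<circ> ?f) y = mpoly_eval p' y / mpoly_eval q' y" if "?f y \<in> W" for y
      proof -
        have eq: "mpoly_eval p' y = mpoly_eval p (?f y)" "mpoly_eval q' y = mpoly_eval q (?f y)"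
          by (rule p'(2)[rule_format] q'(2)[rule_format])+
        show ?thesis unfolding eq comp_apply using pq(3) that by blast
      qed
      then show "\<exists>p\<in>polys m. \<exists>q\<in>polys m. \<forall>y\<in>{y \<in> affine_space m. ?f y \<in> W}.
          mpoly_eval q y \<noteq> 0 \<and> (g \<circ> ?f) y = mpoly_eval p y / mpoly_eval q y"
        using p'(1) q'(1) by blast
    qed
  qed
  ultimately show ?thesis
    unfolding variety_morphism_def by blast
qed

section \<open>Morphisms on lines\<close>

text \<open>
  A local representation \<open>P / Q\<close> in lowest terms is valid everywhere: where another one \<open>P' / Q'\<close>
  holds, \<open>P Q' = P' Q\<close>, so a root of \<open>Q\<close> there would be a root of \<open>P\<close>. Hence
  \<open>Q\<close> has no roots and is constant. The polynomial \<open>w\<close> describes the Zariski neighbourhood on which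
  the representation holds.
\<close>

lemma locally_rational_imp_poly:
  fixes h :: "complex \<Rightarrow> complex"
  assumes loc: "\<And>s\<^sub>0. \<exists>P Q w. poly w s\<^sub>0 \<noteq> 0 \<and>
    (\<forall>s. poly w s \<noteq> 0 \<longrightarrow> poly Q s \<noteq> 0 \<and> h s = poly P s / poly Q s)"
  shows "\<exists>r. \<forall>s. poly r s = h s"
proof -
  obtain P Q w where w: "poly w 0 \<noteq> 0"
    and PQ: "\<And>s. poly w s \<noteq> 0 \<Longrightarrow> poly Q s \<noteq> 0 \<and> h s = poly P s / poly Q s"
    using loc[of 0] by blast
  have "Q \<noteq> 0" "w \<noteq> 0" using w PQ[of 0] by auto
  define d where "d = gcd P Q"
  have "d \<noteq> 0" using \<open>Q \<noteq> 0\<close> by (simp add: d_def)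
  obtain P1 Q1 where P1: "P = d * P1" and Q1: "Q = d * Q1" and cop: "coprime P1 Q1"
    using gcd_coprime_exists[of P Q] \<open>d \<noteq> 0\<close> unfolding d_def by (auto simp: mult.commute)
  have main: "poly Q1 s0 \<noteq> 0 \<and> h s0 = poly P1 s0 / poly Q1 s0" for s0
  proof -
    obtain P' Q' w' where w': "poly w' s0 \<noteq> 0"
      and PQ': "\<And>s. poly w' s \<noteq> 0 \<Longrightarrow> poly Q' s \<noteq> 0 \<and> h s = poly P' s / poly Q' s"
      using loc[of s0] by blast
    have "w' \<noteq> 0" using w' by auto
    have "poly ((P * Q' - P' * Q) * (w * w')) s = 0" for s
      using PQ[of s] PQ'[of s] by (cases "poly w s = 0 \<or> poly w' s = 0") (auto simp: frac_eq_eq)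
    then have "(P * Q' - P' * Q) * (w * w') = 0"
      using poly_all_0_iff_0 by blast
    then have "d * (P1 * Q') = d * (P' * Q1)"
      using \<open>w \<noteq> 0\<close> \<open>w' \<noteq> 0\<close> by (simp add: P1 Q1 mult_ac)
    then have eq: "P1 * Q' = P' * Q1"
      using \<open>d \<noteq> 0\<close> by simp
    have val: "poly P1 s0 * poly Q' s0 = poly P' s0 * poly Q1 s0"
      using arg_cong[OF eq, of "\<lambda>p. poly p s0"] by simp
    have Q's: "poly Q' s0 \<noteq> 0" "h s0 = poly P' s0 / poly Q' s0" using PQ'[OF w'] by auto
    have "poly Q1 s0 \<noteq> 0"
    proof
      assume "poly Q1 s0 = 0"
      with val Q's have "[:- s0, 1:] dvd P1" "[:- s0, 1:] dvd Q1"
        by (auto simp: poly_eq_0_iff_dvd)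
      with cop have "is_unit [:- s0, 1:]" by (rule coprime_common_divisor)
      then show False by (simp add: is_unit_iff_degree)
    qed
    with val Q's show ?thesis by (simp add: frac_eq_eq)
  qed
  then have "constant (poly Q1)"
    using fundamental_theorem_of_algebra by blast
  then obtain c where "Q1 = [:c:]"
    by (metis constant_degree degree_eq_zeroE)
  with main have "\<forall>s. poly (Polynomial.smult (inverse c) P1) s = h s"
    by (simp add: field_simps)
  then show ?thesis by blast
qed

lemma regular_fun_line:
  assumes "regular_fun m (affine_space m) \<phi>"
  shows "\<exists>r. \<forall>s. poly r s = \<phi> (aff_proj m (\<lambda>j. a j + s * b j))"
proof (rule locally_rational_imp_poly)
  fix s0
  let ?g = "\<lambda>s. aff_proj m (\<lambda>j. a j + s * b j)"
  obtain W where W_props: "openin (zariski m) W \<and> ?g s0 \<in> W \<and> W \<subseteq> affine_space m \<and> (\<exists>p\<in>polys m. \<exists>q\<in>polys m.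
      \<forall>y\<in>W. mpoly_eval q y \<noteq> 0 \<and> \<phi> y = mpoly_eval p y / mpoly_eval q y)"
    using bspec[OF assms[unfolded regular_fun_def] aff_proj_in] by (rule exE)
  note W = conjunct1[OF W_props] conjunct1[OF conjunct2[OF W_props]]
  obtain p where p: "p \<in> polys m" and "\<exists>q\<in>polys m. \<forall>y\<in>W. mpoly_eval q y \<noteq> 0 \<and> \<phi> y = mpoly_eval p y / mpoly_eval q y"
    using conjunct2[OF conjunct2[OF conjunct2[OF W_props]]] by (rule bexE)
  from this(2) obtain q where q: "q \<in> polys m"
    and pq: "\<forall>y\<in>W. mpoly_eval q y \<noteq> 0 \<and> \<phi> y = mpoly_eval p y / mpoly_eval q y"
    by (rule bexE)
  obtain S where S: "S \<subseteq> polys m" "W = affine_space m - zero_locus m S"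
    using W(1) unfolding openin_zariski by blast
  then obtain w where w: "w \<in> S" "mpoly_eval w (?g s0) \<noteq> 0"
    using W(2) unfolding zero_locus_def by blast
  have w_W: "?g s \<in> W" if "mpoly_eval w (?g s) \<noteq> 0" for s
    unfolding S(2) zero_locus_def using w(1) that aff_proj_in by blast
  have pol: "\<exists>r. \<forall>s. poly r s = mpoly_eval p (?g s)" if "p \<in> polys m" for p
  proof -
    obtain r where "\<forall>s. poly r s = mpoly_eval p (\<lambda>j. poly [:a j, b j:] s)"
      using mpoly_eval_curve[of p "\<lambda>j. [:a j, b j:]"] by blast
    then show ?thesis using that by (intro exI[of _ r]) (simp add: mpoly_eval_aff_proj del: restrict_apply)
  qed
  obtain P where P: "\<forall>s. poly P s = mpoly_eval p (?g s)" using pol[OF p] by (rule exE)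
  obtain Q where Q: "\<forall>s. poly Q s = mpoly_eval q (?g s)" using pol[OF q] by (rule exE)
  have "w \<in> polys m" using w(1) S(1) by blast
  obtain w' where w': "\<forall>s. poly w' s = mpoly_eval w (?g s)" using pol[OF \<open>w \<in> polys m\<close>] by (rule exE)
  show "\<exists>P Q w. poly w s0 \<noteq> 0 \<and>
      (\<forall>s. poly w s \<noteq> 0 \<longrightarrow> poly Q s \<noteq> 0 \<and> \<phi> (?g s) = poly P s / poly Q s)"
  proof (rule exI[of _ P], rule exI[of _ Q], rule exI[of _ w'], intro conjI allI impI)
    show "poly w' s0 \<noteq> 0" using w(2) by (simp only: w'[rule_format] not_False_eq_True)
    fix s assume "poly w' s \<noteq> 0"
    then have "?g s \<in> W" using w_W by (simp only: w'[rule_format])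
    with pq have "mpoly_eval q (?g s) \<noteq> 0 \<and> \<phi> (?g s) = mpoly_eval p (?g s) / mpoly_eval q (?g s)"
      by (rule bspec)
    note vals = this
    show "poly Q s \<noteq> 0" unfolding Q[rule_format] by (rule conjunct1[OF vals])
    show "\<phi> (?g s) = poly P s / poly Q s"
      unfolding P[rule_format] Q[rule_format] by (rule conjunct2[OF vals])
  qed
qed

lemma variety_morphism_line:
  assumes f: "variety_morphism m n f" and i: "i < n"
  shows "\<exists>r. \<forall>s. poly r s = f (aff_proj m (\<lambda>j. a j + s * b j)) i"
proof -
  have reg: "regular_fun n (affine_space n) (\<lambda>x. x i)"
    unfolding regular_fun_def
  proof
    fix x assume x: "x \<in> affine_space n"
    have "openin (zariski n) (affine_space n)"
      using openin_topspace[of "zariski n"] by simp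
    with x i show "\<exists>W. openin (zariski n) W \<and> x \<in> W \<and> W \<subseteq> affine_space n \<and>
        (\<exists>p\<in>polys n. \<exists>q\<in>polys n. \<forall>y\<in>W. mpoly_eval q y \<noteq> 0 \<and> y i = mpoly_eval p y / mpoly_eval q y)"
      by (intro exI[of _ "affine_space n"] conjI bexI[OF bexI[OF _ polys_1] polys_var[OF i]]) auto
  qed
  have "openin (zariski n) (affine_space n)"
    using openin_topspace[of "zariski n"] by simp
  with f reg have "regular_fun m {x \<in> affine_space m. f x \<in> affine_space n} ((\<lambda>x. x i) \<circ> f)"
    unfolding variety_morphism_def by blast
  moreover have "{x \<in> affine_space m. f x \<in> affine_space n} = affine_space m"
    using f unfolding variety_morphism_def continuous_map_def topspace_zariski by blast
  ultimately have "regular_fun m (affine_space m) ((\<lambda>x. x i) \<circ> f)" by simp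
  from regular_fun_line[OF this, of a b] show ?thesis unfolding comp_apply .
qed

section \<open>Gauss' lemma for monic factors\<close>

text \<open>
  By multiplicativity of the content, the content of \<open>H\<close> accounts for its whole leading coefficient. In other
  words, a factor of \<open>P\<close> over the field of fractions that is monic has polynomial coefficients.
\<close>

lemma factor_of_monic:
  fixes P Q H :: "complex poly poly"
  assumes eq: "Polynomial.smult c P = Q * H" and unit: "is_unit (lead_coeff P)" and nz: "H \<noteq> 0" "c \<noteq> 0"
  shows "\<exists>H'. H = Polynomial.smult (lead_coeff H) H' \<and> lead_coeff H' = 1"
proof -
  have "P \<noteq> 0" using unit by auto
  then have "Q \<noteq> 0" using eq nz by auto
  have "Polynomial.content P dvd lead_coeff P" by (rule content_dvd_coeff)
  then have "is_unit (Polynomial.content P)" using unit by (rule dvd_trans)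
  then have cont_P: "Polynomial.content P = 1" by (metis is_unit_normalize normalize_content)
  let ?cH = "Polynomial.content H" and ?H = "primitive_part H"
  let ?cQ = "Polynomial.content Q" and ?Q = "primitive_part Q"
  have c_eq: "unit_factor c * (?cQ * ?cH) = c"
    using arg_cong[OF eq, of Polynomial.content] cont_P unit_factor_mult_normalize[of c]
    by (simp add: content_mult)
  have lQ: "lead_coeff Q = ?cQ * lead_coeff ?Q"
    by (metis content_times_primitive_part lead_coeff_smult)
  have lH: "lead_coeff H = ?cH * lead_coeff ?H"
    by (metis content_times_primitive_part lead_coeff_smult)
  have "c * lead_coeff P = lead_coeff Q * lead_coeff H"
    using arg_cong[OF eq, of lead_coeff] nz by (simp add: lead_coeff_mult)
  then have "(?cQ * ?cH) * (unit_factor c * lead_coeff P) = (?cQ * ?cH) * (lead_coeff ?Q * lead_coeff ?H)"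
    unfolding lQ lH by (subst (asm) c_eq[symmetric]) (simp only: mult_ac)
  moreover have "?cQ * ?cH \<noteq> 0" using nz \<open>Q \<noteq> 0\<close> by simp
  ultimately have "unit_factor c * lead_coeff P = lead_coeff ?Q * lead_coeff ?H"
    by (simp only: mult_cancel_left) blast
  moreover have "is_unit (unit_factor c * lead_coeff P)"
    unfolding is_unit_mult_iff using unit unit_factor_is_unit[OF nz(2)] by blast
  ultimately have "is_unit (lead_coeff ?Q * lead_coeff ?H)" by simp
  then have u: "is_unit (lead_coeff ?H)" unfolding is_unit_mult_iff by (rule conjunct2)
  define H' where "H' = Polynomial.smult (1 div lead_coeff ?H) ?H"
  have inv: "1 div lead_coeff ?H * lead_coeff ?H = 1"
    using u by (rule unit_div_mult_self[OF _ , of _ 1, simplified])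
  have "lead_coeff H' = 1"
    unfolding H'_def lead_coeff_smult by (rule inv)
  moreover have "Polynomial.smult (lead_coeff H) H' = H"
    using inv unfolding H'_def lH smult_smult mult.assoc by (simp add: mult.commute)
  ultimately show ?thesis by metis
qed

lemma monic_dvd_smult:
  fixes H G :: "complex poly poly"
  assumes "lead_coeff H = 1" "c \<noteq> 0" "H dvd Polynomial.smult c G"
  shows "H dvd G"
proof -
  have "Polynomial.content H dvd 1" using content_dvd_coeff[of H "degree H"] assms(1) by simp
  then have cont: "Polynomial.content H = 1" by (metis is_unit_normalize normalize_content)
  have "fract_poly H dvd fract_poly (Polynomial.smult c G)"
    using assms(3) by (rule fract_poly_dvd)
  then have "fract_poly H dvd fract_poly G"
    using assms(2) by (simp add: dvd_smult_iff)
  then show ?thesis using cont by (rule fract_poly_dvdD)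
qed

section \<open>Irreducible closed sets missed by a morphism\<close>

text \<open>
  An element of \<open>A[t]\<close> as a function on affine space: its coefficients are evaluated at the projection along
  \<open>e\<close> and the variable at coordinate \<open>k\<close>.
\<close>

definition eval_sheared :: "nat \<Rightarrow> (nat \<Rightarrow> complex) \<Rightarrow> mpoly poly \<Rightarrow> (nat \<Rightarrow> complex) \<Rightarrow> complex" where
  "eval_sheared k e P z = poly (eval_coeffs (shear k e z) P) (z k)"

lemma eval_coeffs_hom: "comm_ring_hom (eval_coeffs x)"
proof -
  interpret comm_ring_hom "\<lambda>c. mpoly_eval c x" by (rule mpoly_eval_hom)
  interpret mp: map_poly_comm_ring_hom "\<lambda>c. mpoly_eval c x" ..
  have "eval_coeffs x = map_poly (\<lambda>c. mpoly_eval c x)" by (rule ext) (simp add: eval_coeffs_def)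
  then show ?thesis using mp.comm_ring_hom_axioms by simp
qed

lemma eval_sheared_mult: "eval_sheared k e (P * Q) z = eval_sheared k e P z * eval_sheared k e Q z"
proof -
  interpret comm_ring_hom "eval_coeffs (shear k e z)" by (rule eval_coeffs_hom)
  show ?thesis by (simp add: eval_sheared_def hom_mult)
qed

lemma eval_sheared_diff: "eval_sheared k e (P - Q) z = eval_sheared k e P z - eval_sheared k e Q z"
proof -
  interpret comm_ring_hom "eval_coeffs (shear k e z)" by (rule eval_coeffs_hom)
  show ?thesis by (simp add: eval_sheared_def hom_minus)
qed

lemma eval_sheared_const: "eval_sheared k e [:c:] z = mpoly_eval c (shear k e z)"
  by (cases "c = 0") (simp_all add: eval_sheared_def eval_coeffs_def map_poly_pCons)

lemma shear_translate: "e k = 1 \<Longrightarrow> shear k e (\<lambda>i. z i + t * e i) = shear k e z"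
  by (auto simp: shear_def algebra_simps)

lemma mpolyfun_shear: "c \<in> polys k \<Longrightarrow> mpolyfun (Suc k) (\<lambda>z. mpoly_eval c (shear k e z))"
  by (rule mpolyfun_compose[OF mpolyfun_eval])
    (auto simp: shear_def intro!: mpolyfun_diff mpolyfun_mult mpolyfun_coord mpolyfun_const)

lemma mpolyfun_eval_sheared:
  assumes "P \<in> upolys k"
  shows "mpolyfun (Suc k) (eval_sheared k e P)"
proof -
  let ?w = "\<lambda>z. (shear k e z)(k := z k)"
  have "eval_sheared k e P z = mpoly_eval (poly P (var k)) (?w z)" for z
    unfolding mpoly_eval_poly_var eval_sheared_def eval_coeffs_def
    by (subst map_poly_eval_cong[of P k _ "shear k e z"]) (use assms in \<open>auto simp: upolys_def\<close>)
  then have "eval_sheared k e P = (\<lambda>z. mpoly_eval (poly P (var k)) (?w z))"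
    by (rule ext)
  moreover have "mpolyfun (Suc k) (\<lambda>z. mpoly_eval (poly P (var k)) (?w z))"
  proof (rule mpolyfun_compose[OF mpolyfun_eval[OF upolys_poly_var[OF assms]]])
    show "mpolyfun (Suc k) (\<lambda>z. ?w z i)" if "i < Suc k" for i
      using that by (cases "i = k")
        (auto simp: shear_def intro!: mpolyfun_diff mpolyfun_mult mpolyfun_coord mpolyfun_const)
  qed
  ultimately show ?thesis by simp
qed

lemma eval_sheared_aff_proj:
  "P \<in> upolys k \<Longrightarrow> eval_sheared k e P (aff_proj (Suc k) z) = eval_sheared k e P z"
  by (rule mpolyfun_cong[OF mpolyfun_eval_sheared]) simp_all

lemma polys_eq_eval_sheared:
  assumes "p \<in> polys (Suc k)" "e k = 1"
  shows "\<exists>P\<in>upolys k. \<forall>z. eval_sheared k e P z = mpoly_eval p z"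
proof -
  obtain P where P: "P \<in> upolys k" and "\<forall>z t. poly (eval_coeffs (shear k e z) P) (z k + t)
            = mpoly_eval p (\<lambda>i. z i + t * e i)"
    using polys_shear_ex_upoly[of p k e, OF assms] by (rule bexE)
  from this(2)[rule_format, of _ 0] have "eval_sheared k e P z = mpoly_eval p z" for z
    by (simp add: eval_sheared_def)
  with P show ?thesis by blast
qed

lemma eval_sheared_eq_0_imp:
  assumes P: "P \<in> upolys k" and e: "e k = 1" and zero: "\<And>z. eval_sheared k e P z = 0"
  shows "P = 0"
proof (rule poly_eqI)
  fix i
  have "mpoly_eval (coeff P i) x = 0" for x
  proof -
    let ?z = "\<lambda>t j. (x(k := 0)) j + t * e j"
    have "poly (eval_coeffs (shear k e (x(k := 0))) P) t = 0" for t
      using zero[of "?z t"] shear_translate[of e k "x(k := 0)" t, OF e] e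
      by (simp add: eval_sheared_def)
    then have "eval_coeffs (shear k e (x(k := 0))) P = 0"
      using poly_all_0_iff_0 by blast
    then have "mpoly_eval (coeff P i) (shear k e (x(k := 0))) = 0"
      by (metis coeff_eval_coeffs coeff_0)
    moreover have "mpoly_eval (coeff P i) (shear k e (x(k := 0))) = mpoly_eval (coeff P i) x"
      using P by (intro mpoly_eval_cong[of _ k]) (auto simp: upolys_def shear_def)
    ultimately show ?thesis by simp
  qed
  then have "coeff P i = 0"
    using mpoly_nonzero_ex_eval[OF upolys_coeff[OF P]] by blast
  then show "coeff P i = coeff 0 i" by simp
qed

lemma poly_poly_eval:
  assumes "\<sigma> 0 = 0"
  shows "poly (poly (map_poly \<sigma> F) g) s = poly (map_poly (\<lambda>c. poly (\<sigma> c) s) F) (poly g s)"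
  using assms by (induction F) (auto simp: map_poly_pCons)

text \<open>
  Along the polynomial curve \<open>\<gamma>\<close> the elements of \<open>A[t]\<close> become polynomials in \<open>t\<close> over \<open>\<complex>[s]\<close>. There \<open>H\<close>
  divides a multiple of \<open>P\<close>, which is monic up to a constant, so by Gauss' lemma it is its leading coefficient times a monic
  \<open>H'\<close>, and \<open>H'\<close> divides every element of \<open>I\<close>. On the curve, \<open>H'\<close> is a polynomial in \<open>s\<close>;
  a zero of it would be a common zero of \<open>I\<close> on the curve, which is excluded. So it is constant.
\<close>

lemma ratio_to_lead_coeff_constant_on_curve:
  assumes e: "e k = 1"
    and I: "\<And>F. F \<in> I \<Longrightarrow> F \<in> upolys k"
    and P: "P \<in> I" "lead_coeff P = Poly_Mapping.single 0 c0" "c0 \<noteq> 0"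
    and H: "H \<in> I" "H \<noteq> 0"
    and div: "\<And>F. F \<in> I \<Longrightarrow> \<exists>j Q. Polynomial.smult (lead_coeff H ^ j) F = Q * H"
    and off: "\<And>s. \<exists>F\<in>I. eval_sheared k e F (\<lambda>i. poly (\<gamma> i) s) \<noteq> 0"
    and nz: "mpoly_eval (lead_coeff H) (shear k e (\<lambda>i. poly (\<gamma> i) s\<^sub>0)) \<noteq> 0"
  shows "\<exists>c. \<forall>s. eval_sheared k e H (\<lambda>i. poly (\<gamma> i) s) =
     c * mpoly_eval (lead_coeff H) (shear k e (\<lambda>i. poly (\<gamma> i) s))"
proof -
  define x where "x = (\<lambda>s i. poly (\<gamma> i) s)"
  define \<delta> where "\<delta> = (\<lambda>i. \<gamma> i - \<gamma> k * [:e i:])"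
  have \<delta>: "(\<lambda>i. poly (\<delta> i) s) = shear k e (x s)" for s
    by (auto simp: \<delta>_def shear_def x_def)
  define \<sigma> where "\<sigma> = (\<lambda>p. SOME r. \<forall>s. poly r s = mpoly_eval p (\<lambda>i. poly (\<delta> i) s))"
  have \<sigma>: "poly (\<sigma> p) s = mpoly_eval p (shear k e (x s))" for p s
  proof -
    have "\<forall>s. poly (\<sigma> p) s = mpoly_eval p (\<lambda>i. poly (\<delta> i) s)"
      unfolding \<sigma>_def by (rule someI_ex[OF mpoly_eval_curve])
    then show ?thesis unfolding \<delta> by (rule spec)
  qed
  have hom: "comm_ring_hom \<sigma>"
    by standard (auto intro!: poly_ext simp: \<sigma> mpoly_eval_add mpoly_eval_mult)
  interpret comm_ring_hom \<sigma> by (rule hom)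
  interpret mp: map_poly_comm_ring_hom \<sigma> ..
  let ?M = "map_poly \<sigma>"
  have M_eval: "poly (poly (?M F) (\<gamma> k)) s = eval_sheared k e F (x s)" for F s
    by (subst poly_poly_eval) (simp_all add: \<sigma> eval_sheared_def eval_coeffs_def x_def)
  define lc where "lc = \<sigma> (lead_coeff H)"
  have lc_nz: "lc \<noteq> 0"
    using nz \<sigma>[of "lead_coeff H" s\<^sub>0] unfolding lc_def x_def by auto
  have coeffH: "coeff (?M H) (degree H) = lc"
    by (simp add: lc_def coeff_map_poly)
  have degH: "degree (?M H) = degree H"
    by (rule le_antisym[OF degree_map_poly_le le_degree]) (unfold coeffH, rule lc_nz)
  have leadH: "lead_coeff (?M H) = lc" unfolding degH by (rule coeffH)
  have "?M H \<noteq> 0" using coeffH lc_nz by (metis coeff_0)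
  have sc0: "\<sigma> (Poly_Mapping.single 0 c0) = [:c0:]"
    by (rule poly_ext) (simp add: \<sigma>)
  have coeffP: "coeff (?M P) (degree P) = [:c0:]"
    using P(2) sc0 by (simp add: coeff_map_poly)
  have degP: "degree (?M P) = degree P"
    by (rule le_antisym[OF degree_map_poly_le le_degree]) (unfold coeffP, simp add: P(3))
  have unitP: "is_unit (lead_coeff (?M P))"
    unfolding degP coeffP using P(3) by (simp add: is_unit_const_poly_iff)
  have divM: "\<exists>j Q. Polynomial.smult (lc ^ j) (?M F) = Q * ?M H" if F: "F \<in> I" for F
  proof -
    obtain j Q where "Polynomial.smult (lead_coeff H ^ j) F = Q * H" using div[OF F] by blast
    from arg_cong[OF this, of ?M] have "Polynomial.smult (lc ^ j) (?M F) = ?M Q * ?M H"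
      by (simp add: map_poly_hom_smult mp.hom_mult hom_power lc_def)
    then show ?thesis by blast
  qed
  obtain j Q where jQ: "Polynomial.smult (lc ^ j) (?M P) = Q * ?M H"
    using divM[OF P(1)] by blast
  have "lc ^ j \<noteq> 0" using lc_nz by simp
  from factor_of_monic[OF jQ unitP \<open>?M H \<noteq> 0\<close> this]
  obtain H' where H': "?M H = Polynomial.smult lc H'" "lead_coeff H' = 1"
    unfolding leadH by blast
  \<comment> \<open>A zero of \<open>H'\<close> on the curve would be a common zero of all of \<open>I\<close>.\<close>
  have "poly (poly H' (\<gamma> k)) s \<noteq> 0" for s
  proof
    assume zero: "poly (poly H' (\<gamma> k)) s = 0"
    obtain F where F: "F \<in> I" "eval_sheared k e F (x s) \<noteq> 0"
      using off[of s] unfolding x_def by blast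
    obtain i Q' where "Polynomial.smult (lc ^ i) (?M F) = Q' * ?M H"
      using divM[OF F(1)] by blast
    then have "H' dvd Polynomial.smult (lc ^ i) (?M F)"
      unfolding H'(1) by (simp add: dvd_smult)
    moreover have "lc ^ i \<noteq> 0" using lc_nz by simp
    ultimately have "H' dvd ?M F" using monic_dvd_smult[OF H'(2)] by blast
    then obtain R where "?M F = H' * R" by (rule dvdE)
    then have "poly (poly (?M F) (\<gamma> k)) s = 0" using zero by simp
    with F(2) show False by (simp add: M_eval)
  qed
  then have "constant (poly (poly H' (\<gamma> k)))"
    using fundamental_theorem_of_algebra by blast
  then obtain c where c: "poly H' (\<gamma> k) = [:c:]"
    by (metis constant_degree degree_eq_zeroE)
  have "eval_sheared k e H (x s) = c * mpoly_eval (lead_coeff H) (shear k e (x s))" for s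
    unfolding M_eval[symmetric] H'(1) using \<sigma>[of "lead_coeff H" s] by (simp add: c lc_def)
  then show ?thesis unfolding x_def by blast
qed


text \<open>
  Let \<open>H\<close> be a nonzero element of least degree along \<open>e\<close> in the ideal of \<open>Y\<close>. If the conclusion fails, that
  degree is positive. Pseudo-division by \<open>H\<close> leaves no remainder in the ideal, and the image of every line
  under \<open>f\<close> is a curve that misses \<open>Y\<close>. Hence \<open>H\<close> has constant ratio to its leading coefficient along
  each such curve. Any two points of the source lie on a line, so the ratio is the same on all of \<open>U\<close>; as
  \<open>U\<close> is dense, this is an identity of polynomials, and the degree of \<open>H\<close> is zero after all.
\<close>

lemma invariant_function_if_missed:
  assumes f: "variety_morphism m (Suc k) f" and U: "openin (zariski (Suc k)) U" "f ` affine_space m = U"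
    and Y: "closedin (zariski (Suc k)) Y" "Y \<inter> U = {}"
    and p\<^sub>0: "p\<^sub>0 \<in> polys (Suc k)" "vanishes_on p\<^sub>0 Y" and e: "e k = 1" and c\<^sub>0: "c\<^sub>0 \<noteq> 0"
    and lines: "constant_lead_along p\<^sub>0 e D c\<^sub>0"
  shows "\<exists>a\<in>polys k. a \<noteq> 0 \<and> (\<forall>y\<in>Y. mpoly_eval a (shear k e y) = 0)"
proof (rule ccontr)
  let ?n = "Suc k" and ?E = "eval_sheared k e"
  assume "\<not> ?thesis"
  then have none: "a = 0" if "a \<in> polys k" "\<forall>y\<in>Y. mpoly_eval a (shear k e y) = 0" for a
    using that by blast
  define I where "I = {F \<in> upolys k. \<forall>y\<in>Y. ?E F y = 0}"
  obtain P where P_up: "P \<in> upolys k" and P_props: "degree P = D \<and> lead_coeff P = Poly_Mapping.single 0 c\<^sub>0 \<and>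
    (\<forall>z t. poly (eval_coeffs (shear k e z) P) (z k + t)
      = mpoly_eval p\<^sub>0 (\<lambda>i. z i + t * e i))"
    using constant_lead_ex_upoly[of p\<^sub>0 k e c\<^sub>0 D, OF p\<^sub>0(1) e c\<^sub>0 lines] by (rule bexE)
  have P_lead: "lead_coeff P = Poly_Mapping.single 0 c\<^sub>0" by (rule conjunct1[OF conjunct2[OF P_props]])
  have "?E P z = mpoly_eval p\<^sub>0 z" for z
    using conjunct2[OF conjunct2[OF P_props], rule_format, of z 0]
    by (simp add: eval_sheared_def)
  then have P_I: "P \<in> I" using P_up p\<^sub>0(2) by (simp add: I_def vanishes_on_def)
  have "P \<noteq> 0" using P_lead c\<^sub>0 by (metis coeff_0 lookup_single_eq lookup_zero)
  obtain H where H: "H \<in> I" "H \<noteq> 0" and Hmin: "\<And>F. F \<in> I \<Longrightarrow> F \<noteq> 0 \<Longrightarrow> degree H \<le> degree F"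
    using arg_min_nat_lemma[of "\<lambda>H. H \<in> I \<and> H \<noteq> 0" P degree] P_I \<open>P \<noteq> 0\<close> by blast
  have I_up: "F \<in> upolys k" if "F \<in> I" for F using that by (simp add: I_def)
  have degH: "degree H > 0"
  proof (rule ccontr)
    assume "\<not> degree H > 0"
    then obtain a where a: "H = [:a:]" using degree_eq_zeroE[of H] by auto
    then have "a \<in> polys k" using upolys_coeff[OF I_up[OF H(1)], of 0] by simp
    moreover have "\<forall>y\<in>Y. mpoly_eval a (shear k e y) = 0"
      using H(1) by (simp add: I_def a eval_sheared_const)
    ultimately show False using none H(2) a by simp
  qed
  let ?l = "lead_coeff H"
  have l: "?l \<in> polys k" "?l \<noteq> 0" using upolys_coeff[OF I_up[OF H(1)]] H(2) by simp_all
  have div: "\<exists>j Q. Polynomial.smult (?l ^ j) F = Q * H" if F: "F \<in> I" for F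
  proof -
    obtain j Q R where QR: "Q \<in> upolys k" "R \<in> upolys k"
      "Polynomial.smult (?l ^ j) F = Q * H + R" "R = 0 \<or> degree R < degree H"
      using upolys_pseudo_division[OF I_up[OF H(1)] H(2) I_up[OF F]] by blast
    have R_eq: "R = [:?l ^ j:] * F - Q * H" using QR(3) by simp
    have "?E R y = 0" if "y \<in> Y" for y
      using F H(1) that unfolding R_eq eval_sheared_diff eval_sheared_mult by (simp add: I_def)
    then have "R \<in> I" using QR(2) by (simp add: I_def)
    then have "R = 0" using Hmin[of R] QR(4) by fastforce
    with QR(3) show ?thesis by auto
  qed
  have f_U: "f x \<in> U" if "x \<in> affine_space m" for x using U(2) that by blast
  have U_sub: "U \<subseteq> affine_space ?n" using openin_subset[OF U(1)] by simp
  obtain u0 where u0: "u0 \<in> U" using f_U[OF aff_proj_in] by blast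
  obtain S where S: "S \<subseteq> polys ?n" "U = affine_space ?n - zero_locus ?n S"
    using U(1) unfolding openin_zariski by blast
  then obtain w where w: "w \<in> S" "mpoly_eval w u0 \<noteq> 0"
    using u0 unfolding zero_locus_def by blast
  have w_polys: "w \<in> polys ?n" using w(1) S(1) by blast
  have w_U: "aff_proj ?n z \<in> U" if "mpoly_eval w z \<noteq> 0" for z
  proof -
    have "mpoly_eval w (aff_proj ?n z) \<noteq> 0" using that mpoly_eval_aff_proj[OF w_polys] by simp
    then show ?thesis unfolding S(2) zero_locus_def using w(1) aff_proj_in by blast
  qed
  have shear_aff: "mpoly_eval c (shear k e (aff_proj ?n z)) = mpoly_eval c (shear k e z)" if "c \<in> polys k" for c z
    by (rule mpolyfun_cong[OF mpolyfun_shear[OF that]]) simp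
  obtain x where x: "mpoly_eval ?l x \<noteq> 0" using mpoly_nonzero_ex_eval[OF l] by blast
  have "mpoly_eval ?l (shear k e (x(k := 0))) = mpoly_eval ?l x"
    using l(1) by (rule mpoly_eval_cong) (simp add: shear_def)
  with x have "mpoly_eval ?l (shear k e (x(k := 0))) \<noteq> 0" by simp
  then obtain z where z: "mpoly_eval ?l (shear k e z) \<noteq> 0" "mpoly_eval w z \<noteq> 0"
    using mpolyfun_nonzero_mult[OF mpolyfun_shear[OF l(1)] mpolyfun_eval[OF w_polys] _ w(2)] by blast
  obtain a where a: "a \<in> affine_space m" "f a = aff_proj ?n z"
    using w_U[OF z(2)] U(2) by (metis imageE)
  have l_a: "mpoly_eval ?l (shear k e (f a)) \<noteq> 0"
    unfolding a(2) using z(1) shear_aff[OF l(1)] by simp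
  define c where "c = ?E H (f a) / mpoly_eval ?l (shear k e (f a))"
  have ratio: "?E H (f b) = c * mpoly_eval ?l (shear k e (f b))" if b: "b \<in> affine_space m" for b
  proof -
    let ?g = "\<lambda>s. f (aff_proj m (\<lambda>j. a j + s * (b j - a j)))"
    have "\<forall>i. \<exists>r. i < ?n \<longrightarrow> (\<forall>s. poly r s = ?g s i)"
    proof
      fix i
      show "\<exists>r. i < ?n \<longrightarrow> (\<forall>s. poly r s = ?g s i)"
        using variety_morphism_line[OF f, of i a "\<lambda>j. b j - a j"] by (cases "i < ?n") auto
    qed
    then obtain \<gamma> where \<gamma>: "\<And>i s. i < ?n \<Longrightarrow> poly (\<gamma> i) s = ?g s i"
      by metis
    have ev: "F (\<lambda>i. poly (\<gamma> i) s) = F (?g s)" if "mpolyfun ?n F" for F s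
      by (rule mpolyfun_cong[OF that]) (rule \<gamma>)
    note ev_E = ev[OF mpolyfun_eval_sheared[OF I_up]] and ev_l = ev[OF mpolyfun_shear[OF l(1)]]
    have g0: "?g 0 = f a" using aff_proj_id[OF a(1)] by simp
    have g1: "?g 1 = f b" using aff_proj_id[OF b] by simp
    have "\<exists>c. \<forall>s. ?E H (\<lambda>i. poly (\<gamma> i) s) = c * mpoly_eval ?l (shear k e (\<lambda>i. poly (\<gamma> i) s))"
    proof (rule ratio_to_lead_coeff_constant_on_curve[where I = I and \<gamma> = \<gamma> and s\<^sub>0 = 0 and k = k and e = e and H = H and P = P, OF e I_up P_I P_lead c\<^sub>0 H div])
      fix s
      have "?g s \<in> U" by (rule f_U[OF aff_proj_in])
      with Y(2) U_sub have "?g s \<in> affine_space ?n" "?g s \<notin> Y" by blast+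
      then obtain p where p: "p \<in> polys ?n" "vanishes_on p Y" "mpoly_eval p (?g s) \<noteq> 0"
        using closedin_zariski_separate[OF Y(1)] by metis
      obtain F where F: "F \<in> upolys k" and FE: "\<forall>z. ?E F z = mpoly_eval p z"
        using polys_eq_eval_sheared[of p k e, OF p(1) e] by (rule bexE)
      have "F \<in> I" using F FE p(2) by (simp add: I_def vanishes_on_def)
      moreover have "?E F (\<lambda>i. poly (\<gamma> i) s) \<noteq> 0"
        unfolding ev_E[OF \<open>F \<in> I\<close>] FE[rule_format] by (rule p(3))
      ultimately show "\<exists>F\<in>I. ?E F (\<lambda>i. poly (\<gamma> i) s) \<noteq> 0" by blast
    next
      show "mpoly_eval ?l (shear k e (\<lambda>i. poly (\<gamma> i) 0)) \<noteq> 0"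
        unfolding ev_l g0 by (rule l_a)
    qed
    then obtain c' where "\<forall>s. ?E H (\<lambda>i. poly (\<gamma> i) s) = c' * mpoly_eval ?l (shear k e (\<lambda>i. poly (\<gamma> i) s))"
      by (rule exE)
    then have c': "?E H (?g s) = c' * mpoly_eval ?l (shear k e (?g s))" for s
      unfolding ev_E[OF H(1)] ev_l by (rule spec)
    from c'[of 0, unfolded g0] l_a have "c' = c" by (simp add: c_def)
    with c'[of 1, unfolded g1] show ?thesis by simp
  qed
  \<comment> \<open>So \<open>H\<close> agrees on \<open>U\<close>, hence everywhere, with a multiple of its leading coefficient.\<close>
  define H' where "H' = H - [:Poly_Mapping.single 0 c * ?l:]"
  have H'_up: "H' \<in> upolys k"
    unfolding H'_def by (intro upolys_diff upolys_const polys_mult polys_const l I_up H)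
  have H'_U: "?E H' u = 0" if u: "u \<in> U" for u
  proof -
    obtain b where "b \<in> affine_space m" "u = f b" using U(2) u by blast
    then show ?thesis
      using ratio[of b] by (simp add: H'_def eval_sheared_diff eval_sheared_const mpoly_eval_mult)
  qed
  have "?E H' z = 0" for z
  proof (rule ccontr)
    assume "?E H' z \<noteq> 0"
    then obtain y where y: "?E H' y \<noteq> 0" "mpoly_eval w y \<noteq> 0"
      using mpolyfun_nonzero_mult[OF mpolyfun_eval_sheared[OF H'_up] mpolyfun_eval[OF w_polys] _ w(2)] by blast
    have "?E H' (aff_proj ?n y) = 0" by (rule H'_U[OF w_U[OF y(2)]])
    with y(1) show False using eval_sheared_aff_proj[OF H'_up] by simp
  qed
  then have "H' = 0" by (rule eval_sheared_eq_0_imp[of H' k e, OF H'_up e])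
  then have "H = [:Poly_Mapping.single 0 c * ?l:]" by (simp add: H'_def)
  then have "degree H = 0" by (metis degree_pCons_0)
  with degH show False by simp
qed

text \<open>
  The set \<open>W\<close> consists of the common zeros of all polynomials that are constant along \<open>e\<close> and vanish on \<open>Y\<close>. It is
  irreducible: a polynomial that does not vanish on \<open>W\<close> has a coefficient along \<open>e\<close> that does not vanish on
  \<open>Y\<close>; for two such polynomials, \<open>Y\<close> has a point where both coefficients are nonzero, and on the line through
  that point, which lies in \<open>W\<close>, neither polynomial is identically zero. It differs from \<open>Y\<close>, because on a
  line in direction \<open>e\<close> the polynomial \<open>p\<^sub>0\<close> has only finitely many zeros.
\<close>

lemma irreducible_cylinder_between:
  assumes Y: "irreducible_closed (zariski (Suc k)) Y" and e: "e k = 1"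
    and p\<^sub>0: "vanishes_on p\<^sub>0 Y" "p\<^sub>0 \<in> polys (Suc k)" and c\<^sub>0: "c\<^sub>0 \<noteq> 0"
    and lines: "constant_lead_along p\<^sub>0 e D c\<^sub>0"
    and a: "a \<in> polys k" "a \<noteq> 0" "\<forall>y\<in>Y. mpoly_eval a (shear k e y) = 0"
  shows "\<exists>W. irreducible_closed (zariski (Suc k)) W \<and> Y \<subset> W \<and> W \<subset> affine_space (Suc k)"
proof -
  let ?n = "Suc k" and ?E = "eval_sheared k e"
  have Y': "closedin (zariski ?n) Y" "Y \<noteq> {}" "prime_on ?n Y"
    using Y by (simp_all add: irreducible_closed_zariski_iff)
  define I where "I = {b \<in> polys k. \<forall>y\<in>Y. mpoly_eval b (shear k e y) = 0}"
  define W where "W = {x \<in> affine_space ?n. \<forall>b\<in>I. mpoly_eval b (shear k e x) = 0}"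
  have shear_aff: "mpoly_eval c (shear k e (aff_proj ?n z)) = mpoly_eval c (shear k e z)" if "c \<in> polys k" for c z
    by (rule mpolyfun_cong[OF mpolyfun_shear[OF that]]) simp
  have Y_sub: "Y \<subseteq> affine_space ?n" by (rule closedin_zariski_subset[OF Y'(1)])
  have YW: "Y \<subseteq> W" using Y_sub by (auto simp: W_def I_def)
  have line_W: "aff_proj ?n (\<lambda>i. y i + t * e i) \<in> W" if "y \<in> W" for y t
    using that shear_aff shear_translate[of e k y t, OF e] unfolding W_def I_def by simp
  define S where "S = {p \<in> polys ?n. \<exists>b\<in>I. \<forall>z. mpoly_eval p z = mpoly_eval b (shear k e z)}"
  have W_eq: "W = zero_locus ?n S"
  proof -
    have "\<exists>p\<in>S. \<forall>z. mpoly_eval p z = mpoly_eval b (shear k e z)" if "b \<in> I" for b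
    proof -
      have "mpolyfun ?n (\<lambda>z. mpoly_eval b (shear k e z))"
        using that by (intro mpolyfun_shear) (simp add: I_def)
      then obtain p where p: "p \<in> polys ?n" "(\<lambda>z. mpoly_eval b (shear k e z)) = mpoly_eval p"
        by (rule mpolyfunE)
      have "\<forall>z. mpoly_eval p z = mpoly_eval b (shear k e z)" using fun_cong[OF p(2)] by simp
      with p(1) that show ?thesis unfolding S_def by blast
    qed
    note ex = this
    have iff: "(\<forall>b\<in>I. mpoly_eval b (shear k e x) = 0) \<longleftrightarrow> (\<forall>p\<in>S. mpoly_eval p x = 0)" for x
    proof (intro iffI ballI)
      fix p assume "\<forall>b\<in>I. mpoly_eval b (shear k e x) = 0" "p \<in> S"
      then show "mpoly_eval p x = 0" by (auto simp: S_def)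
    next
      fix b assume all: "\<forall>p\<in>S. mpoly_eval p x = 0" and b: "b \<in> I"
      obtain p where "p \<in> S" "\<forall>z. mpoly_eval p z = mpoly_eval b (shear k e z)"
        using ex[OF b] by (rule bexE)
      note p = this
      have "mpoly_eval p x = 0" by (rule bspec[OF all p(1)])
      then show "mpoly_eval b (shear k e x) = 0" by (simp only: p(2)[rule_format])
    qed
    show ?thesis by (simp only: W_def zero_locus_def iff)
  qed
  have "S \<subseteq> polys ?n" by (auto simp: S_def)
  then have W_closed: "closedin (zariski ?n) W"
    unfolding closedin_zariski W_eq by (intro exI[of _ S] conjI refl)
  have "prime_on ?n W"
    unfolding prime_on_def
  proof (intro ballI impI, rule ccontr)
    fix p q assume p: "p \<in> polys ?n" and q: "q \<in> polys ?n" and pq: "vanishes_on (p * q) W"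
      and neg: "\<not> (vanishes_on p W \<or> vanishes_on q W)"
    have coeff: "\<exists>P\<in>upolys k. (\<forall>z. ?E P z = mpoly_eval p z) \<and> (\<exists>i. coeff P i \<notin> I)"
      if p: "p \<in> polys ?n" "\<not> vanishes_on p W" for p
    proof -
      obtain P where P: "P \<in> upolys k" and PE: "\<forall>z. ?E P z = mpoly_eval p z"
        using polys_eq_eval_sheared[of p k e, OF p(1) e] by (rule bexE)
      obtain x where x: "x \<in> W" "mpoly_eval p x \<noteq> 0" using p(2) by (auto simp: vanishes_on_def)
      then have "?E P x \<noteq> 0" using PE by simp
      then have "eval_coeffs (shear k e x) P \<noteq> 0" by (auto simp: eval_sheared_def)
      then obtain i where "mpoly_eval (coeff P i) (shear k e x) \<noteq> 0"
        by (metis coeff_eval_coeffs leading_coeff_0_iff)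
      then have "coeff P i \<notin> I" using x(1) by (auto simp: W_def)
      with P PE show ?thesis by blast
    qed
    obtain P i where P: "P \<in> upolys k" "\<forall>z. ?E P z = mpoly_eval p z" "coeff P i \<notin> I"
      using coeff[OF p] neg by blast
    obtain Q j where Q: "Q \<in> upolys k" "\<forall>z. ?E Q z = mpoly_eval q z" "coeff Q j \<notin> I"
      using coeff[OF q] neg by blast
    have "\<exists>y\<in>Y. mpoly_eval (coeff P i) (shear k e y) \<noteq> 0 \<and> mpoly_eval (coeff Q j) (shear k e y) \<noteq> 0"
    proof (rule ccontr)
      assume not: "\<not> ?thesis"
      obtain b where b: "b \<in> polys ?n" "(\<lambda>z. mpoly_eval (coeff P i) (shear k e z)) = mpoly_eval b"
        using mpolyfun_shear[OF upolys_coeff[OF P(1)], of i e] by (rule mpolyfunE)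
      obtain d where d: "d \<in> polys ?n" "(\<lambda>z. mpoly_eval (coeff Q j) (shear k e z)) = mpoly_eval d"
        using mpolyfun_shear[OF upolys_coeff[OF Q(1)], of j e] by (rule mpolyfunE)
      have "vanishes_on b Y \<or> vanishes_on d Y"
        using not by (intro prime_onD[OF Y'(3) b(1) d(1)]) (auto simp: b(2)[symmetric] d(2)[symmetric])
      then show False
        using P(3) Q(3) upolys_coeff[OF P(1)] upolys_coeff[OF Q(1)]
        unfolding vanishes_on_def b(2)[symmetric] d(2)[symmetric] I_def by blast
    qed
    then obtain y where y: "y \<in> Y" "mpoly_eval (coeff P i) (shear k e y) \<noteq> 0"
      "mpoly_eval (coeff Q j) (shear k e y) \<noteq> 0" by blast
    let ?P = "eval_coeffs (shear k e y) P" and ?Q = "eval_coeffs (shear k e y) Q"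
    have "?P \<noteq> 0" "?Q \<noteq> 0" using y by (metis coeff_eval_coeffs coeff_0)+
    then have "?P * ?Q \<noteq> 0" by simp
    then obtain t where t: "poly (?P * ?Q) t \<noteq> 0" using poly_all_0_iff_0 by blast
    let ?y = "\<lambda>i. y i + (t - y k) * e i"
    have sh: "shear k e ?y = shear k e y" by (rule shear_translate[of e k y "t - y k", OF e])
    have "mpoly_eval p ?y = poly ?P t" "mpoly_eval q ?y = poly ?Q t"
      using P(2)[rule_format, of ?y] Q(2)[rule_format, of ?y] e by (simp_all add: eval_sheared_def sh)
    then have "mpoly_eval (p * q) ?y \<noteq> 0" using t by (simp add: mpoly_eval_mult)
    then have "mpoly_eval (p * q) (aff_proj ?n ?y) \<noteq> 0"
      using mpoly_eval_aff_proj[OF polys_mult[OF p q]] by simp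
    moreover have "aff_proj ?n ?y \<in> W" using y(1) YW by (intro line_W) blast
    ultimately show False using pq unfolding vanishes_on_def by blast
  qed
  moreover have "W \<noteq> {}" using YW Y'(2) by blast
  ultimately have "irreducible_closed (zariski ?n) W"
    using W_closed by (simp add: irreducible_closed_zariski_iff)
  moreover have "Y \<noteq> W"
  proof
    assume eq: "Y = W"
    obtain y where y: "y \<in> Y" using Y'(2) by blast
    obtain r where r: "coeff r D = c\<^sub>0" "\<And>t. poly r t = mpoly_eval p\<^sub>0 (\<lambda>i. y i + t * e i)"
      using lines unfolding constant_lead_along_def by blast
    have "poly r t = 0" for t
    proof -
      have "aff_proj ?n (\<lambda>i. y i + t * e i) \<in> Y" using line_W[of y t] y eq by simp
      then have "mpoly_eval p\<^sub>0 (aff_proj ?n (\<lambda>i. y i + t * e i)) = 0"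
        using p\<^sub>0(1) unfolding vanishes_on_def by blast
      then show ?thesis using r(2) mpoly_eval_aff_proj[OF p\<^sub>0(2)] by simp
    qed
    then have "r = 0" using poly_all_0_iff_0 by blast
    with r(1) c\<^sub>0 show False by simp
  qed
  moreover have "W \<noteq> affine_space ?n"
  proof
    assume eq: "W = affine_space ?n"
    obtain x where x: "mpoly_eval a x \<noteq> 0" using mpoly_nonzero_ex_eval[OF a(1,2)] by blast
    have "mpoly_eval a (shear k e (x(k := 0))) = mpoly_eval a x"
      using a(1) by (rule mpoly_eval_cong) (simp add: shear_def)
    with x shear_aff[OF a(1), of "x(k := 0)"]
    have "mpoly_eval a (shear k e (aff_proj ?n (x(k := 0)))) \<noteq> 0" by simp
    moreover have "aff_proj ?n (x(k := 0)) \<in> W" unfolding eq by (rule aff_proj_in)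
    moreover have "a \<in> I" using a by (simp add: I_def)
    ultimately show False unfolding W_def by blast
  qed
  ultimately show ?thesis using YW closedin_zariski_subset[OF W_closed] by blast
qed

section \<open>The characterization\<close>

text \<open>
  In dimension zero there is no direction to work with; the single point is either all of \<open>U\<close> or all of its complement.
\<close>

lemma affine_space_0: "x \<in> affine_space 0 \<Longrightarrow> y \<in> affine_space 0 \<Longrightarrow> x = y"
  by (simp add: affine_space_def)

lemma codim_complement_of_image:
  assumes f: "variety_morphism m n f" and U: "openin (zariski n) U" "f ` affine_space m = U"
  shows "codim (zariski n) (affine_space n - U) \<ge> 2"
  unfolding codim_ge_2_iff
proof (intro allI impI, elim conjE)
  fix Y assume Y: "irreducible_closed (zariski n) Y" and sub: "Y \<subseteq> affine_space n - U"
  have Y': "closedin (zariski n) Y" "Y \<noteq> {}"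
    using Y by (simp_all add: irreducible_closed_zariski_iff)
  obtain u where u: "u \<in> U" using U(2) aff_proj_in by blast
  then have u_aff: "u \<in> affine_space n" "u \<notin> Y"
    using openin_subset[OF U(1)] sub by auto
  obtain y where y: "y \<in> Y" "y \<in> affine_space n" using Y'(2) sub by blast
  show "\<exists>Z\<^sub>1 Z\<^sub>2. irreducible_closed (zariski n) Z\<^sub>1 \<and> irreducible_closed (zariski n) Z\<^sub>2 \<and> Y \<subset> Z\<^sub>1 \<and> Z\<^sub>1 \<subset> Z\<^sub>2"
  proof (cases n)
    case 0
    with u_aff y have "u = y" using affine_space_0 by blast
    with u_aff y show ?thesis by blast
  next
    case [simp]: (Suc k)
    obtain p where p: "p \<in> polys (Suc k)" "vanishes_on p Y" "mpoly_eval p u \<noteq> 0"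
      using closedin_zariski_separate[OF Y'(1) u_aff] by auto
    then have "p \<noteq> 0" by auto
    obtain a where a: "a \<in> polys k" and "\<exists>D. a \<noteq> 0 \<and> (\<forall>e. e k = 1 \<longrightarrow> mpoly_eval a e \<noteq> 0 \<longrightarrow>
        constant_lead_along p e D (mpoly_eval a e))"
      using generic_direction[OF p(1) \<open>p \<noteq> 0\<close>] by (rule bexE)
    then obtain D where a_D: "a \<noteq> 0 \<and> (\<forall>e. e k = 1 \<longrightarrow> mpoly_eval a e \<noteq> 0 \<longrightarrow>
        constant_lead_along p e D (mpoly_eval a e))"
      by (elim exE)
    obtain w where w: "mpoly_eval a w \<noteq> 0" using mpoly_nonzero_ex_eval[OF a] a_D by blast
    define e where "e = w(k := 1)"
    have e: "e k = 1" "mpoly_eval a e \<noteq> 0"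
      using w mpoly_eval_cong[OF a, of e w] by (auto simp: e_def)
    note lead = conjunct2[OF a_D, rule_format, OF e]
    have "Y \<inter> U = {}" using sub by blast
    then obtain b where b: "b \<in> polys k" "b \<noteq> 0 \<and> (\<forall>y\<in>Y. mpoly_eval b (shear k e y) = 0)"
      using invariant_function_if_missed[OF f[unfolded Suc] U(1)[unfolded Suc] U(2) Y'(1)[unfolded Suc] _ p(1,2) e(1,2) lead]
      by blast
    obtain W where "irreducible_closed (zariski (Suc k)) W \<and> Y \<subset> W \<and> W \<subset> affine_space (Suc k)"
      using irreducible_cylinder_between[OF Y[unfolded Suc] e(1) p(2,1) e(2) lead b(1) conjunct1[OF b(2)] conjunct2[OF b(2)]]
      by (rule exE)
    then show ?thesis
      using irreducible_closed_affine_space[of n] by auto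
  qed
qed

lemma image_of_codim_complement:
  assumes U: "openin (zariski n) U" and codim: "codim (zariski n) (affine_space n - U) \<ge> 2"
  shows "\<exists>m f. variety_morphism m n f \<and> f ` affine_space m = U"
proof -
  let ?Z = "affine_space n - U"
  have U_sub: "U \<subseteq> affine_space n" using openin_subset[OF U] by simp
  have Z: "closedin (zariski n) ?Z"
    using U by (simp add: closedin_def double_diff U_sub)
  show ?thesis
  proof (cases "?Z = {}")
    case True
    then have "U = affine_space n" using U_sub by blast
    moreover have "aff_proj n ` affine_space n = affine_space n"
      using aff_proj_id by force
    moreover have "variety_morphism n n (aff_proj n)"
      using variety_morphism_polymap[of n n "\<lambda>y. y"] by (simp add: mpolyfun_coord)
    ultimately show ?thesis by blast
  next
    case False
    have "U \<noteq> {}"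
    proof
      assume "U = {}"
      then obtain Z1 where "irreducible_closed (zariski n) Z1" "affine_space n \<subset> Z1"
        using codim irreducible_closed_affine_space[of n] unfolding codim_ge_2_iff by blast
      then show False
        using closedin_zariski_subset unfolding irreducible_closed_def by blast
    qed
    then obtain x where x: "x \<in> U" by blast
    obtain z where z: "z \<in> ?Z" using False by blast
    obtain k where n: "n = Suc k"
    proof (cases n)
      case 0
      then have "x = z" using x z U_sub affine_space_0 by blast
      then show ?thesis using x z by blast
    qed
    have "aff_proj n x \<notin> ?Z" using x U_sub aff_proj_id[of x n] by auto
    then obtain m \<phi> where phi: "polymap_avoiding n ?Z m \<phi>"
      and onto: "\<And>x. aff_proj n x \<notin> ?Z \<Longrightarrow> \<exists>y. \<forall>i<n. \<phi> y i = x i"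
      using polymap_onto_complement[of k ?Z x] Z codim unfolding n by blast
    have poly: "mpolyfun m (\<lambda>y. \<phi> y i)" for i
      using phi by (simp add: polymap_avoiding_def)
    have "(\<lambda>y. aff_proj n (\<phi> y)) ` affine_space m = U"
    proof (intro equalityI subsetI)
      fix u assume "u \<in> (\<lambda>y. aff_proj n (\<phi> y)) ` affine_space m"
      then obtain y where "u = aff_proj n (\<phi> y)" by blast
      moreover have "aff_proj n (\<phi> y) \<notin> ?Z" using phi by (simp add: polymap_avoiding_def)
      ultimately show "u \<in> U" using aff_proj_in[of "\<phi> y" n] by blast
    next
      fix u assume u: "u \<in> U"
      then have u_id: "aff_proj n u = u" using U_sub aff_proj_id by blast
      then have "aff_proj n u \<notin> ?Z" using u by simp
      then obtain y where y: "\<forall>i<n. \<phi> y i = u i" using onto by blast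
      have "\<phi> (aff_proj m y) i = \<phi> y i" for i
        by (rule mpolyfun_cong[OF poly]) simp
      then have "aff_proj n (\<phi> (aff_proj m y)) = aff_proj n u"
        using y by (intro aff_proj_cong) simp
      then have "u = aff_proj n (\<phi> (aff_proj m y))" using u_id by simp
      then show "u \<in> (\<lambda>y. aff_proj n (\<phi> y)) ` affine_space m"
        using aff_proj_in by (rule image_eqI)
    qed
    with variety_morphism_polymap[of n m \<phi>] poly show ?thesis by blast
  qed
qed

theorem corollary1p4:
  fixes n :: nat and U :: "(nat \<Rightarrow> complex) set"
  assumes "openin (zariski n) U"
  shows "(\<exists>m f. variety_morphism m n f \<and> f ` affine_space m = U) \<longleftrightarrow>
         codim (zariski n) (affine_space n - U) \<ge> 2"
  using assms codim_complement_of_image image_of_codim_complement by blast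

end
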